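(* Let $P_{S_eS}$ be the joint distribution of side information and state, let $P_{YZ|XS}$ be the channel, let $d$ be the distortion measure, and let $R_E\ge0$ be the henchman's rate. For $D\ge0$, $D_E\ge0$ let $C(D,D_E,0)$ be the set of all pairs $(R,R_c)\in\mathbb{R}^2$ with $R\ge0$, $R_c\ge0$ for which there exists $P_{S_eSUXYZ\hat S}\in\mathcal{P}$ such that $$R\le I(U;Y)-I(U;S_e),\qquad R_c\ge\max\{I(U;\hat S)-I(U;Y),0\},\qquad D\ge\mathbb{E}[d(S,\hat S)],$$ $$D_E\le\begin{cases}D(R_E,P_{\hat SY}) & \text{if } R_E<R_c,\\ \min\{D(R_E,P_{\hat SY}),\,D(R_E-R_c,P_{U\hat SY})\} & \text{if } R_E\ge R_c.\end{cases}$$ Then $C(D,D_E,0)$ is an inner bound of the secure common-randomness-assisted distribution-preserving capacity-distortion region: every $(R,R_c)\in C(D,D_E,0)$ belongs to the secure $(D,D_E,0)$-capacity-distortion region.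
   Context: All alphabets $\mathcal{S}_e,\mathcal{S}=\hat{\mathcal{S}}=\hat{\mathcal{S}}_E,\mathcal{X},\mathcal{Y},\mathcal{Z}$ are finite. Given are a distribution $P_{S_eS}$ with marginal $P_S$, a channel $P_{YZ|XS}$, and a distortion measure $d:\mathcal{S}\times\mathcal{S}\to[0,\infty)$ with $d(s^n,\hat s^n)=\frac1n\sum_{i=1}^nd(s_i,\hat s_i)$. The pairs $(S_{e,i},S_i)$ are i.i.d. $\sim P_{S_eS}$, and the channel is memoryless: given $X^n,S^n$, the pair $(Y^n,Z^n)$ has law $\prod_iP_{YZ|XS}$. $Y^n$ is the receiver's output, and $Z^n$ is feedback to the state estimator at the sender. An $(n,R,R_c)$ common-randomness-assisted code consists of: a message $M$ uniform on $\mathcal{M}=[1:2^{nR}]$; common randomness $\Gamma$ uniform on $[1:2^{nR_c}]$ ($M$, $\Gamma$, $(S_e^n,S^n)$ independent); a (possibly stochastic) encoder mapping $(M,S_e^n,\Gamma)$ to $X^n$ (noncausal knowledge of $S_e^n$); a decoder mapping $(Y^n,\Gamma)$ to $\hat M\in\mathcal{M}$; and a (possibly stochastic) state estimator mapping $(\Gamma,X^n,S_e^n,Z^n)$ to $\hat S^n$. Henchman and eavesdropper: a henchman of rate $R_E$ observes $\hat S^n,Y^n,\Gamma$ and sends $M_E=f_E(\hat S^n,Y^n,\Gamma)\in[1:2^{nR_E}]$ to an eavesdropper, who observes $Y^n$ but not $\Gamma$ and outputs $\hat S_E^n=g_E(Y^n,M_E)$. Both $f_E$ and $g_E$ may be chosen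 with knowledge of the code (codebook) used by the legitimate parties. $(R,R_c)$ is $(D,D_E,0)$-achievable if for every $\epsilon>0$ and all sufficiently large $n$ there is an $(n,R,R_c)$ code with $\Pr\{M\neq\hat M\}\le\epsilon$, $P_{\hat S^n}=P_S^n:=\prod_{i=1}^nP_S$ (zero total variation distance), $\mathbb{E}[d(S^n,\hat S^n)]\le D$, and $\mathbb{E}[d(\hat S^n,\hat S_E^n)]\ge D_E$ for every pair $(f_E,g_E)$ of rate $R_E$. The secure $(D,D_E,0)$-capacity-distortion region is the set of $(R,R_c)$ such that $(R,R_c,D,D_E)$ lies in the closure of the set of $(R',R_c',D',D_E')$ for which $(R',R_c')$ is $(D',D_E',0)$-achievable. $\mathcal{P}$ is the set of joint distributions (with $U$ an auxiliary variable on some finite alphabet) of the form $$P_{S_eS}(s_e,s)\,P_{U|S_e}(u|s_e)\,P_{X|US_e}(x|u,s_e)\,P_{YZ|XS}(y,z|x,s)\,P_{\hat S|XS_eZ}(\hat s|x,s_e,z)$$ with $P_{\hat S}=P_S$. Conditional distortion-rate functions: for $r\ge0$, $$D(r,P_{\hat SY})=\min_{P_{\hat S_E|\hat SY}:\,I(\hat S;\hat S_E|Y)\le r}\mathbb{E}[d(\hat S,\hat S_E)],\qquad D(r,P_{U\hat SY})=\min_{P_{\hat S_E|U\hat SY}:\,I(\hat S;\hat S_E|U,Y)\le r}\mathbb{E}[d(\hat S,\hat S_E)],$$ where $\hat S$ is the source and $Y$ (resp. $(U,Y)$) is side information at both sides. Both are $\infty$ for $r<0$. *)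

theory Defs
  imports "HOL-Probability.Probability"
begin

(* Conventions. The finite alphabets are types of class finite. An n-letter sequence over 'a is an
   extensional function {..<n} -> 'a (value undefined off {..<n}); the default value of Pi_pmf is
   undefined accordingly. This matters: an unrestricted function could carry extra randomness from
   the encoder to the estimator in its values off {..<n}. Logarithms are to base 2. *)

definition seqs :: "nat \<Rightarrow> (nat \<Rightarrow> 'a) set" where
  "seqs n = ({..<n} \<rightarrow>\<^sub>E UNIV)"

definition iid :: "nat \<Rightarrow> 'a pmf \<Rightarrow> (nat \<Rightarrow> 'a) pmf" where
  "iid n p = Pi_pmf {..<n} undefined (\<lambda>_. p)"

definition avg_dist :: "('s \<Rightarrow> 's \<Rightarrow> real) \<Rightarrow> nat \<Rightarrow> (nat \<Rightarrow> 's) \<Rightarrow> (nat \<Rightarrow> 's) \<Rightarrow> real" where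
  "avg_dist d n s t = (\<Sum>i<n. d (s i) (t i)) / real n"

(* The integer interval [1:2^(n r)]; for r \<ge> 0 it is nonempty. *)
definition index_set :: "nat \<Rightarrow> real \<Rightarrow> nat set" where
  "index_set n r = {k. 1 \<le> k \<and> real k \<le> 2 powr (real n * r)}"


section \<open>Codes\<close>

(* Encoder (M, Se^n, Gamma), decoder (Y^n, Gamma), estimator (Gamma, X^n, Se^n, Z^n). *)
record ('e, 's, 'x, 'y, 'z) ca_code =
  encoder :: "nat \<Rightarrow> (nat \<Rightarrow> 'e) \<Rightarrow> nat \<Rightarrow> (nat \<Rightarrow> 'x) pmf"
  decoder :: "(nat \<Rightarrow> 'y) \<Rightarrow> nat \<Rightarrow> nat"
  estimator :: "nat \<Rightarrow> (nat \<Rightarrow> 'x) \<Rightarrow> (nat \<Rightarrow> 'e) \<Rightarrow> (nat \<Rightarrow> 'z) \<Rightarrow> (nat \<Rightarrow> 's) pmf"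

definition is_code :: "nat \<Rightarrow> real \<Rightarrow> real \<Rightarrow> ('e, 's, 'x, 'y, 'z) ca_code \<Rightarrow> bool" where
  "is_code n R Rc c \<longleftrightarrow>
     (\<forall>m \<in> index_set n R. \<forall>se \<in> seqs n. \<forall>\<gamma> \<in> index_set n Rc.
        set_pmf (encoder c m se \<gamma>) \<subseteq> seqs n) \<and>
     (\<forall>y \<in> seqs n. \<forall>\<gamma> \<in> index_set n Rc. decoder c y \<gamma> \<in> index_set n R) \<and>
     (\<forall>\<gamma> \<in> index_set n Rc. \<forall>x \<in> seqs n. \<forall>se \<in> seqs n. \<forall>z \<in> seqs n.
        set_pmf (estimator c \<gamma> x se z) \<subseteq> seqs n)"

(* Joint law of (M, Gamma, Se^n, S^n, X^n, Y^n, Z^n, S_hat^n). *)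
definition code_law ::
  "('e \<times> 's) pmf \<Rightarrow> ('x \<Rightarrow> 's \<Rightarrow> ('y \<times> 'z) pmf) \<Rightarrow> nat \<Rightarrow> real \<Rightarrow> real \<Rightarrow>
   ('e, 's, 'x, 'y, 'z) ca_code \<Rightarrow>
   (nat \<times> nat \<times> (nat \<Rightarrow> 'e) \<times> (nat \<Rightarrow> 's) \<times> (nat \<Rightarrow> 'x) \<times> (nat \<Rightarrow> 'y) \<times> (nat \<Rightarrow> 'z) \<times> (nat \<Rightarrow> 's)) pmf"
where
  "code_law P W n R Rc c = do {
     m \<leftarrow> pmf_of_set (index_set n R);
     \<gamma> \<leftarrow> pmf_of_set (index_set n Rc);
     es \<leftarrow> iid n P;
     let se = (\<lambda>i\<in>{..<n}. fst (es i));
     let s = (\<lambda>i\<in>{..<n}. snd (es i));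
     x \<leftarrow> encoder c m se \<gamma>;
     yz \<leftarrow> Pi_pmf {..<n} undefined (\<lambda>i. W (x i) (s i));
     let y = (\<lambda>i\<in>{..<n}. fst (yz i));
     let z = (\<lambda>i\<in>{..<n}. snd (yz i));
     sh \<leftarrow> estimator c \<gamma> x se z;
     return_pmf (m, \<gamma>, se, s, x, y, z, sh)
   }"


section \<open>Achievability and the capacity-distortion region\<close>

(* The henchman sees S_hat^n, Y^n and Gamma; the eavesdropper sees Y^n and the henchman's index.
   Both strategies are chosen after the code c. *)
definition secure_against_henchman ::
  "('e \<times> 's) pmf \<Rightarrow> ('x \<Rightarrow> 's \<Rightarrow> ('y \<times> 'z) pmf) \<Rightarrow> ('s \<Rightarrow> 's \<Rightarrow> real) \<Rightarrow> real \<Rightarrow> nat \<Rightarrow> real \<Rightarrow> real \<Rightarrow>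
   ('e, 's, 'x, 'y, 'z) ca_code \<Rightarrow> real \<Rightarrow> bool"
where
  "secure_against_henchman P W d RE n R Rc c DE \<longleftrightarrow>
     (\<forall>(fE :: (nat \<Rightarrow> 's) \<Rightarrow> (nat \<Rightarrow> 'y) \<Rightarrow> nat \<Rightarrow> nat) (gE :: (nat \<Rightarrow> 'y) \<Rightarrow> nat \<Rightarrow> (nat \<Rightarrow> 's)).
        (\<forall>sh y \<gamma>. fE sh y \<gamma> \<in> index_set n RE) \<longrightarrow>
        measure_pmf.expectation (code_law P W n R Rc c)
          (\<lambda>(m, \<gamma>, se, s, x, y, z, sh). avg_dist d n sh (gE y (fE sh y \<gamma>))) \<ge> DE)"

definition achievable ::
  "('e \<times> 's) pmf \<Rightarrow> ('x \<Rightarrow> 's \<Rightarrow> ('y \<times> 'z) pmf) \<Rightarrow> ('s \<Rightarrow> 's \<Rightarrow> real) \<Rightarrow> real \<Rightarrow>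
   real \<Rightarrow> real \<Rightarrow> real \<Rightarrow> real \<Rightarrow> bool"
where
  "achievable P W d RE D DE R Rc \<longleftrightarrow> R \<ge> 0 \<and> Rc \<ge> 0 \<and>
     (\<forall>\<epsilon>>0. \<forall>\<^sub>F n in sequentially. \<exists>c. is_code n R Rc c \<and>
        measure_pmf.prob (code_law P W n R Rc c)
          {(m, \<gamma>, se, s, x, y, z, sh). m \<noteq> decoder c y \<gamma>} \<le> \<epsilon> \<and>
        map_pmf (\<lambda>(m, \<gamma>, se, s, x, y, z, sh). sh) (code_law P W n R Rc c) = iid n (map_pmf snd P) \<and>
        measure_pmf.expectation (code_law P W n R Rc c)
          (\<lambda>(m, \<gamma>, se, s, x, y, z, sh). avg_dist d n s sh) \<le> D \<and>
        secure_against_henchman P W d RE n R Rc c DE)"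

definition capacity_distortion_region ::
  "('e \<times> 's) pmf \<Rightarrow> ('x \<Rightarrow> 's \<Rightarrow> ('y \<times> 'z) pmf) \<Rightarrow> ('s \<Rightarrow> 's \<Rightarrow> real) \<Rightarrow> real \<Rightarrow>
   real \<Rightarrow> real \<Rightarrow> (real \<times> real) set"
where
  "capacity_distortion_region P W d RE D DE =
     {(R, Rc). (R, Rc, D, DE) \<in> closure {(R', Rc', D', DE'). achievable P W d RE D' DE' R' Rc'}}"


section \<open>Information measures\<close>

definition mutual_info :: "'w pmf \<Rightarrow> ('w \<Rightarrow> 'a) \<Rightarrow> ('w \<Rightarrow> 'b) \<Rightarrow> real" where
  "mutual_info Q A B =
     prob_space.mutual_information (measure_pmf Q) 2 (count_space UNIV) (count_space UNIV) A B"

definition cond_mutual_info :: "'w pmf \<Rightarrow> ('w \<Rightarrow> 'a) \<Rightarrow> ('w \<Rightarrow> 'b) \<Rightarrow> ('w \<Rightarrow> 'c) \<Rightarrow> real" where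
  "cond_mutual_info Q A B C =
     prob_space.conditional_mutual_information (measure_pmf Q) 2
       (count_space UNIV) (count_space UNIV) (count_space UNIV) A B C"

(* Q is the joint law of the source T and the side information V (available at both sides); the
   reconstruction kernel K gives the joint law of (T, V, T_hat). The minimum is written as an
   infimum in ereal. *)
definition recon_law :: "('s \<times> 'v) pmf \<Rightarrow> ('s \<Rightarrow> 'v \<Rightarrow> 's pmf) \<Rightarrow> ('s \<times> 'v \<times> 's) pmf" where
  "recon_law Q K = do { (t, v) \<leftarrow> Q; t' \<leftarrow> K t v; return_pmf (t, v, t') }"

definition cond_distortion_rate ::
  "('s \<Rightarrow> 's \<Rightarrow> real) \<Rightarrow> real \<Rightarrow> ('s \<times> 'v) pmf \<Rightarrow> ereal"
where
  "cond_distortion_rate d r Q =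
     (if r < 0 then \<infinity>
      else INF K \<in> {K. cond_mutual_info (recon_law Q K)
                          (\<lambda>(t, v, t'). t) (\<lambda>(t, v, t'). t') (\<lambda>(t, v, t'). v) \<le> r}.
             ereal (measure_pmf.expectation (recon_law Q K) (\<lambda>(t, v, t'). d t t')))"


section \<open>The single-letter region\<close>

(* Joint laws of (Se, S, U, X, Y, Z, S_hat). The finite alphabet of U is a finite set of natural
   numbers, which is general up to relabelling. *)
definition single_letter_laws ::
  "('e \<times> 's) pmf \<Rightarrow> ('x \<Rightarrow> 's \<Rightarrow> ('y \<times> 'z) pmf) \<Rightarrow> ('e \<times> 's \<times> nat \<times> 'x \<times> 'y \<times> 'z \<times> 's) pmf set"
where
  "single_letter_laws P W =
     {Q. (\<exists>(PU :: 'e \<Rightarrow> nat pmf) (PX :: nat \<Rightarrow> 'e \<Rightarrow> 'x pmf) (PT :: 'x \<Rightarrow> 'e \<Rightarrow> 'z \<Rightarrow> 's pmf).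
            finite (\<Union>e. set_pmf (PU e)) \<and>
            Q = do {
              (se, s) \<leftarrow> P;
              u \<leftarrow> PU se;
              x \<leftarrow> PX u se;
              (y, z) \<leftarrow> W x s;
              sh \<leftarrow> PT x se z;
              return_pmf (se, s, u, x, y, z, sh)
            }) \<and>
         map_pmf (\<lambda>(se, s, u, x, y, z, sh). sh) Q = map_pmf snd P}"

definition inner_region ::
  "('e \<times> 's) pmf \<Rightarrow> ('x \<Rightarrow> 's \<Rightarrow> ('y \<times> 'z) pmf) \<Rightarrow> ('s \<Rightarrow> 's \<Rightarrow> real) \<Rightarrow> real \<Rightarrow>
   real \<Rightarrow> real \<Rightarrow> (real \<times> real) set"
where
  "inner_region P W d RE D DE =
     {(R, Rc). R \<ge> 0 \<and> Rc \<ge> 0 \<and> (\<exists>Q \<in> single_letter_laws P W.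
        let Se = (\<lambda>(se, s, u, x, y, z, sh). se);
            U = (\<lambda>(se, s, u, x, y, z, sh). u);
            Y = (\<lambda>(se, s, u, x, y, z, sh). y);
            Sh = (\<lambda>(se, s, u, x, y, z, sh). sh);
            D1 = (\<lambda>r. cond_distortion_rate d r
                    (map_pmf (\<lambda>(se, s, u, x, y, z, sh). (sh, y)) Q));
            D2 = (\<lambda>r. cond_distortion_rate d r
                    (map_pmf (\<lambda>(se, s, u, x, y, z, sh). (sh, (u, y))) Q))
        in R \<le> mutual_info Q U Y - mutual_info Q U Se \<and>
           Rc \<ge> max (mutual_info Q U Sh - mutual_info Q U Y) 0 \<and>
           D \<ge> measure_pmf.expectation Q (\<lambda>(se, s, u, x, y, z, sh). d s sh) \<and>
           ereal DE \<le> (if RE < Rc then D1 RE else min (D1 RE) (D2 (RE - Rc))))}"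

end

theory Submission
  imports Defs "HOL-Real_Asymp.Real_Asymp"
begin

text \<open>
  Gelfand-Pinsker random coding with a likelihood encoder. Codewords \<open>C (m, \<gamma>, l)\<close> are drawn i.i.d.
  from \<open>P_U\<close>, and the encoder picks \<open>l\<close> from the posterior given \<open>S_e\<close>. By soft covering
  (rate of \<open>l\<close> above \<open>I(U;S_e)\<close>) the induced law is close in total variation to the ideal law, in
  which a uniformly chosen codeword is passed through the single-letter channel; everything is then
  analysed under the ideal law. Soft covering for the reconstruction (total rate above the
  information between \<open>U\<close> and the reconstruction) and a coupling kernel applied by the estimator make
  the reconstruction exactly i.i.d.

  For security the henchman's rate only matters through the number \<open>2^(n R_E)\<close> of reconstructions
  compatible with a given \<open>y\<close>. Given \<open>y\<close>, the probability that the reconstruction lies within the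
  distortion ball of a fixed sequence is a sum of independent contributions of the codewords. A
  moment generating function bounds the maximum over all sequences by the expectation of such a sum
  (exponent \<open>R_E\<close>, from the distortion-rate function given \<open>Y\<close>) plus the largest single
  contribution (exponent \<open>R_c\<close> plus the rate of the distortion-rate function given \<open>(U, Y)\<close>). Both
  exponents come from counting conditional types, since a small distortion forces a large empirical
  conditional mutual information.

  If \<open>R = 0\<close> no decoding is needed, and the rate of \<open>l\<close> is taken above \<open>I(U;Y)\<close>; this covers the
  degenerate case \<open>I(U;Y) = I(U;S_e)\<close>.
\<close>

section \<open>Random codebooks\<close>

text \<open>The eavesdropper chooses the reconstructions after the codebook, so one codebook has to
  withstand every target sequence for every \<open>y\<close>. This is affordable because the maximum
  over targets costs the largest single contribution only a factor
  \<open>ln (card (seqs n))\<close>, linear in \<open>n\<close>. What the henchman knows,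
  \<open>\<gamma>\<close> included, needs no separate treatment: only the list of replies possible
  for a given \<open>y\<close> is used. The threshold at \<open>R_E = R_c\<close> arises as follows.
  Given \<open>y\<close>, one codeword contributes at most about 2^(n I(U;Y)) p(y) before averaging
  over the codebook. The message rate plus the rate of \<open>l\<close> stays within a fraction of
  the slack of I(U;Y), or above it, so the codebook has total rate about I(U;Y) + R_c or more.
  Dividing by its size and multiplying by 2^(n R_E) leaves 2^(n (R_E - R_c)). For R_E below R_c this
  decays by itself; otherwise the distortion-rate function given (U, Y) at R_E - R_c has to supply
  the missing exponent. The same total rate exceeds I(U;S_hat) precisely by the condition on R_c, so
  the exact output law costs no additional rate.\<close>

abbreviation expec :: "'a pmf \<Rightarrow> ('a \<Rightarrow> real) \<Rightarrow> real" where
  "expec p \<equiv> measure_pmf.expectation p"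

abbreviation prb :: "'a pmf \<Rightarrow> 'a set \<Rightarrow> real" where
  "prb p \<equiv> measure_pmf.prob p"

section \<open>Moments and maxima of sums over independent codewords\<close>

lemma Pi_pmf_pair_component:
  assumes "finite I" "i \<in> I" "j \<in> I" "i \<noteq> j"
  shows "map_pmf (\<lambda>C. (C i, C j)) (Pi_pmf I dflt (\<lambda>_. q)) = pair_pmf q q"
proof -
  have I: "I = insert i (I - {i})" using assms by auto
  have "Pi_pmf I dflt (\<lambda>_. q) = map_pmf (\<lambda>(y, f). f(i := y)) (pair_pmf q (Pi_pmf (I - {i}) dflt (\<lambda>_. q)))"
    by (subst I, subst Pi_pmf_insert) (use assms in auto)
  then have "map_pmf (\<lambda>C. (C i, C j)) (Pi_pmf I dflt (\<lambda>_. q)) =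
      map_pmf (\<lambda>(y, f). (y, f j)) (pair_pmf q (Pi_pmf (I - {i}) dflt (\<lambda>_. q)))"
    using assms by (simp add: map_pmf_comp case_prod_unfold)
  also have "\<dots> = map_pmf (map_prod id (\<lambda>f. f j)) (pair_pmf q (Pi_pmf (I - {i}) dflt (\<lambda>_. q)))"
    by (rule map_pmf_cong) auto
  also have "\<dots> = pair_pmf q (map_pmf (\<lambda>f. f j) (Pi_pmf (I - {i}) dflt (\<lambda>_. q)))"
    by (simp add: map_prod_def pair_map_pmf2 apsnd_def)
  also have "map_pmf (\<lambda>f. f j) (Pi_pmf (I - {i}) dflt (\<lambda>_. q)) = q"
    using assms by (subst Pi_pmf_component) auto
  finally show ?thesis .
qed

lemma finite_set_Pi_pmf:
  assumes "finite I" "\<And>i. i \<in> I \<Longrightarrow> finite (set_pmf (q i))"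
  shows "finite (set_pmf (Pi_pmf I dflt q))"
  by (rule finite_subset[OF set_Pi_pmf_subset'[OF assms(1)]])
     (use assms in \<open>auto intro!: finite_PiE_dflt\<close>)

lemma expectation_Pi_pmf_component:
  assumes "finite I" "i \<in> I"
  shows "expec (Pi_pmf I dflt (\<lambda>_. q)) (\<lambda>C. f (C i) :: real) = expec q f"
proof -
  have "expec q f = expec (map_pmf (\<lambda>C. C i) (Pi_pmf I dflt (\<lambda>_. q))) f"
    using assms by (subst Pi_pmf_component) auto
  then show ?thesis by simp
qed

lemma expectation_pair_pmf_iterated:
  fixes f :: "'a \<Rightarrow> 'b \<Rightarrow> real"
  assumes p: "finite (set_pmf p)" and q: "finite (set_pmf q)"
  shows "expec (pair_pmf p q) (\<lambda>(x, y). f x y)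
       = expec q (\<lambda>y. expec p (\<lambda>x. f x y))"
proof -
  have "expec (pair_pmf p q) (\<lambda>(x, y). f x y)
     = (\<Sum>a\<in>set_pmf p \<times> set_pmf q. pmf (pair_pmf p q) a * (case a of (x, y) \<Rightarrow> f x y))"
    by (subst integral_measure_pmf[of "set_pmf p \<times> set_pmf q"]) (use assms in auto)
  also have "\<dots> = (\<Sum>x\<in>set_pmf p. \<Sum>y\<in>set_pmf q. pmf q y * (pmf p x * f x y))"
    unfolding sum.cartesian_product by (intro sum.cong) (auto simp: pmf_pair)
  also have "\<dots> = (\<Sum>y\<in>set_pmf q. pmf q y * (\<Sum>x\<in>set_pmf p. pmf p x * f x y))"
    by (subst sum.swap) (simp add: sum_distrib_left)
  also have "\<dots> = expec q (\<lambda>y. expec p (\<lambda>x. f x y))"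
    by (simp add: integral_measure_pmf[OF q] integral_measure_pmf[OF p])
  finally show ?thesis .
qed

text \<open>Since \<open>h\<close> is centred, pairwise independence removes all off-diagonal
  terms.\<close>

lemma expectation_square_sum_iid:
  fixes h :: "'u \<Rightarrow> real"
  assumes I: "finite I" and q: "finite (set_pmf q)" and h: "expec q h = 0"
  shows "expec (Pi_pmf I dflt (\<lambda>_. q)) (\<lambda>C. (\<Sum>i\<in>I. h (C i))\<^sup>2)
       = real (card I) * expec q (\<lambda>u. (h u)\<^sup>2)"
proof -
  let ?P = "Pi_pmf I dflt (\<lambda>_. q)"
  have fin: "finite (set_pmf ?P)" by (rule finite_set_Pi_pmf) (use assms in auto)
  have "expec ?P (\<lambda>C. (\<Sum>i\<in>I. h (C i))\<^sup>2)
      = (\<Sum>i\<in>I. \<Sum>j\<in>I. expec ?P (\<lambda>C. h (C i) * h (C j)))"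
    by (simp add: power2_eq_square sum_product integrable_measure_pmf_finite fin)
  also have "\<dots> = (\<Sum>i\<in>I. \<Sum>j\<in>I. if j = i then expec q (\<lambda>u. (h u)\<^sup>2) else 0)"
  proof (intro sum.cong refl)
    fix i j assume ij: "i \<in> I" "j \<in> I"
    show "expec ?P (\<lambda>C. h (C i) * h (C j))
        = (if j = i then expec q (\<lambda>u. (h u)\<^sup>2) else 0)"
    proof (cases "j = i")
      case True
      then show ?thesis
        using expectation_Pi_pmf_component[OF I ij(1), where q=q and f="\<lambda>u. h u * h u"] by (simp add: power2_eq_square)
    next
      case False
      have "expec ?P (\<lambda>C. h (C i) * h (C j))
         = expec (map_pmf (\<lambda>C. (C i, C j)) ?P) (\<lambda>(x, y). h x * h y)"
        by simp
      also have "\<dots> = expec (pair_pmf q q) (\<lambda>(x, y). h x * h y)"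
        using False ij I by (subst Pi_pmf_pair_component) auto
      also have "\<dots> = 0" unfolding expectation_pair_pmf_iterated[OF q q] by (simp add: h)
      finally show ?thesis using False by simp
    qed
  qed
  also have "\<dots> = real (card I) * expec q (\<lambda>u. (h u)\<^sup>2)"
    using I by simp
  finally show ?thesis .
qed

text \<open>A linearised Cauchy-Schwarz inequality: after taking expectations and choosing
  \<open>c\<close> well, it bounds a first absolute moment by the root of the second moment.\<close>

lemma abs_le_weighted_square:
  fixes x c :: real assumes "c > 0" shows "\<bar>x\<bar> \<le> (x\<^sup>2 / c + c) / 2"
proof -
  have "0 \<le> (\<bar>x\<bar> - c)\<^sup>2" by simp
  then have "2 * \<bar>x\<bar> * c \<le> x\<^sup>2 + c\<^sup>2" by (simp add: power2_diff)
  then show ?thesis using assms by (simp add: field_simps power2_eq_square)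
qed

text \<open>The average of the truncated kernel has variance at most \<open>B p(v)\<^sup>2 / |I|\<close>; the truncated
  part only costs its probability.\<close>

lemma soft_covering:
  fixes q :: "'u pmf" and V :: "'u \<Rightarrow> 'v pmf"
  assumes I: "finite I" "I \<noteq> {}" and q: "finite (set_pmf q)" and S: "finite S"
    and p: "p = bind_pmf q V" and VS: "\<And>u. u \<in> set_pmf q \<Longrightarrow> set_pmf (V u) \<subseteq> S"
    and B: "B > 0" and A: "\<And>u v. u \<in> set_pmf q \<Longrightarrow> (u, v) \<in> A \<Longrightarrow> pmf (V u) v \<le> B * pmf p v"
  shows "expec (Pi_pmf I dflt (\<lambda>_. q))
           (\<lambda>C. \<Sum>v\<in>S. \<bar>(\<Sum>i\<in>I. pmf (V (C i)) v) / real (card I) - pmf p v\<bar>)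
       \<le> sqrt (B / real (card I))
         + 2 * expec q (\<lambda>u. prb (V u) {v. (u, v) \<notin> A})"
proof -
  let ?P = "Pi_pmf I dflt (\<lambda>_. q)"
  let ?K = "real (card I)"
  have K: "?K > 0" using I by (simp add: card_gt_0_iff)
  have fin: "finite (set_pmf ?P)" by (rule finite_set_Pi_pmf) (use I q in auto)
  note int = integrable_measure_pmf_finite[OF fin] integrable_measure_pmf_finite[OF q]
  define f where "f v u = pmf (V u) v * indicator A (u, v)" for v u
  define g where "g v u = pmf (V u) v * indicator (-A) (u, v)" for v u
  have fg: "pmf (V u) v = f v u + g v u" for u v
    by (auto simp: f_def g_def indicator_def)
  have pE: "pmf p v = expec q (\<lambda>u. pmf (V u) v)" for v by (simp add: p pmf_bind)
  have pfg: "pmf p v = expec q (f v) + expec q (g v)" for v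
    unfolding pE fg by (rule Bochner_Integration.integral_add) (rule int)+
  define s where "s = sqrt (B / ?K)"
  have s: "s > 0" using B K by (simp add: s_def)
  have g0: "g v u \<ge> 0" for v u by (simp add: g_def)
  have one: "expec ?P (\<lambda>C. \<bar>(\<Sum>i\<in>I. pmf (V (C i)) v) / ?K - pmf p v\<bar>) \<le> pmf p v * s + 2 * expec q (g v)" for v
  proof -
    define h where "h u = f v u - expec q (f v)" for u
    have h0: "expec q h = 0" unfolding h_def by (simp add: int)
    have main: "expec ?P (\<lambda>C. \<bar>(\<Sum>i\<in>I. h (C i)) / ?K\<bar>) \<le> pmf p v * s"
    \<comment> \<open>The weight \<open>c\<close> used below must be positive. Where
      \<open>p\<close> vanishes, every kernel \<open>V u\<close> vanishes too and both sides are
      zero.\<close>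
    proof (cases "pmf p v = 0")
      case True
      then have V0: "pmf (V u) v = 0" if "u \<in> set_pmf q" for u
        using that by (simp add: p pmf_eq_0_set_pmf)
      have "expec q (f v) = expec q (\<lambda>_. 0)" 
        by (intro integral_cong_AE) (auto simp: AE_measure_pmf_iff f_def V0)
      then have f0: "expec q (f v) = 0" by simp
      have zero: "expec ?P (\<lambda>C. \<bar>(\<Sum>i\<in>I. h (C i)) / ?K\<bar>) = expec ?P (\<lambda>_. 0)"
      proof (intro integral_cong_AE)
        have "h u = 0" if "u \<in> set_pmf q" for u by (simp add: h_def f0 f_def V0 that)
        moreover have "C i \<in> set_pmf q" if "C \<in> set_pmf ?P" "i \<in> I" for C i
          using that set_Pi_pmf[OF I(1), of dflt "\<lambda>_. q"] by (auto simp: PiE_dflt_def)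
        ultimately show "AE C in measure_pmf ?P. \<bar>(\<Sum>i\<in>I. h (C i)) / ?K\<bar> = 0"
          by (auto simp: AE_measure_pmf_iff)
      qed auto
      show ?thesis unfolding zero True by simp
    next
      case False
      then have pv: "pmf p v > 0" by (simp add: pmf_pos)
      \<comment> \<open>This weight balances the inequality: with second moment at most
        \<open>B * (pmf p v)\<^sup>2\<close>, each of the two summands becomes
        \<open>pmf p v * s / 2\<close>.\<close>
      define c where "c = pmf p v * s"
      have c: "c > 0" using pv s by (simp add: c_def)
      have "expec q (\<lambda>u. (h u)\<^sup>2) = expec q (\<lambda>u. (f v u)\<^sup>2 - (2 * expec q (f v)) * f v u + (expec q (f v))\<^sup>2)"
        by (simp add: h_def power2_diff algebra_simps)
      also have "\<dots> = expec q (\<lambda>u. (f v u)\<^sup>2) - (expec q (f v))\<^sup>2"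
        by (simp add: int power2_eq_square)
      also have "\<dots> \<le> expec q (\<lambda>u. (f v u)\<^sup>2)" by simp
      also have "\<dots> \<le> expec q (\<lambda>u. B * pmf p v * pmf (V u) v)"
      proof (intro integral_mono_AE)
        show "AE u in measure_pmf q. (f v u)\<^sup>2 \<le> B * pmf p v * pmf (V u) v"
          unfolding AE_measure_pmf_iff
        proof
          fix u assume u: "u \<in> set_pmf q"
          show "(f v u)\<^sup>2 \<le> B * pmf p v * pmf (V u) v"
            using A[OF u] B by (auto simp: f_def indicator_def power2_eq_square intro!: mult_right_mono)
        qed
      qed (rule int)+
      also have "\<dots> = B * pmf p v * pmf p v" by (simp add: pE)
      finally have h2: "expec q (\<lambda>u. (h u)\<^sup>2) \<le> B * (pmf p v)\<^sup>2" by (simp add: power2_eq_square)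
      have "expec ?P (\<lambda>C. \<bar>(\<Sum>i\<in>I. h (C i)) / ?K\<bar>) \<le> expec ?P (\<lambda>C. (((\<Sum>i\<in>I. h (C i)) / ?K)\<^sup>2 / c + c) / 2)"
        by (intro integral_mono int abs_le_weighted_square c)
      also have "\<dots> = expec ?P (\<lambda>C. (\<Sum>i\<in>I. h (C i))\<^sup>2 * (1 / (2 * c * ?K\<^sup>2)) + c / 2)"
        by (intro Bochner_Integration.integral_cong) (auto simp: power_divide field_simps)
      also have "\<dots> = expec ?P (\<lambda>C. (\<Sum>i\<in>I. h (C i))\<^sup>2) / (2 * c * ?K\<^sup>2) + c / 2"
        by (simp add: int)
      also have "\<dots> = expec q (\<lambda>u. (h u)\<^sup>2) / (2 * c * ?K) + c / 2"
        using K unfolding expectation_square_sum_iid[OF I(1) q h0] by (simp add: power2_eq_square[of ?K])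
      also have "\<dots> \<le> B * (pmf p v)\<^sup>2 / (2 * c * ?K) + c / 2"
        using h2 c K by (intro add_mono divide_right_mono) auto
      also have "B * (pmf p v)\<^sup>2 / (2 * c * ?K) = (B / ?K) * pmf p v / (2 * s)"
        using pv s K by (simp add: c_def power2_eq_square field_simps)
      also have "\<dots> = s * s * pmf p v / (2 * s)"
        using B K by (simp add: s_def)
      also have "\<dots> + c / 2 = pmf p v * s" using s by (simp add: c_def field_simps)
      finally show ?thesis .
    qed
    have "\<bar>(\<Sum>i\<in>I. pmf (V (C i)) v) / ?K - pmf p v\<bar>
        \<le> \<bar>(\<Sum>i\<in>I. h (C i)) / ?K\<bar> + ((\<Sum>i\<in>I. g v (C i)) / ?K + expec q (g v))" for C
    proof -
      have "(\<Sum>i\<in>I. pmf (V (C i)) v) / ?K - pmf p v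
          = (\<Sum>i\<in>I. h (C i)) / ?K + ((\<Sum>i\<in>I. g v (C i)) / ?K - expec q (g v))"
        using K by (simp add: fg pfg h_def sum.distrib sum_subtractf field_simps)
      moreover have "(\<Sum>i\<in>I. g v (C i)) / ?K \<ge> 0" "expec q (g v) \<ge> 0"
        using g0 by (auto intro!: sum_nonneg divide_nonneg_nonneg integral_nonneg)
      ultimately show ?thesis by linarith
    qed
    then have "expec ?P (\<lambda>C. \<bar>(\<Sum>i\<in>I. pmf (V (C i)) v) / ?K - pmf p v\<bar>)
        \<le> expec ?P (\<lambda>C. \<bar>(\<Sum>i\<in>I. h (C i)) / ?K\<bar> + ((\<Sum>i\<in>I. g v (C i)) / ?K + expec q (g v)))"
      by (intro integral_mono int)
    also have "\<dots> = expec ?P (\<lambda>C. \<bar>(\<Sum>i\<in>I. h (C i)) / ?K\<bar>) + ((\<Sum>i\<in>I. expec ?P (\<lambda>C. g v (C i))) / ?K + expec q (g v))"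
      by (simp add: int)
    \<comment> \<open>The sample mean of the truncated part has expectation
      \<open>expec q (g v)\<close>, so it and its mean together account for the factor 2.\<close>
    also have "(\<Sum>i\<in>I. expec ?P (\<lambda>C. g v (C i))) = ?K * expec q (g v)"
      by (simp add: expectation_Pi_pmf_component[OF I(1), where f="g v"])
    finally show ?thesis using main K by simp
  qed
  have "expec ?P (\<lambda>C. \<Sum>v\<in>S. \<bar>(\<Sum>i\<in>I. pmf (V (C i)) v) / ?K - pmf p v\<bar>)
      = (\<Sum>v\<in>S. expec ?P (\<lambda>C. \<bar>(\<Sum>i\<in>I. pmf (V (C i)) v) / ?K - pmf p v\<bar>))"
    by (rule Bochner_Integration.integral_sum) (rule int)
  also have "\<dots> \<le> (\<Sum>v\<in>S. pmf p v * s + 2 * expec q (g v))"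
    by (intro sum_mono one)
  also have "\<dots> = (\<Sum>v\<in>S. pmf p v) * s + 2 * expec q (\<lambda>u. \<Sum>v\<in>S. g v u)"
    by (simp add: sum.distrib sum_distrib_right sum_distrib_left int)
  also have "\<dots> \<le> 1 * s + 2 * expec q (\<lambda>u. prb (V u) {v. (u, v) \<notin> A})"
  proof (intro add_mono mult_right_mono mult_left_mono)
    show "(\<Sum>v\<in>S. pmf p v) \<le> 1"
      using measure_pmf.prob_le_1[of p S] by (simp add: measure_measure_pmf_finite S)
    have "(\<Sum>v\<in>S. g v u) \<le> prb (V u) {v. (u, v) \<notin> A}" for u
    proof -
      have "(\<Sum>v\<in>S. g v u) = (\<Sum>v\<in>{v\<in>S. (u, v) \<notin> A}. pmf (V u) v)"
        unfolding g_def using S by (intro sum.mono_neutral_cong_right) (auto simp: indicator_def)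
      also have "\<dots> = prb (V u) {v\<in>S. (u, v) \<notin> A}"
        using S by (simp add: measure_measure_pmf_finite)
      also have "\<dots> \<le> prb (V u) {v. (u, v) \<notin> A}"
        by (intro measure_pmf.finite_measure_mono) auto
      finally show ?thesis .
    qed
    then show "expec q (\<lambda>u. \<Sum>v\<in>S. g v u) \<le> expec q (\<lambda>u. prb (V u) {v. (u, v) \<notin> A})"
      by (intro integral_mono int)
  qed (use s in auto)
  finally show ?thesis by (simp add: s_def)
qed

text \<open>With \<open>X = Max\<^sub>t \<Sum>\<^sub>i f\<^sub>t (C i)\<close>, the inequality \<open>y \<le> ln a + exp y / a - 1\<close> at \<open>y = X / b\<close> reduces
  the claim to moment generating functions.\<close>

lemma expectation_Max_sum_le:
  fixes f :: "'t \<Rightarrow> 'u \<Rightarrow> real"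
  assumes I: "finite I" and q: "finite (set_pmf q)" and T: "finite T" "T \<noteq> {}" and b: "b > 0"
    and f: "\<And>t u. t \<in> T \<Longrightarrow> u \<in> set_pmf q \<Longrightarrow> 0 \<le> f t u \<and> f t u \<le> b"
    and mu: "\<And>t. t \<in> T \<Longrightarrow> expec q (f t) \<le> \<mu>"
  shows "expec (Pi_pmf I dflt (\<lambda>_. q)) (\<lambda>C. Max ((\<lambda>t. \<Sum>i\<in>I. f t (C i)) ` T))
       \<le> b * ln (real (card T)) + 2 * real (card I) * \<mu>"
proof -
  let ?P = "Pi_pmf I dflt (\<lambda>_. q)"
  let ?K = "real (card I)"
  have fin: "finite (set_pmf ?P)" by (rule finite_set_Pi_pmf) (use I q in auto)
  note int = integrable_measure_pmf_finite[OF fin] integrable_measure_pmf_finite[OF q]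
  \<comment> \<open>\<open>exp L\<close> is the sum over \<open>T\<close> of the bounds on the
    moment generating functions. With this \<open>a = exp L\<close> the last two terms of the
    inequality cancel.\<close>
  define L where "L = ln (real (card T)) + 2 * ?K * \<mu> / b"
  define X where "X C = Max ((\<lambda>t. \<Sum>i\<in>I. f t (C i)) ` T)" for C
  have cT: "real (card T) > 0" using T by (simp add: card_gt_0_iff)
  have mgf: "expec ?P (\<lambda>C. exp ((\<Sum>i\<in>I. f t (C i)) / b)) \<le> exp (2 * ?K * \<mu> / b)" if t: "t \<in> T" for t
  proof -
    have "expec ?P (\<lambda>C. exp ((\<Sum>i\<in>I. f t (C i)) / b)) = expec ?P (\<lambda>C. \<Prod>i\<in>I. exp (f t (C i) / b))"
      by (simp add: exp_sum[symmetric] I sum_divide_distrib)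
    also have "\<dots> = (\<Prod>i\<in>I. expec q (\<lambda>u. exp (f t u / b)))"
      by (subst expectation_prod_Pi_pmf) (use I q in \<open>auto intro: integrable_measure_pmf_finite\<close>)
    also have "\<dots> = (expec q (\<lambda>u. exp (f t u / b))) ^ card I" by simp
    also have "\<dots> \<le> (exp (2 * \<mu> / b)) ^ card I"
    proof (rule power_mono)
      have "expec q (\<lambda>u. exp (f t u / b)) \<le> expec q (\<lambda>u. 1 + 2 * (f t u / b))"
      proof (intro integral_mono_AE)
        show "AE u in measure_pmf q. exp (f t u / b) \<le> 1 + 2 * (f t u / b)"
          unfolding AE_measure_pmf_iff
        proof
          fix u assume u: "u \<in> set_pmf q"
          \<comment> \<open>Dividing by \<open>b\<close> brings the values into the unit interval,
            where exp x is at most 1 + x + x^2 and hence at most 1 + 2 x.\<close>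
          have x: "0 \<le> f t u / b" "f t u / b \<le> 1" using f[OF t u] b by auto
          then have sq: "(f t u / b)\<^sup>2 \<le> f t u / b"
            unfolding power2_eq_square by (intro mult_left_le)
          show "exp (f t u / b) \<le> 1 + 2 * (f t u / b)"
            using exp_bound[OF x] sq by linarith
        qed
      qed (rule int)+
      also have "\<dots> = 1 + 2 * expec q (f t) / b" by (simp add: int)
      also have "\<dots> \<le> 1 + 2 * \<mu> / b" using mu[OF t] b by (simp add: divide_right_mono)
      also have "\<dots> \<le> exp (2 * \<mu> / b)" by (rule exp_ge_add_one_self)
      finally show "expec q (\<lambda>u. exp (f t u / b)) \<le> exp (2 * \<mu> / b)" .
    qed simp
    also have "\<dots> = exp (2 * ?K * \<mu> / b)" by (simp add: exp_of_nat_mult[symmetric] algebra_simps)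
    finally show ?thesis .
  qed
  have "X C / b \<le> L + (\<Sum>t\<in>T. exp ((\<Sum>i\<in>I. f t (C i)) / b)) * exp (- L) - 1" for C
  proof -
    have "X C \<in> (\<lambda>t. \<Sum>i\<in>I. f t (C i)) ` T" unfolding X_def using T by (intro Max_in) auto
    then obtain t where t: "t \<in> T" "X C = (\<Sum>i\<in>I. f t (C i))" by auto
    have "1 + (X C / b - L) \<le> exp (X C / b - L)" by (rule exp_ge_add_one_self)
    also have "\<dots> = exp (X C / b) * exp (- L)" by (simp add: exp_add[symmetric])
    also have "\<dots> \<le> (\<Sum>t\<in>T. exp ((\<Sum>i\<in>I. f t (C i)) / b)) * exp (- L)"
      unfolding t(2) using t(1) T by (intro mult_right_mono member_le_sum) auto
    finally show ?thesis by simp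
  qed
  then have "expec ?P (\<lambda>C. X C / b) \<le> expec ?P (\<lambda>C. L + (\<Sum>t\<in>T. exp ((\<Sum>i\<in>I. f t (C i)) / b)) * exp (- L) - 1)"
    by (intro integral_mono int)
  also have "\<dots> = L + (\<Sum>t\<in>T. expec ?P (\<lambda>C. exp ((\<Sum>i\<in>I. f t (C i)) / b))) * exp (- L) - 1"
    by (simp add: int)
  also have "\<dots> \<le> L + (\<Sum>t\<in>T. exp (2 * ?K * \<mu> / b)) * exp (- L) - 1"
    using mgf by (intro add_mono diff_mono mult_right_mono sum_mono) auto
  also have "(\<Sum>t\<in>T. exp (2 * ?K * \<mu> / b)) = exp L"
    using cT by (simp add: L_def exp_add)
  also have "L + exp L * exp (- L) - 1 = L" by (simp add: exp_minus)
  finally have "expec ?P X / b \<le> L" by (simp add: int)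
  then have "expec ?P X \<le> L * b" using b by (simp add: divide_le_eq)
  also have "\<dots> = b * ln (real (card T)) + 2 * ?K * \<mu>" using b by (simp add: L_def algebra_simps)
  finally show ?thesis by (simp add: X_def[abs_def])
qed

section \<open>Total variation, disintegration and coupling\<close>

lemma measure_bind_pmf: 
  "prb (bind_pmf p f) A = expec p (\<lambda>x. prb (f x) A)"
proof -
  have "ennreal (prb (bind_pmf p f) A) = (\<integral>\<^sup>+x. ennreal (prb (f x) A) \<partial>p)"
    by (simp add: measure_pmf.emeasure_eq_measure[symmetric])
  also have "\<dots> = ennreal (expec p (\<lambda>x. prb (f x) A))"
    by (intro nn_integral_eq_integral measure_pmf.integrable_const_bound[where B=1]) auto
  finally show ?thesis by (subst (asm) ennreal_inj) (auto intro!: integral_nonneg)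
qed

text \<open>A common kernel weighs each deviation by a probability, hence by at most one. The
  distance is the full sum of absolute deviations, without the factor one half;
  \<open>enc_tv\<close> and \<open>cov_tv\<close> below are of this form.\<close>

lemma measure_bind_pmf_le:
  assumes S: "finite S" "set_pmf p \<subseteq> S" "set_pmf p' \<subseteq> S"
  shows "prb (bind_pmf p f) A
       \<le> prb (bind_pmf p' f) A + (\<Sum>x\<in>S. \<bar>pmf p x - pmf p' x\<bar>)"
proof -
  have *: "prb (bind_pmf r f) A = (\<Sum>x\<in>S. pmf r x * prb (f x) A)"
    if "set_pmf r \<subseteq> S" for r
    unfolding measure_bind_pmf by (subst integral_measure_pmf[OF S(1)]) (use that in auto)
  have "prb (bind_pmf p f) A - prb (bind_pmf p' f) A
      = (\<Sum>x\<in>S. (pmf p x - pmf p' x) * prb (f x) A)"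
    by (simp add: * S sum_subtractf left_diff_distrib)
  also have "\<dots> \<le> (\<Sum>x\<in>S. \<bar>pmf p x - pmf p' x\<bar>)"
  proof (rule sum_mono)
    fix x
    have "(pmf p x - pmf p' x) * prb (f x) A \<le> \<bar>pmf p x - pmf p' x\<bar> * prb (f x) A"
      by (intro mult_right_mono) auto
    also have "\<dots> \<le> \<bar>pmf p x - pmf p' x\<bar>" by (intro mult_left_le) auto
    finally show "(pmf p x - pmf p' x) * prb (f x) A \<le> \<bar>pmf p x - pmf p' x\<bar>" .
  qed
  finally show ?thesis by simp
qed

lemma measure_pmf_finite_support:
  assumes "finite S" "set_pmf p \<subseteq> S"
  shows "prb p A = (\<Sum>x\<in>S \<inter> A. pmf p x)"
proof -
  have "prb p A = prb p (A \<inter> set_pmf p)" by (simp add: measure_Int_set_pmf)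
  also have "\<dots> \<le> prb p (S \<inter> A)" using assms by (intro measure_pmf.finite_measure_mono) auto
  finally have "prb p A = prb p (S \<inter> A)"
    using measure_pmf.finite_measure_mono[of "S \<inter> A" A p] by auto
  then show ?thesis using assms by (simp add: measure_measure_pmf_finite)
qed

lemma disintegration_pmf:
  fixes J :: "('a \<times> 'b) pmf"
  shows "\<exists>\<kappa>. J = do { b \<leftarrow> map_pmf snd J; a \<leftarrow> \<kappa> b; return_pmf (a, b) }
    \<and> (\<forall>b. set_pmf (\<kappa> b) \<subseteq> fst ` set_pmf J)"
proof -
  \<comment> \<open>Conditioning is meaningful only for \<open>b\<close> of positive probability;
    the first marginal serves elsewhere so that the support claim holds for every
    \<open>b\<close>.\<close>
  define \<kappa> where "\<kappa> b = (if b \<in> snd ` set_pmf J then map_pmf fst (cond_pmf J {p. snd p = b}) else map_pmf fst J)" for b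
  have ne: "set_pmf J \<inter> {p. snd p = b} \<noteq> {}" if "b \<in> snd ` set_pmf J" for b using that by auto
  have "do { b \<leftarrow> map_pmf snd J; a \<leftarrow> \<kappa> b; return_pmf (a, b) }
      = do { b \<leftarrow> map_pmf snd J; cond_pmf J {p. snd p = b} }"
  proof (rule bind_pmf_cong)
    fix b assume "b \<in> set_pmf (map_pmf snd J)"
    then have b: "b \<in> snd ` set_pmf J" by simp
    have "do { a \<leftarrow> \<kappa> b; return_pmf (a, b) } = map_pmf (\<lambda>p. (fst p, b)) (cond_pmf J {p. snd p = b})"
      by (simp add: \<kappa>_def b map_pmf_def[symmetric] map_pmf_comp)
    also have "\<dots> = map_pmf id (cond_pmf J {p. snd p = b})"
      by (intro map_pmf_cong) (auto simp: set_cond_pmf[OF ne[OF b]])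
    finally show "do { a \<leftarrow> \<kappa> b; return_pmf (a, b) } = cond_pmf J {p. snd p = b}" by simp
  qed simp
  also have "\<dots> = J"
  proof (rule bind_cond_pmf_cancel)
    show "\<And>y. y \<in> set_pmf J \<Longrightarrow> set_pmf (map_pmf snd J) \<inter> {x. snd y = x} \<noteq> {}" by auto
    fix x y assume "y \<in> set_pmf J" "snd y = x"
    have "{x. snd y = x} = {x}" using \<open>snd y = x\<close> by auto
    then show "prb J {y. snd y = x} = prb (map_pmf snd J) {x. snd y = x}"
      by (simp add: vimage_def)
  qed (use ne in auto)
  finally have "J = do { b \<leftarrow> map_pmf snd J; a \<leftarrow> \<kappa> b; return_pmf (a, b) }" by simp
  moreover have "set_pmf (\<kappa> b) \<subseteq> fst ` set_pmf J" for b
    by (auto simp: \<kappa>_def set_cond_pmf[OF ne])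
  ultimately show ?thesis by blast
qed

lemma disintegration_pmf_fst:
  fixes J :: "('a \<times> 'b) pmf"
  shows "\<exists>\<kappa>. J = do { a \<leftarrow> map_pmf fst J; b \<leftarrow> \<kappa> a; return_pmf (a, b) }"
proof -
  define J' where "J' = map_pmf prod.swap J"
  obtain \<kappa> where \<kappa>: "J' = do { b \<leftarrow> map_pmf snd J'; a \<leftarrow> \<kappa> b; return_pmf (a, b) }"
    using disintegration_pmf[of J'] by (elim exE conjE)
  have sJ: "map_pmf snd J' = map_pmf fst J" by (simp add: J'_def map_pmf_comp)
  have "J = map_pmf prod.swap J'" by (simp add: J'_def map_pmf_comp)
  also have "\<dots> = map_pmf prod.swap (do { b \<leftarrow> map_pmf fst J; a \<leftarrow> \<kappa> b; return_pmf (a, b) })"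
    using \<kappa> unfolding sJ by simp
  also have "\<dots> = do { a \<leftarrow> map_pmf fst J; b \<leftarrow> \<kappa> a; return_pmf (a, b) }" by (simp add: map_bind_pmf)
  finally show ?thesis by (rule exI[of _ \<kappa>])
qed

lemma pmf_bind_Pair:
  "pmf (do { u \<leftarrow> q; v \<leftarrow> V u; return_pmf (u, v) }) (u, v) = pmf q u * pmf (V u) v"
proof -
  have "pmf (do { u \<leftarrow> q; v \<leftarrow> V u; return_pmf (u, v) }) (u, v)
     = expec q (\<lambda>u'. indicator {u} u' * pmf (V u) v)"
    unfolding pmf_bind[of q] map_pmf_def[symmetric]
  proof (rule Bochner_Integration.integral_cong[OF refl])
    fix u'
    have "Pair u' -` {(u, v)} = (if u' = u then {v} else {})" by auto
    then show "pmf (map_pmf (Pair u') (V u')) (u, v) = indicator {u} u' * pmf (V u) v"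
      by (simp add: pmf_map measure_pmf_single)
  qed
  then show ?thesis by (simp add: measure_pmf_single)
qed

text \<open>Keep \<open>t\<close> with probability \<open>min (1, \<nu> t / \<mu> t)\<close>, otherwise redraw from the normalised excess of
  \<open>\<nu>\<close> over \<open>\<mu>\<close>.\<close>

lemma coupling_kernel:
  fixes \<mu> \<nu> :: "'t pmf"
  assumes fin: "finite (set_pmf \<mu>)" "finite (set_pmf \<nu>)"
    and le: "\<And>A. prb \<mu> A \<le> prb \<nu> A + \<epsilon>"
  shows "\<exists>\<kappa>. bind_pmf \<mu> \<kappa> = \<nu> \<and> (\<forall>t. set_pmf (\<kappa> t) \<subseteq> insert t (set_pmf \<nu>))
    \<and> prb (do { t \<leftarrow> \<mu>; t' \<leftarrow> \<kappa> t; return_pmf (t, t') }) {(t, t'). t \<noteq> t'} \<le> \<epsilon>"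
proof -
  define S where "S = set_pmf \<mu> \<union> set_pmf \<nu>"
  have S: "finite S" "set_pmf \<mu> \<subseteq> S" "set_pmf \<nu> \<subseteq> S" using fin by (auto simp: S_def)
  define m where "m t = min (pmf \<mu> t) (pmf \<nu> t)" for t
  define \<delta> where "\<delta> = (\<Sum>t\<in>S. pmf \<nu> t - m t)"
  have sum1: "(\<Sum>t\<in>S. pmf \<mu> t) = 1" "(\<Sum>t\<in>S. pmf \<nu> t) = 1"
    using S by (auto intro: sum_pmf_eq_1)
  have \<delta>': "\<delta> = (\<Sum>t\<in>S. pmf \<mu> t - m t)" by (simp add: \<delta>_def sum_subtractf sum1)
  have \<delta>0: "\<delta> \<ge> 0" unfolding \<delta>_def by (intro sum_nonneg) (auto simp: m_def)
  have \<delta>eps: "\<delta> \<le> \<epsilon>"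
  proof -
    \<comment> \<open>All the excess of \<open>\<mu>\<close> over \<open>\<nu>\<close> sits on this
      set, so the hypothesis for this one event bounds \<open>\<delta>\<close>.\<close>
    let ?A = "{t. pmf \<mu> t > pmf \<nu> t}"
    have "\<delta> = (\<Sum>t\<in>S \<inter> ?A. pmf \<mu> t - pmf \<nu> t)"
      unfolding \<delta>' using S by (intro sum.mono_neutral_cong_right) (auto simp: m_def min_def)
    also have "\<dots> = prb \<mu> ?A - prb \<nu> ?A"
      using S by (simp add: measure_pmf_finite_support[OF S(1)] sum_subtractf)
    finally show ?thesis using le[of ?A] by simp
  qed
  show ?thesis
  \<comment> \<open>For \<open>\<delta> = 0\<close> there is no excess to normalise, but then the
    laws agree and the identity kernel will do.\<close>
  proof (cases "\<delta> = 0")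
    case True
    have "pmf \<mu> t = pmf \<nu> t" for t
    proof (cases "t \<in> S")
      case t: True
      have "\<forall>t\<in>S. pmf \<nu> t - m t = 0" "\<forall>t\<in>S. pmf \<mu> t - m t = 0"
        using True S(1) unfolding \<delta>_def
        by (subst (asm) sum_nonneg_eq_0_iff; auto simp: m_def)
           (use True S(1) in \<open>unfold \<delta>', subst (asm) sum_nonneg_eq_0_iff; auto simp: m_def\<close>)
      then show ?thesis using t by (metis right_minus_eq)
    next
      case False
      then show ?thesis by (auto simp: S_def set_pmf_iff)
    qed
    then have "\<mu> = \<nu>" by (rule pmf_eqI)
    then show ?thesis using \<delta>eps True
      by (intro exI[of _ return_pmf]) (auto simp: bind_return_pmf bind_return_pmf' map_pmf_def[symmetric])
  next
    case False
    then have \<delta>: "\<delta> > 0" using \<delta>0 by simp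
    define \<rho> where "\<rho> = embed_pmf (\<lambda>t. (pmf \<nu> t - m t) / \<delta>)"
    have z: "pmf \<nu> t - m t = 0" if "t \<notin> S" for t using that by (auto simp: S_def m_def set_pmf_iff)
    have nn: "0 \<le> (pmf \<nu> t - m t) / \<delta>" for t using \<delta> by (simp add: m_def)
    have tot: "(\<integral>\<^sup>+t. ennreal ((pmf \<nu> t - m t) / \<delta>) \<partial>count_space UNIV) = 1"
    proof -
      have "(\<integral>\<^sup>+t. ennreal ((pmf \<nu> t - m t) / \<delta>) \<partial>count_space UNIV)
          = (\<Sum>t\<in>S. ennreal ((pmf \<nu> t - m t) / \<delta>))"
        using z by (intro nn_integral_count_space' S) auto
      also have "\<dots> = ennreal (\<Sum>t\<in>S. (pmf \<nu> t - m t) / \<delta>)" using nn by (simp add: sum_ennreal)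
      also have "(\<Sum>t\<in>S. (pmf \<nu> t - m t) / \<delta>) = 1" using \<delta> by (simp add: sum_divide_distrib[symmetric] \<delta>_def)
      finally show ?thesis by simp
    qed
    have pmf\<rho>: "pmf \<rho> t = (pmf \<nu> t - m t) / \<delta>" for t
      unfolding \<rho>_def by (rule pmf_embed_pmf[OF nn tot])
    define a where "a t = (if pmf \<mu> t = 0 then 1 else m t / pmf \<mu> t)" for t
    have a: "0 \<le> a t" "a t \<le> 1" for t by (auto simp: a_def m_def divide_le_eq_1)
    have a\<mu>: "pmf \<mu> t * a t = m t" for t by (auto simp: a_def m_def)
    define \<kappa> where "\<kappa> t = bind_pmf (bernoulli_pmf (a t)) (\<lambda>b. if b then return_pmf t else \<rho>)" for t
    have \<rho>sub: "set_pmf \<rho> \<subseteq> set_pmf \<nu>"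
      using \<delta> by (auto simp: set_pmf_iff pmf\<rho> m_def)
    have pmf\<kappa>: "pmf (\<kappa> t) v = a t * indicator {t} v + (1 - a t) * pmf \<rho> v" for t v
      using a[of t] by (simp add: \<kappa>_def pmf_bind indicator_def)
    have sumr: "(\<Sum>t\<in>S. pmf \<mu> t * (1 - a t)) = \<delta>"
      by (simp add: right_diff_distrib a\<mu> \<delta>')
    have "bind_pmf \<mu> \<kappa> = \<nu>"
    proof (rule pmf_eqI)
      fix v
      have "pmf (bind_pmf \<mu> \<kappa>) v = (\<Sum>t\<in>S. pmf \<mu> t * (a t * indicator {t} v + (1 - a t) * pmf \<rho> v))"
        unfolding pmf_bind pmf\<kappa> by (subst integral_measure_pmf[OF S(1)]) (use S in auto)
      also have "\<dots> = (\<Sum>t\<in>S. m t * indicator {t} v) + (\<Sum>t\<in>S. pmf \<mu> t * (1 - a t)) * pmf \<rho> v"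
        unfolding a\<mu>[symmetric] sum_distrib_right sum.distrib[symmetric]
        by (intro sum.cong) (simp_all add: algebra_simps)
      also have "(\<Sum>t\<in>S. m t * indicator {t} v) = (if v \<in> S then m v else 0)"
        using S(1) by (simp add: indicator_def if_distrib sum.delta' cong: if_cong)
      also have "\<dots> = m v" by (auto simp: S_def m_def set_pmf_iff)
      also have "m v + (\<Sum>t\<in>S. pmf \<mu> t * (1 - a t)) * pmf \<rho> v = pmf \<nu> v"
        unfolding sumr pmf\<rho> using \<delta> by simp
      finally show "pmf (bind_pmf \<mu> \<kappa>) v = pmf \<nu> v" .
    qed
    moreover have "set_pmf (\<kappa> t) \<subseteq> insert t (set_pmf \<nu>)" for t
      using \<rho>sub by (auto simp: \<kappa>_def split: if_splits)
    moreover have "prb (do { t \<leftarrow> \<mu>; t' \<leftarrow> \<kappa> t; return_pmf (t, t') }) {(t, t'). t \<noteq> t'} \<le> \<epsilon>"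
    proof -
      have "prb (do { t \<leftarrow> \<mu>; t' \<leftarrow> \<kappa> t; return_pmf (t, t') }) {(t, t'). t \<noteq> t'}
         = expec \<mu> (\<lambda>t. prb (\<kappa> t) {t'. t' \<noteq> t})"
        unfolding measure_bind_pmf[of \<mu>]
        by (simp add: map_pmf_def[symmetric] vimage_def eq_commute)
      also have "\<dots> \<le> expec \<mu> (\<lambda>t. 1 - a t)"
      proof (intro integral_mono integrable_measure_pmf_finite fin)
        fix t
        have "a t \<le> pmf (\<kappa> t) t" unfolding pmf\<kappa> using a[of t] by simp
        moreover have "prb (\<kappa> t) (UNIV - {t}) = 1 - prb (\<kappa> t) {t}"
          using measure_pmf.prob_compl[of "{t}" "\<kappa> t"] by simp
        moreover have "{t'. t' \<noteq> t} = UNIV - {t}" by auto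
        ultimately show "prb (\<kappa> t) {t'. t' \<noteq> t} \<le> 1 - a t"
          by (simp add: measure_pmf_single)
      qed
      also have "\<dots> = \<delta>" unfolding sumr[symmetric]
        by (subst integral_measure_pmf[OF S(1)]) (use S in auto)
      finally show ?thesis using \<delta>eps by simp
    qed
    ultimately show ?thesis by (intro exI[of _ \<kappa>]) blast
  qed
qed

section \<open>Random codes over an abstract alphabet: the ideal and the actual law\<close>

lemma prob_bind_uniform:
  assumes "finite S" "S \<noteq> {}"
  shows "prb (bind_pmf (pmf_of_set S) f) A = (\<Sum>x\<in>S. prb (f x) A) / real (card S)"
  unfolding measure_bind_pmf by (rule integral_pmf_of_set) (use assms in auto)

lemma pmf_of_set_Times:
  assumes "finite A" "A \<noteq> {}" "finite B" "B \<noteq> {}"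
  shows "pmf_of_set (A \<times> B) = pair_pmf (pmf_of_set A) (pmf_of_set B)"
  by (rule pmf_eqI) (use assms in \<open>auto simp: pmf_pair indicator_def card_cartesian_product split_paired_all\<close>)

text \<open>A codeword \<open>C (m, \<gamma>, l)\<close> is drawn from \<open>q\<close>; \<open>e\<close> is the encoder's side information and \<open>Ker\<close>
  generates everything after it. In the ideal law the codeword comes first and \<open>e\<close> is its
  channel output; in the actual law \<open>e\<close> comes first and \<open>l\<close> is drawn from its posterior.\<close>

locale random_code =
  fixes M G L :: "nat set" and dflt :: 'u and q :: "'u pmf" and PE :: "'u \<Rightarrow> 'e pmf"
    and Ker :: "'e \<Rightarrow> 'u \<Rightarrow> 'o pmf" and Yo :: "'o \<Rightarrow> 'y" and To :: "'o \<Rightarrow> 't"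
  assumes M: "finite M" "M \<noteq> {}" and G: "finite G" "G \<noteq> {}" and L: "finite L" "L \<noteq> {}"
    and finq: "finite (set_pmf q)" and finE: "\<And>u. finite (set_pmf (PE u))"
    and finK: "\<And>e u. finite (set_pmf (Ker e u))"
begin

definition idx where "idx = M \<times> G \<times> L"
definition books where "books = Pi_pmf idx dflt (\<lambda>_. q)"
definition outp where "outp u = do { e \<leftarrow> PE u; x \<leftarrow> Ker e u; return_pmf (e, x) }"
definition avg_law where "avg_law = do { u \<leftarrow> q; (e, x) \<leftarrow> outp u; return_pmf (u, e, x) }"
definition pE where "pE = bind_pmf q PE"
definition pY where "pY = map_pmf (\<lambda>(u, e, x). Yo x) avg_law"
definition pT where "pT = map_pmf (\<lambda>(u, e, x). To x) avg_law"
definition ideal where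
  "ideal C = do { i \<leftarrow> pmf_of_set idx; (e, x) \<leftarrow> outp (C i); return_pmf (i, e, x) }"
definition lik_joint where
  "lik_joint C m \<gamma> = do { l \<leftarrow> pmf_of_set L; e \<leftarrow> PE (C (m, \<gamma>, l)); return_pmf (l, e) }"
text \<open>The likelihood encoder, as a version of the posterior of \<open>l\<close> given
  \<open>e\<close>. The support condition is imposed for all \<open>e\<close>, because the actual
  law may produce values of \<open>e\<close> that no codeword of the given
  \<open>(m, \<gamma>)\<close> can produce.\<close>

definition lik :: "(nat \<times> nat \<times> nat \<Rightarrow> 'u) \<Rightarrow> nat \<Rightarrow> nat \<Rightarrow> 'e \<Rightarrow> nat pmf" where
  "lik C m \<gamma> = (SOME \<kappa>. lik_joint C m \<gamma> = do { e \<leftarrow> map_pmf snd (lik_joint C m \<gamma>); l \<leftarrow> \<kappa> e; return_pmf (l, e) }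
      \<and> (\<forall>e. set_pmf (\<kappa> e) \<subseteq> L))"
definition actual where
  "actual C = do { m \<leftarrow> pmf_of_set M; \<gamma> \<leftarrow> pmf_of_set G; e \<leftarrow> pE; l \<leftarrow> lik C m \<gamma> e;
      x \<leftarrow> Ker e (C (m, \<gamma>, l)); return_pmf ((m, \<gamma>, l), e, x) }"
abbreviation enc_dev where
  "enc_dev C m \<gamma> \<equiv> \<Sum>e\<in>set_pmf pE. \<bar>(\<Sum>l\<in>L. pmf (PE (C (m, \<gamma>, l))) e) / real (card L) - pmf pE e\<bar>"
definition enc_tv where
  "enc_tv C = (\<Sum>m\<in>M. \<Sum>\<gamma>\<in>G. enc_dev C m \<gamma>) / (real (card M) * real (card G))"

abbreviation "NK \<equiv> real (card idx)"

lemma idx: "finite idx" "idx \<noteq> {}" using M G L by (auto simp: idx_def)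

lemma NK: "NK = real (card M) * real (card G) * real (card L)" "NK > 0"
  using idx by (simp_all add: card_gt_0_iff, simp add: idx_def card_cartesian_product)

lemma fin_books: "finite (set_pmf books)"
  unfolding books_def by (rule finite_set_Pi_pmf) (use idx finq in auto)

lemma books_mem: "C \<in> set_pmf books \<Longrightarrow> i \<in> idx \<Longrightarrow> C i \<in> set_pmf q"
  using set_Pi_pmf[OF idx(1), of dflt "\<lambda>_. q"] by (cases i) (auto simp: books_def PiE_dflt_def)

lemma fin_outp: "finite (set_pmf (outp u))"
  by (auto simp: outp_def finE finK)

lemma fin_avg_law: "finite (set_pmf avg_law)"
  by (auto simp: avg_law_def finq fin_outp)

lemma fin_pE: "finite (set_pmf pE)" by (auto simp: pE_def finq finE)

lemmas intb = integrable_measure_pmf_finite[OF fin_books]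
lemmas intq = integrable_measure_pmf_finite[OF finq]

lemma prob_ideal:
  "prb (ideal C) A = (\<Sum>i\<in>idx. prb (outp (C i)) {(e, x). (i, e, x) \<in> A}) / NK"
proof -
  have "prb (outp u \<bind> (\<lambda>(e, x). return_pmf (i, e, x))) A
      = prb (outp u) {(e, x). (i, e, x) \<in> A}" for u i
    by (simp add: case_prod_unfold map_pmf_def[symmetric] vimage_def)
  then show ?thesis
    unfolding ideal_def measure_bind_pmf[of "pmf_of_set idx"] by (simp add: integral_pmf_of_set idx)
qed

lemma expectation_outp:
  "expec q (\<lambda>u. prb (outp u) {(e, x). (u, e, x) \<in> B}) = prb avg_law B"
proof -
  have "prb (outp u \<bind> (\<lambda>(e, x). return_pmf (u, e, x))) B
      = prb (outp u) {(e, x). (u, e, x) \<in> B}" for u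
    by (simp add: case_prod_unfold map_pmf_def[symmetric] vimage_def)
  then show ?thesis unfolding avg_law_def measure_bind_pmf[of q] by simp
qed

text \<open>Every fixed entry of a random codebook has law \<open>q\<close>. An event that sees the
  codebook only through the sent codeword therefore behaves as for a single fresh codeword, whatever
  the rates.\<close>

lemma expectation_ideal:
  "expec books (\<lambda>C. prb (ideal C) {(i, e, x). (C i, e, x) \<in> B})
    = prb avg_law B"
proof -
  have "expec books (\<lambda>C. prb (ideal C) {(i, e, x). (C i, e, x) \<in> B})
      = (\<Sum>i\<in>idx. expec books (\<lambda>C. prb (outp (C i)) {(e, x). (C i, e, x) \<in> B})) / NK"
    by (simp add: prob_ideal intb)
  also have "\<dots> = (\<Sum>i\<in>idx. prb avg_law B) / NK"
    unfolding books_def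
    by (intro arg_cong2[where f="(/)"] sum.cong refl)
       (subst expectation_Pi_pmf_component[OF idx(1), where f="\<lambda>u. prb (outp u) {(e, x). (u, e, x) \<in> B}"],
         auto simp: expectation_outp)
  finally show ?thesis using NK(2) by simp
qed

lemma lik:
  "lik_joint C m \<gamma> = do { e \<leftarrow> map_pmf snd (lik_joint C m \<gamma>); l \<leftarrow> lik C m \<gamma> e; return_pmf (l, e) }"
  "set_pmf (lik C m \<gamma> e) \<subseteq> L"
proof -
  note k = disintegration_pmf[of "lik_joint C m \<gamma>"]
  have "fst ` set_pmf (lik_joint C m \<gamma>) \<subseteq> L" using L by (auto simp: lik_joint_def)
  then have ex: "\<exists>\<kappa>. lik_joint C m \<gamma> = do { e \<leftarrow> map_pmf snd (lik_joint C m \<gamma>); l \<leftarrow> \<kappa> e; return_pmf (l, e) }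
      \<and> (\<forall>e. set_pmf (\<kappa> e) \<subseteq> L)"
    using k by blast
  show "lik_joint C m \<gamma> = do { e \<leftarrow> map_pmf snd (lik_joint C m \<gamma>); l \<leftarrow> lik C m \<gamma> e; return_pmf (l, e) }"
    "set_pmf (lik C m \<gamma> e) \<subseteq> L"
    using someI_ex[OF ex] unfolding lik_def[symmetric] by blast+
qed

lemma pmf_of_set_idx:
  "pmf_of_set idx = do { m \<leftarrow> pmf_of_set M; \<gamma> \<leftarrow> pmf_of_set G; l \<leftarrow> pmf_of_set L; return_pmf (m, \<gamma>, l) }"
  unfolding idx_def
  using M G L by (simp add: pmf_of_set_Times pair_pmf_def bind_assoc_pmf bind_return_pmf)

text \<open>Because \<open>lik\<close> is the posterior, the ideal law can also be generated with
  \<open>e\<close> first and \<open>l\<close> second. Both laws then apply the same kernel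
  \<open>k\<close> after \<open>e\<close> and differ only in the law of \<open>e\<close> given
  \<open>(m, \<gamma>)\<close>.\<close>

lemma prob_actual_le:
  assumes C: "C \<in> set_pmf books"
  shows "prb (actual C) A \<le> prb (ideal C) A + enc_tv C"
proof -
  define k where "k m \<gamma> e = do { l \<leftarrow> lik C m \<gamma> e; x \<leftarrow> Ker e (C (m, \<gamma>, l)); return_pmf ((m, \<gamma>, l), e, x) }" for m \<gamma> e
  define \<pi> where "\<pi> m \<gamma> = map_pmf snd (lik_joint C m \<gamma>)" for m \<gamma>
  have ac: "prb (actual C) A
      = (\<Sum>m\<in>M. (\<Sum>\<gamma>\<in>G. prb (bind_pmf pE (k m \<gamma>)) A) / real (card G)) / real (card M)"
    unfolding actual_def k_def[symmetric] prob_bind_uniform[OF M] prob_bind_uniform[OF G] ..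
  have "ideal C = do { m \<leftarrow> pmf_of_set M; \<gamma> \<leftarrow> pmf_of_set G; (l, e) \<leftarrow> lik_joint C m \<gamma>;
      x \<leftarrow> Ker e (C (m, \<gamma>, l)); return_pmf ((m, \<gamma>, l), e, x) }"
    by (simp add: ideal_def pmf_of_set_idx outp_def lik_joint_def bind_assoc_pmf bind_return_pmf)
  also have "\<dots> = do { m \<leftarrow> pmf_of_set M; \<gamma> \<leftarrow> pmf_of_set G; bind_pmf (\<pi> m \<gamma>) (k m \<gamma>) }"
    by (subst lik(1)) (simp add: \<pi>_def k_def[abs_def] bind_assoc_pmf bind_return_pmf)
  finally have id: "prb (ideal C) A
      = (\<Sum>m\<in>M. (\<Sum>\<gamma>\<in>G. prb (bind_pmf (\<pi> m \<gamma>) (k m \<gamma>)) A) / real (card G)) / real (card M)"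
    by (simp only: prob_bind_uniform[OF M] prob_bind_uniform[OF G])
  have pmf\<pi>: "pmf (\<pi> m \<gamma>) e = (\<Sum>l\<in>L. pmf (PE (C (m, \<gamma>, l))) e) / real (card L)" for m \<gamma> e
  proof -
    have "\<pi> m \<gamma> = do { l \<leftarrow> pmf_of_set L; PE (C (m, \<gamma>, l)) }"
      by (simp add: \<pi>_def lik_joint_def map_bind_pmf bind_return_pmf')
    then show ?thesis by (simp add: pmf_bind integral_pmf_of_set L)
  qed
  have le: "prb (bind_pmf pE (k m \<gamma>)) A \<le> prb (bind_pmf (\<pi> m \<gamma>) (k m \<gamma>)) A
      + enc_dev C m \<gamma>"
    if "m \<in> M" "\<gamma> \<in> G" for m \<gamma>
  proof -
    have "set_pmf (\<pi> m \<gamma>) \<subseteq> set_pmf pE"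
      using books_mem[OF C] that L by (auto simp: \<pi>_def lik_joint_def pE_def idx_def)
    from measure_bind_pmf_le[OF fin_pE order_refl this, of "k m \<gamma>" A]
    show ?thesis by (simp add: pmf\<pi> abs_minus_commute)
  qed
  have "prb (actual C) A
     \<le> (\<Sum>m\<in>M. (\<Sum>\<gamma>\<in>G. prb (bind_pmf (\<pi> m \<gamma>) (k m \<gamma>)) A
      + enc_dev C m \<gamma>) / real (card G)) / real (card M)"
    unfolding ac by (intro divide_right_mono sum_mono le) auto
  also have "\<dots> = prb (ideal C) A + enc_tv C"
    unfolding id enc_tv_def
    by (simp add: sum.distrib add_divide_distrib sum_divide_distrib mult.commute)
  finally show ?thesis .
qed

lemma expectation_enc_tv:
  assumes B: "B > 0" and A: "\<And>u e. u \<in> set_pmf q \<Longrightarrow> (u, e) \<in> A \<Longrightarrow> pmf (PE u) e \<le> B * pmf pE e"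
  shows "expec books enc_tv
    \<le> sqrt (B / real (card L)) + 2 * prb avg_law {(u, e, x). (u, e) \<notin> A}"
proof -
  have one: "expec books (\<lambda>C. enc_dev C m \<gamma>)
    \<le> sqrt (B / real (card L)) + 2 * prb avg_law {(u, e, x). (u, e) \<notin> A}"
    if mg: "m \<in> M" "\<gamma> \<in> G" for m \<gamma>
  proof -
    \<comment> \<open>The codewords with this \<open>m\<close> and \<open>\<gamma>\<close> form an
      independent codebook of size \<open>card L\<close>, which alone has to cover the law of
      \<open>e\<close>.\<close>
    let ?J = "{m} \<times> {\<gamma>} \<times> L"
    have J: "?J \<subseteq> idx" using mg by (auto simp: idx_def)
    have cardJ: "card ?J = card L" by (simp add: card_cartesian_product)
    have sumJ: "(\<Sum>i\<in>?J. f i) = (\<Sum>l\<in>L. f (m, \<gamma>, l))" for f :: "_ \<Rightarrow> real"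
    proof -
      have "?J = (\<lambda>l. (m, \<gamma>, l)) ` L" by auto
      then show ?thesis by (simp add: sum.reindex inj_on_def)
    qed
    have "expec (Pi_pmf ?J dflt (\<lambda>_. q))
           (\<lambda>C. \<Sum>e\<in>set_pmf pE. \<bar>(\<Sum>i\<in>?J. pmf (PE (C i)) e) / real (card ?J) - pmf pE e\<bar>)
       \<le> sqrt (B / real (card ?J))
         + 2 * expec q (\<lambda>u. prb (PE u) {e. (u, e) \<notin> A})"
      by (rule soft_covering) (use L finq fin_pE B A in \<open>auto simp: pE_def\<close>)
    also have "expec q (\<lambda>u. prb (PE u) {e. (u, e) \<notin> A})
        = prb avg_law {(u, e, x). (u, e) \<notin> A}"
    proof -
      have mp: "map_pmf fst (outp u) = PE u" for u
        by (simp add: outp_def map_bind_pmf bind_return_pmf' map_pmf_comp)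
      have "prb (PE u) {e. (u, e) \<notin> A} = prb (outp u) {(e, x). (u, e) \<notin> A}" for u
        using arg_cong[OF mp, of "\<lambda>p. prb p {e. (u, e) \<notin> A}" u]
        by (simp add: vimage_def case_prod_unfold)
      then show ?thesis using expectation_outp[of "{(u, e, x). (u, e) \<notin> A}"] by simp
    qed
    also have "expec (Pi_pmf ?J dflt (\<lambda>_. q))
           (\<lambda>C. \<Sum>e\<in>set_pmf pE. \<bar>(\<Sum>i\<in>?J. pmf (PE (C i)) e) / real (card ?J) - pmf pE e\<bar>)
      = expec books (\<lambda>C. enc_dev C m \<gamma>)"
      unfolding books_def
      by (subst Pi_pmf_subset[OF idx(1) J]) (simp add: sumJ cardJ)
    finally show ?thesis by (simp add: cardJ)
  qed
  have cM: "real (card M) > 0" "real (card G) > 0" using M G by (auto simp: card_gt_0_iff)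
  have "expec books enc_tv = (\<Sum>m\<in>M. \<Sum>\<gamma>\<in>G. expec books (\<lambda>C. enc_dev C m \<gamma>)) / (real (card M) * real (card G))"
    unfolding enc_tv_def[abs_def] by (simp add: intb del: sum_divide_distrib)
  also have "\<dots> \<le> (\<Sum>m\<in>M. \<Sum>\<gamma>\<in>G. sqrt (B / real (card L)) + 2 * prb avg_law {(u, e, x). (u, e) \<notin> A}) / (real (card M) * real (card G))"
    by (intro divide_right_mono sum_mono one) auto
  also have "\<dots> = sqrt (B / real (card L)) + 2 * prb avg_law {(u, e, x). (u, e) \<notin> A}"
    using cM by simp
  finally show ?thesis .
qed

end

section \<open>Covering, decoding and leakage under the ideal law\<close>

lemma prob_le_sum_cover:
  assumes "finite J" "\<And>w. w \<in> set_pmf p \<Longrightarrow> w \<in> A \<Longrightarrow> \<exists>j\<in>J. w \<in> B j"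
  shows "prb p A \<le> (\<Sum>j\<in>J. prb p (B j))"
proof -
  have "prb p A = prb p (A \<inter> set_pmf p)" by (simp add: measure_Int_set_pmf)
  also have "\<dots> \<le> prb p (\<Union>j\<in>J. B j)"
    using assms(2) by (intro measure_pmf.finite_measure_mono) auto
  also have "\<dots> \<le> (\<Sum>j\<in>J. prb p (B j))"
    using assms(1) by (intro measure_pmf.finite_measure_subadditive_finite) auto
  finally show ?thesis .
qed

context random_code
begin

definition VY where "VY u = map_pmf (\<lambda>(e, x). Yo x) (outp u)"
definition VT where "VT u = map_pmf (\<lambda>(e, x). To x) (outp u)"

lemma pY_bind: "pY = bind_pmf q VY"
  by (simp add: pY_def VY_def[abs_def] avg_law_def map_bind_pmf case_prod_unfold bind_return_pmf' map_pmf_def[symmetric] map_pmf_comp)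

lemma pT_bind: "pT = bind_pmf q VT"
  by (simp add: pT_def VT_def[abs_def] avg_law_def map_bind_pmf case_prod_unfold bind_return_pmf' map_pmf_def[symmetric] map_pmf_comp)

lemma fin_pY: "finite (set_pmf pY)" by (auto simp: pY_def fin_avg_law)
lemma fin_pT: "finite (set_pmf pT)" by (auto simp: pT_def fin_avg_law)

definition cov_tv where
  "cov_tv C = (\<Sum>t\<in>set_pmf pT. \<bar>(\<Sum>i\<in>idx. pmf (VT (C i)) t) / NK - pmf pT t\<bar>)"

lemma prob_ideal_T_le:
  assumes C: "C \<in> set_pmf books"
  shows "prb (ideal C) {(i, e, x). To x \<in> A} \<le> prb pT A + cov_tv C"
proof -
  define \<pi> where "\<pi> = bind_pmf (pmf_of_set idx) (\<lambda>i. VT (C i))"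
  have \<pi>: "\<pi> = map_pmf (\<lambda>(i, e, x). To x) (ideal C)"
    by (simp add: \<pi>_def VT_def ideal_def map_bind_pmf case_prod_unfold bind_return_pmf' map_pmf_def[symmetric] map_pmf_comp)
  have sub: "set_pmf \<pi> \<subseteq> set_pmf pT"
    using books_mem[OF C] idx by (auto simp: \<pi>_def pT_bind)
  have "pmf \<pi> t = (\<Sum>i\<in>idx. pmf (VT (C i)) t) / NK" for t
    by (simp add: \<pi>_def pmf_bind integral_pmf_of_set idx)
  then show ?thesis
    using measure_bind_pmf_le[OF fin_pT sub order_refl, of return_pmf A]
    by (simp add: bind_return_pmf' \<pi> cov_tv_def vimage_def case_prod_unfold)
qed

lemma prob_VT: "prb (VT u) A = prb (outp u) {(e, x). To x \<in> A}"
  by (simp add: VT_def vimage_def case_prod_unfold)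

lemma expectation_cov_tv:
  assumes B: "B > 0" and A: "\<And>u t. u \<in> set_pmf q \<Longrightarrow> (u, t) \<in> A \<Longrightarrow> pmf (VT u) t \<le> B * pmf pT t"
  shows "expec books cov_tv
    \<le> sqrt (B / NK) + 2 * prb avg_law {(u, e, x). (u, To x) \<notin> A}"
proof -
  have "expec books cov_tv
    \<le> sqrt (B / NK) + 2 * expec q (\<lambda>u. prb (VT u) {t. (u, t) \<notin> A})"
    unfolding books_def cov_tv_def[abs_def]
    by (rule soft_covering) (use idx finq fin_pT B A in \<open>auto simp: pT_bind\<close>)
  also have "expec q (\<lambda>u. prb (VT u) {t. (u, t) \<notin> A})
     = prb avg_law {(u, e, x). (u, To x) \<notin> A}"
    using expectation_outp[of "{(u, e, x). (u, To x) \<notin> A}"] by (simp add: prob_VT)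
  finally show ?thesis .
qed

text \<open>The decoder knows \<open>\<gamma>\<close>, so it searches only over \<open>M\<close> and
  \<open>L\<close>. Ties are broken arbitrarily, and the fallback keeps the output in
  \<open>M\<close> as \<open>is_code\<close> demands.\<close>

definition dec where
  "dec Gd C y \<gamma> = (if \<exists>m\<in>M. \<exists>l\<in>L. (C (m, \<gamma>, l), y) \<in> Gd
     then (SOME m. m \<in> M \<and> (\<exists>l\<in>L. (C (m, \<gamma>, l), y) \<in> Gd)) else (SOME m. m \<in> M))"

lemma dec_eq:
  assumes "m \<in> M" "l \<in> L" "(C (m, \<gamma>, l), y) \<in> Gd"
  shows "dec Gd C y \<gamma> \<in> M \<and> (\<exists>l\<in>L. (C (dec Gd C y \<gamma>, \<gamma>, l), y) \<in> Gd)"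
proof -
  have ex: "\<exists>m. m \<in> M \<and> (\<exists>l\<in>L. (C (m, \<gamma>, l), y) \<in> Gd)" using assms by blast
  then have "dec Gd C y \<gamma> = (SOME m. m \<in> M \<and> (\<exists>l\<in>L. (C (m, \<gamma>, l), y) \<in> Gd))"
    by (auto simp: dec_def)
  then show ?thesis using someI_ex[OF ex] by simp
qed

lemma dec_in: "dec Gd C y \<gamma> \<in> M"
proof (cases "\<exists>m\<in>M. \<exists>l\<in>L. (C (m, \<gamma>, l), y) \<in> Gd")
  case True
  then obtain m l where "m \<in> M" "l \<in> L" "(C (m, \<gamma>, l), y) \<in> Gd" by auto
  from dec_eq[where C=C and \<gamma>=\<gamma> and y=y and Gd=Gd, OF this] show ?thesis ..
next
  case False
  then have "dec Gd C y \<gamma> = (SOME m. m \<in> M)" unfolding dec_def by (rule if_not_P)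
  then show ?thesis using M(2) by (simp add: some_in_eq)
qed

text \<open>Codeword \<open>j\<close> is independent of the output of codeword \<open>i\<close>. On
  \<open>Gd\<close> the likelihood is at least \<open>B\<close> times the output probability, and
  likelihoods of accepted outputs sum to at most one.\<close>

lemma expectation_two_codewords:
  assumes B: "B > 0" and Gd: "\<And>u y. u \<in> set_pmf q \<Longrightarrow> (u, y) \<in> Gd \<Longrightarrow> B * pmf pY y \<le> pmf (VY u) y"
    and ij: "i \<in> idx" "j \<in> idx" "i \<noteq> j"
  shows "expec books (\<lambda>C. prb (outp (C i)) {(e, x). (C j, Yo x) \<in> Gd}) \<le> 1 / B"
proof -
  have "expec books (\<lambda>C. prb (outp (C i)) {(e, x). (C j, Yo x) \<in> Gd})
      = expec (map_pmf (\<lambda>C. (C i, C j)) books)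
          (\<lambda>(u, u'). prb (outp u) {(e, x). (u', Yo x) \<in> Gd})"
    by simp
  also have "\<dots> = expec q (\<lambda>u'. expec q (\<lambda>u. 
      prb (outp u) {(e, x). (u', Yo x) \<in> Gd}))"
    unfolding books_def Pi_pmf_pair_component[OF idx(1) ij] by (rule expectation_pair_pmf_iterated[OF finq finq])
  also have "\<dots> = expec q (\<lambda>u'. prb pY {y. (u', y) \<in> Gd})"
    by (simp add: pY_bind measure_bind_pmf[of q] VY_def vimage_def case_prod_unfold)
  also have "\<dots> \<le> expec q (\<lambda>u'. 1 / B)"
  proof (intro integral_mono_AE intq)
    show "AE u in measure_pmf q. prb pY {y. (u, y) \<in> Gd} \<le> 1 / B"
      unfolding AE_measure_pmf_iff
    proof
      fix u assume u: "u \<in> set_pmf q"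
      have "prb pY {y. (u, y) \<in> Gd} = (\<Sum>y\<in>set_pmf pY \<inter> {y. (u, y) \<in> Gd}. pmf pY y)"
        by (rule measure_pmf_finite_support[OF fin_pY order_refl])
      also have "\<dots> \<le> (\<Sum>y\<in>set_pmf pY \<inter> {y. (u, y) \<in> Gd}. pmf (VY u) y / B)"
        using Gd[OF u] B by (intro sum_mono) (auto simp: field_simps)
      also have "\<dots> = prb (VY u) (set_pmf pY \<inter> {y. (u, y) \<in> Gd}) / B"
        by (simp add: sum_divide_distrib[symmetric] measure_measure_pmf_finite fin_pY)
      also have "\<dots> \<le> 1 / B" using B by (intro divide_right_mono) auto
      finally show "prb pY {y. (u, y) \<in> Gd} \<le> 1 / B" .
    qed
  qed
  finally show ?thesis by simp
qed

lemma expectation_decoding_error: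
  assumes B: "B > 0" and Gd: "\<And>u y. u \<in> set_pmf q \<Longrightarrow> (u, y) \<in> Gd \<Longrightarrow> B * pmf pY y \<le> pmf (VY u) y"
  shows "expec books
      (\<lambda>C. prb (ideal C) {((m, \<gamma>, l), e, x). m \<noteq> dec Gd C (Yo x) \<gamma>})
    \<le> prb avg_law {(u, e, x). (u, Yo x) \<notin> Gd} + real (card M) * real (card L) / B"
proof -
  \<comment> \<open>All competitors that share \<open>\<gamma>\<close> with the sent index,
    including those that carry the right message.\<close>
  define J where "J i = (case i of (m, \<gamma>, l) \<Rightarrow> M \<times> {\<gamma>} \<times> L - {i})" for i :: "nat \<times> nat \<times> nat"
  define E1 where "E1 C = prb (ideal C) {(i, e, x). (C i, e, x) \<in> {(u, e, x). (u, Yo x) \<notin> Gd}}" for C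
  define E2 where "E2 C i j = prb (outp (C i)) {(e, x). (C j, Yo x) \<in> Gd}"
    for C and i j :: "nat \<times> nat \<times> nat"
  have finJ: "finite (J i)" for i using M L by (auto simp: J_def split: prod.split)
  have Jidx: "J i \<subseteq> idx" "i \<notin> J i" if "i \<in> idx" for i using that by (auto simp: J_def idx_def)
  have cardJ: "real (card (J i)) \<le> real (card M) * real (card L)" for i
  proof -
    have "card (J i) \<le> card (M \<times> {fst (snd i)} \<times> L)"
      using M L by (intro card_mono) (auto simp: J_def split: prod.splits)
    also have "\<dots> = card M * card L" by (simp add: card_cartesian_product)
    finally show ?thesis by (metis of_nat_le_iff of_nat_mult)
  qed
  have "prb (ideal C) {((m, \<gamma>, l), e, x). m \<noteq> dec Gd C (Yo x) \<gamma>}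
     \<le> E1 C + (\<Sum>i\<in>idx. \<Sum>j\<in>J i. E2 C i j) / NK" for C
  proof -
    have "prb (outp (C i)) {(e, x). (i, e, x) \<in> {((m, \<gamma>, l), e, x). m \<noteq> dec Gd C (Yo x) \<gamma>}}
       \<le> prb (outp (C i)) {(e, x). (C i, Yo x) \<notin> Gd} + (\<Sum>j\<in>J i. E2 C i j)"
      if i: "i \<in> idx" for i
    proof -
      obtain m \<gamma> l where mgl: "i = (m, \<gamma>, l)" "m \<in> M" "l \<in> L" using i by (auto simp: idx_def)
      \<comment> \<open>\<open>None\<close> stands for the sent codeword failing the test,
        \<open>Some j\<close> for competitor \<open>j\<close> passing it.\<close>
      let ?B = "\<lambda>j. case j of None \<Rightarrow> {(e, x). (C i, Yo x) \<notin> Gd} | Some j \<Rightarrow> {(e, x). (C j, Yo x) \<in> Gd}"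
      have "prb (outp (C i)) {(e, x). (i, e, x) \<in> {((m, \<gamma>, l), e, x). m \<noteq> dec Gd C (Yo x) \<gamma>}}
        \<le> (\<Sum>j\<in>insert None (Some ` J i). prb (outp (C i)) (?B j))"
      proof (rule prob_le_sum_cover)
        fix w assume "w \<in> {(e, x). (i, e, x) \<in> {((m, \<gamma>, l), e, x). m \<noteq> dec Gd C (Yo x) \<gamma>}}"
        then obtain e x where w: "w = (e, x)" "m \<noteq> dec Gd C (Yo x) \<gamma>" by (auto simp: mgl)
        show "\<exists>j\<in>insert None (Some ` J i). w \<in> ?B j"
        proof (cases "(C i, Yo x) \<in> Gd")
          case True
          from dec_eq[OF mgl(2,3), of C \<gamma> "Yo x" Gd] True mgl obtain l' where
            "dec Gd C (Yo x) \<gamma> \<in> M" "l' \<in> L" "(C (dec Gd C (Yo x) \<gamma>, \<gamma>, l'), Yo x) \<in> Gd" by auto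
          then show ?thesis using w mgl
            by (intro bexI[of _ "Some (dec Gd C (Yo x) \<gamma>, \<gamma>, l')"]) (auto simp: J_def)
        qed (use w in auto)
      qed (use finJ in auto)
      also have "\<dots> = prb (outp (C i)) {(e, x). (C i, Yo x) \<notin> Gd} + (\<Sum>j\<in>J i. E2 C i j)"
        using finJ by (subst sum.insert) (auto simp: sum.reindex E2_def)
      finally show ?thesis .
    qed
    then have "prb (ideal C) {((m, \<gamma>, l), e, x). m \<noteq> dec Gd C (Yo x) \<gamma>}
      \<le> (\<Sum>i\<in>idx. prb (outp (C i)) {(e, x). (C i, Yo x) \<notin> Gd} + (\<Sum>j\<in>J i. E2 C i j)) / NK"
      unfolding prob_ideal by (intro divide_right_mono sum_mono) auto
    then show ?thesis by (simp add: E1_def prob_ideal sum.distrib add_divide_distrib)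
  qed
  then have "expec books
      (\<lambda>C. prb (ideal C) {((m, \<gamma>, l), e, x). m \<noteq> dec Gd C (Yo x) \<gamma>})
    \<le> expec books (\<lambda>C. E1 C + (\<Sum>i\<in>idx. \<Sum>j\<in>J i. E2 C i j) / NK)"
    by (intro integral_mono intb)
  also have "\<dots> = expec books E1
     + (\<Sum>i\<in>idx. \<Sum>j\<in>J i. expec books (\<lambda>C. E2 C i j)) / NK"
    by (simp add: intb)
  also have "expec books E1 = prb avg_law {(u, e, x). (u, Yo x) \<notin> Gd}"
    unfolding E1_def[abs_def] by (rule expectation_ideal)
  also have "(\<Sum>i\<in>idx. \<Sum>j\<in>J i. expec books (\<lambda>C. E2 C i j)) / NK
     \<le> (\<Sum>i\<in>idx. \<Sum>j\<in>J i. 1 / B) / NK"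
    unfolding E2_def using Jidx
    by (intro divide_right_mono sum_mono expectation_two_codewords[OF B Gd]) auto
  also have "\<dots> \<le> (\<Sum>i\<in>idx. real (card M) * real (card L) / B) / NK"
  proof (intro divide_right_mono sum_mono)
    fix i show "(\<Sum>j\<in>J i. 1 / B) \<le> real (card M) * real (card L) / B"
      using divide_right_mono[OF cardJ[of i], of B] B by simp
  qed simp
  also have "\<dots> = real (card M) * real (card L) / B" using NK(2) by simp
  finally show ?thesis by simp
qed

definition hit_mass where
  "hit_mass Ty Near C y t = (\<Sum>i\<in>idx. prb (outp (C i)) 
      {(e, x). Yo x = y \<and> (C i, y, To x) \<in> Ty \<and> To x \<in> Near t})"

text \<open>A bound valid for all eavesdroppers at once: each of the \<open>N\<close> replies
  available for \<open>y\<close> gains at most the hit mass of the best target.\<close>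

definition leak where
  "leak Ty Near TT (N :: nat) C = real N * (\<Sum>y\<in>set_pmf pY. Max (hit_mass Ty Near C y ` TT)) / NK"

text \<open>The henchman is replaced by the list of all replies \<open>g y k\<close>. Whatever is
  sent after seeing the reconstruction, \<open>y\<close> and \<open>\<gamma>\<close>, success
  requires that some member of this list is close.\<close>

lemma prob_list_hit_le:
  assumes C: "C \<in> set_pmf books" and TT: "finite TT" and g: "\<And>y k. g y k \<in> TT" and Ks: "finite Ks"
  shows "prb (ideal C) {(i, e, x). (\<exists>k\<in>Ks. To x \<in> Near (g (Yo x) k)) \<and> (C i, Yo x, To x) \<in> Ty}
    \<le> leak Ty Near TT (card Ks) C"
proof -
  let ?B = "\<lambda>i y k. {(e, x). Yo x = y \<and> (C i, y, To x) \<in> Ty \<and> To x \<in> Near (g y k)}"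
  have "prb (outp (C i)) {(e, x). (i, e, x) \<in>
        {(i, e, x). (\<exists>k\<in>Ks. To x \<in> Near (g (Yo x) k)) \<and> (C i, Yo x, To x) \<in> Ty}}
     \<le> (\<Sum>y\<in>set_pmf pY. \<Sum>k\<in>Ks. prb (outp (C i)) (?B i y k))" if i: "i \<in> idx" for i
  proof -
    have "prb (outp (C i)) {(e, x). (i, e, x) \<in>
        {(i, e, x). (\<exists>k\<in>Ks. To x \<in> Near (g (Yo x) k)) \<and> (C i, Yo x, To x) \<in> Ty}}
      \<le> (\<Sum>j\<in>set_pmf pY \<times> Ks. prb (outp (C i)) (?B i (fst j) (snd j)))"
    proof (rule prob_le_sum_cover)
      fix w assume w: "w \<in> set_pmf (outp (C i))" "w \<in> {(e, x). (i, e, x) \<in>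
          {(i, e, x). (\<exists>k\<in>Ks. To x \<in> Near (g (Yo x) k)) \<and> (C i, Yo x, To x) \<in> Ty}}"
      obtain e x where ex: "w = (e, x)" by (cases w)
      have "Yo x \<in> set_pmf (VY (C i))" using w(1) by (simp add: VY_def ex rev_image_eqI)
      then have "Yo x \<in> set_pmf pY" using books_mem[OF C i] by (auto simp: pY_bind)
      moreover obtain k where "k \<in> Ks" "To x \<in> Near (g (Yo x) k)" "(C i, Yo x, To x) \<in> Ty"
        using w(2) unfolding ex by blast
      ultimately show "\<exists>j\<in>set_pmf pY \<times> Ks. w \<in> ?B i (fst j) (snd j)"
        unfolding ex by (intro bexI[of _ "(Yo x, k)"]) simp_all
    qed (rule finite_cartesian_product[OF fin_pY Ks])
    then show ?thesis unfolding sum.cartesian_product by (simp only: case_prod_unfold)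
  qed
  then have "prb (ideal C) {(i, e, x). (\<exists>k\<in>Ks. To x \<in> Near (g (Yo x) k)) \<and> (C i, Yo x, To x) \<in> Ty}
    \<le> (\<Sum>i\<in>idx. \<Sum>y\<in>set_pmf pY. \<Sum>k\<in>Ks. prb (outp (C i)) (?B i y k)) / NK"
    unfolding prob_ideal by (intro divide_right_mono sum_mono) auto
  also have "(\<Sum>i\<in>idx. \<Sum>y\<in>set_pmf pY. \<Sum>k\<in>Ks. prb (outp (C i)) (?B i y k))
     = (\<Sum>y\<in>set_pmf pY. \<Sum>k\<in>Ks. hit_mass Ty Near C y (g y k))"
    (is "?lhs = ?rhs")
  proof -
    have "?lhs = (\<Sum>y\<in>set_pmf pY. \<Sum>i\<in>idx. \<Sum>k\<in>Ks. prb (outp (C i)) (?B i y k))"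
      by (rule sum.swap)
    also have "\<dots> = (\<Sum>y\<in>set_pmf pY. \<Sum>k\<in>Ks. \<Sum>i\<in>idx. prb (outp (C i)) (?B i y k))"
      by (rule sum.cong[OF refl]) (rule sum.swap)
    finally show ?thesis unfolding hit_mass_def .
  qed
  also have "\<dots> \<le> (\<Sum>y\<in>set_pmf pY. \<Sum>k\<in>Ks. Max (hit_mass Ty Near C y ` TT))"
    using g TT by (intro sum_mono Max_ge) auto
  also have "\<dots> = real (card Ks) * (\<Sum>y\<in>set_pmf pY. Max (hit_mass Ty Near C y ` TT))"
    by (simp add: sum_distrib_left)
  finally show ?thesis by (simp add: leak_def divide_right_mono)
qed

text \<open>Both hypotheses carry the factor \<open>pmf pY y\<close>. It survives in the bound on
  each maximum, so summing over exponentially many \<open>y\<close> costs nothing.\<close>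

lemma expectation_leak:
  assumes TT: "finite TT" "TT \<noteq> {}" and \<beta>: "\<beta> > 0"
    and b: "\<And>u y t. u \<in> set_pmf q \<Longrightarrow> y \<in> set_pmf pY \<Longrightarrow> t \<in> TT \<Longrightarrow>
      prb (outp u) {(e, x). Yo x = y \<and> (u, y, To x) \<in> Ty \<and> To x \<in> Near t} \<le> \<beta> * pmf pY y"
    and mu: "\<And>y t. y \<in> set_pmf pY \<Longrightarrow> t \<in> TT \<Longrightarrow>
      prb avg_law {(u, e, x). Yo x = y \<and> (u, y, To x) \<in> Ty \<and> To x \<in> Near t} \<le> \<mu> * pmf pY y"
  shows "expec books (leak Ty Near TT N)
    \<le> real N * (\<beta> * ln (real (card TT)) / NK + 2 * \<mu>)"
proof -
  have one: "expec books (\<lambda>C. Max (hit_mass Ty Near C y ` TT))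
     \<le> (\<beta> * ln (real (card TT)) + 2 * NK * \<mu>) * pmf pY y" if y: "y \<in> set_pmf pY" for y
  proof -
    define f where "f t u = prb (outp u) {(e, x). Yo x = y \<and> (u, y, To x) \<in> Ty \<and> To x \<in> Near t}" for t u
    have "expec (Pi_pmf idx dflt (\<lambda>_. q)) (\<lambda>C. Max ((\<lambda>t. \<Sum>i\<in>idx. f t (C i)) ` TT))
       \<le> (\<beta> * pmf pY y) * ln (real (card TT)) + 2 * NK * (\<mu> * pmf pY y)"
    proof (rule expectation_Max_sum_le[OF idx(1) finq TT])
      show "0 < \<beta> * pmf pY y" using \<beta> y by (simp add: pmf_positive)
      show "expec q (f t) \<le> \<mu> * pmf pY y" if "t \<in> TT" for t
        using mu[OF y that] expectation_outp[of "{(u, e, x). Yo x = y \<and> (u, y, To x) \<in> Ty \<and> To x \<in> Near t}"]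
        by (simp add: f_def[abs_def])
    qed (use b y in \<open>auto simp: f_def\<close>)
    then show ?thesis by (simp add: books_def hit_mass_def[abs_def] f_def algebra_simps)
  qed
  have "expec books (leak Ty Near TT N)
     = real N * (\<Sum>y\<in>set_pmf pY. expec books (\<lambda>C. Max (hit_mass Ty Near C y ` TT))) / NK"
    unfolding leak_def[abs_def] by (simp add: intb)
  also have "\<dots> \<le> real N * (\<Sum>y\<in>set_pmf pY. (\<beta> * ln (real (card TT)) + 2 * NK * \<mu>) * pmf pY y) / NK"
    by (intro divide_right_mono mult_left_mono sum_mono one) auto
  also have "(\<Sum>y\<in>set_pmf pY. (\<beta> * ln (real (card TT)) + 2 * NK * \<mu>) * pmf pY y)
      = \<beta> * ln (real (card TT)) + 2 * NK * \<mu>"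
    using sum_pmf_eq_1[OF fin_pY order_refl] by (simp add: sum_distrib_left[symmetric])
  also have "real N * (\<beta> * ln (real (card TT)) + 2 * NK * \<mu>) / NK = real N * (\<beta> * ln (real (card TT)) / NK + 2 * \<mu>)"
    using NK(2) by (simp add: add_divide_distrib distrib_left)
  finally show ?thesis .
qed

end

section \<open>Mutual information of finitely supported laws\<close>

lemma KL_divergence_pmf:
  fixes p q :: "'a::countable pmf"
  assumes fin: "finite (set_pmf q)" and ac: "set_pmf q \<subseteq> set_pmf p"
  shows "KL_divergence 2 (measure_pmf p) (measure_pmf q)
     = expec q (\<lambda>x. log 2 (pmf q x / pmf p x))"
proof -
  interpret sigma_finite_measure "count_space (UNIV :: 'a set)"
    by (rule sigma_finite_measure_count_space)
  have "KL_divergence 2 (measure_pmf p) (measure_pmf q)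
     = KL_divergence 2 (density (count_space UNIV) (pmf p)) (density (count_space UNIV) (pmf q))"
    by (simp add: measure_pmf_eq_density)
  also have "\<dots> = (\<integral>x. pmf q x * log 2 (pmf q x / pmf p x) \<partial>count_space UNIV)"
    by (rule KL_density_density) (use ac in \<open>auto simp: AE_count_space set_pmf_iff\<close>)
  also have "\<dots> = expec q (\<lambda>x. log 2 (pmf q x / pmf p x))"
    by (simp add: measure_pmf_eq_density[of q] integral_density)
  finally show ?thesis .
qed

lemma pair_measure_pmf:
  fixes p :: "'a::countable pmf" and q :: "'b::countable pmf"
  shows "measure_pmf p \<Otimes>\<^sub>M measure_pmf q = measure_pmf (pair_pmf p q)"
proof (rule pair_measure_eqI)
  show "sigma_finite_measure (measure_pmf p)" "sigma_finite_measure (measure_pmf q)"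
    by unfold_locales
  have "sets (measure_pmf p \<Otimes>\<^sub>M measure_pmf q) = sets (count_space UNIV \<Otimes>\<^sub>M count_space UNIV)"
    by (intro sets_pair_measure_cong) auto
  also have "count_space UNIV \<Otimes>\<^sub>M count_space UNIV = (count_space UNIV :: ('a \<times> 'b) measure)"
    by (simp add: pair_measure_countable)
  finally show "sets (measure_pmf p \<Otimes>\<^sub>M measure_pmf q) = sets (measure_pmf (pair_pmf p q))"
    by simp
  fix A B assume "A \<in> sets (measure_pmf p)" "B \<in> sets (measure_pmf q)"
  show "emeasure (measure_pmf p) A * emeasure (measure_pmf q) B = emeasure (measure_pmf (pair_pmf p q)) (A \<times> B)"
    by (simp add: measure_pmf.emeasure_eq_measure measure_pmf_prob_product ennreal_mult)
qed

lemma mutual_info_eq: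
  fixes A :: "'w \<Rightarrow> 'a::countable" and B :: "'w \<Rightarrow> 'b::countable"
  assumes fin: "finite (set_pmf Q)"
  shows "mutual_info Q A B
    = expec Q (\<lambda>w. log 2 (pmf (map_pmf (\<lambda>w. (A w, B w)) Q) (A w, B w)
        / (pmf (map_pmf A Q) (A w) * pmf (map_pmf B Q) (B w))))"
proof -
  have cs: "count_space UNIV \<Otimes>\<^sub>M count_space UNIV = (count_space UNIV :: ('a \<times> 'b) measure)"
    by (simp add: pair_measure_countable)
  have "mutual_info Q A B
    = KL_divergence 2 (measure_pmf (pair_pmf (map_pmf A Q) (map_pmf B Q))) (measure_pmf (map_pmf (\<lambda>w. (A w, B w)) Q))"
    unfolding mutual_info_def prob_space.mutual_information_def[OF measure_pmf.prob_space_axioms] cs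
    by (simp add: map_pmf_rep_eq[symmetric] pair_measure_pmf)
  also have "\<dots> = expec (map_pmf (\<lambda>w. (A w, B w)) Q)
      (\<lambda>x. log 2 (pmf (map_pmf (\<lambda>w. (A w, B w)) Q) x / pmf (pair_pmf (map_pmf A Q) (map_pmf B Q)) x))"
    by (rule KL_divergence_pmf) (use fin in auto)
  finally show ?thesis by (simp add: pmf_pair)
qed

lemma cond_mutual_info_eq:
  fixes A :: "'w \<Rightarrow> 'a::countable" and B :: "'w \<Rightarrow> 'b::countable" and C :: "'w \<Rightarrow> 'c::countable"
  assumes "finite (set_pmf Q)"
  shows "cond_mutual_info Q A B C = mutual_info Q A (\<lambda>w. (B w, C w)) - mutual_info Q A C"
proof -
  have cs: "count_space UNIV \<Otimes>\<^sub>M count_space UNIV = (count_space UNIV :: ('b \<times> 'c) measure)"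
    by (simp add: pair_measure_countable)
  show ?thesis
    unfolding cond_mutual_info_def mutual_info_def
      prob_space.conditional_mutual_information_def[OF measure_pmf.prob_space_axioms] cs ..
qed

section \<open>Conditional mutual information as a function of weights\<close>

definition xlog :: "real \<Rightarrow> real" where "xlog x = x * log 2 x"

lemma continuous_on_xlog: "continuous_on {0..} xlog"
  unfolding continuous_on_def
proof
  fix x :: real assume "x \<in> {0..}"
  show "(xlog \<longlongrightarrow> xlog x) (at x within {0..})"
  proof (cases "x = 0")
    case True
    have "((\<lambda>x::real. x * log 2 x) \<longlongrightarrow> 0) (at_right 0)" by real_asymp
    then have "(xlog \<longlongrightarrow> xlog 0) (at 0 within {0<..})" by (simp add: xlog_def[abs_def])
    moreover have "at (0::real) within {0..} = at 0 within {0<..}"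
    proof -
      have "{0..} - {0::real} = {0<..} - {0}" by auto
      then show ?thesis by (simp only: at_within_def)
    qed
    ultimately show ?thesis using True by simp
  next
    case False
    then have "x > 0" using \<open>x \<in> {0..}\<close> by simp
    then have "isCont xlog x" unfolding xlog_def[abs_def] by (intro continuous_intros) auto
    then show ?thesis by (simp add: isCont_def tendsto_within_subset[OF _ subset_UNIV])
  qed
qed

text \<open>Marginals of plain weight functions rather than of probability laws: this lets empirical
  frequencies enter directly and places the compactness argument in a product of intervals.\<close>

definition marg :: "'w set \<Rightarrow> ('w \<Rightarrow> 'a) \<Rightarrow> ('w \<Rightarrow> real) \<Rightarrow> 'a \<Rightarrow> real" where
  "marg F f V x = (\<Sum>w\<in>{w\<in>F. f w = x}. V w)"

definition neg_ent :: "'w set \<Rightarrow> ('w \<Rightarrow> 'a) \<Rightarrow> ('w \<Rightarrow> real) \<Rightarrow> real" where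
  "neg_ent F f V = (\<Sum>x\<in>f ` F. xlog (marg F f V x))"

text \<open>This is I(S;T|V) as a combination of four joint entropies. Without conditional
  probabilities there is no division, so continuity holds up to the boundary of the simplex.\<close>

definition cmi :: "('s \<times> 'v \<times> 't) set \<Rightarrow> ('s \<times> 'v \<times> 't \<Rightarrow> real) \<Rightarrow> real" where
  "cmi F V = neg_ent F (\<lambda>w. w) V + neg_ent F (\<lambda>(s, v, t). v) V
     - neg_ent F (\<lambda>(s, v, t). (s, v)) V - neg_ent F (\<lambda>(s, v, t). (v, t)) V"

lemma pmf_map_marg:
  assumes "finite F" "set_pmf J \<subseteq> F"
  shows "pmf (map_pmf f J) x = marg F f (pmf J) x"
proof -
  have "pmf (map_pmf f J) x = prb J (f -` {x})" by (rule pmf_map)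
  also have "\<dots> = (\<Sum>w\<in>F \<inter> f -` {x}. pmf J w)" by (rule measure_pmf_finite_support[OF assms])
  also have "F \<inter> f -` {x} = {w\<in>F. f w = x}" by auto
  finally show ?thesis by (simp add: marg_def)
qed

lemma expectation_log_pmf_map:
  assumes "finite F" "set_pmf J \<subseteq> F"
  shows "expec J (\<lambda>w. log 2 (pmf (map_pmf f J) (f w))) = neg_ent F f (pmf J)"
proof -
  have "expec J (\<lambda>w. log 2 (pmf (map_pmf f J) (f w)))
     = expec (map_pmf f J) (\<lambda>x. log 2 (pmf (map_pmf f J) x))" by simp
  also have "\<dots> = (\<Sum>x\<in>f ` F. pmf (map_pmf f J) x * log 2 (pmf (map_pmf f J) x))"
    by (subst integral_measure_pmf[of "f ` F"]) (use assms in auto)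
  finally show ?thesis by (simp add: neg_ent_def xlog_def pmf_map_marg[OF assms])
qed

definition log_pmf :: "'w pmf \<Rightarrow> ('w \<Rightarrow> 'a) \<Rightarrow> 'w \<Rightarrow> real" where
  "log_pmf J f w = log 2 (pmf (map_pmf f J) (f w))"

lemma cond_mutual_info_cmi:
  fixes J :: "('s::countable \<times> 'v::countable \<times> 't::countable) pmf"
  assumes F: "finite F" "set_pmf J \<subseteq> F"
  shows "cond_mutual_info J (\<lambda>(s, v, t). s) (\<lambda>(s, v, t). t) (\<lambda>(s, v, t). v) = cmi F (pmf J)"
proof -
  let ?A = "\<lambda>(s, v, t). s" and ?B = "\<lambda>(s, v, t). t" and ?C = "\<lambda>(s, v, t). v"
  have fin: "finite (set_pmf J)" using F finite_subset by blast
  note int = integrable_measure_pmf_finite[OF fin]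
  have pos: "pmf (map_pmf f J) (f w) > 0" if "w \<in> set_pmf J" for w and f :: "'s \<times> 'v \<times> 't \<Rightarrow> 'x"
    using that by (intro pmf_positive) auto
  \<comment> \<open>The measure-theoretic formula lists the triple as (s, t, v), \<open>cmi\<close>
    as (s, v, t); an injective relabelling does not change point masses.\<close>
  have swap: "pmf (map_pmf (\<lambda>w. (g1 w, g2 w, g3 w)) J) (g1 w, g2 w, g3 w)
      = pmf (map_pmf (\<lambda>w. w) J) w"
    if "inj (\<lambda>w. (g1 w, g2 w, g3 w))"
    for g1 :: "'s \<times> 'v \<times> 't \<Rightarrow> 'x" and g2 :: "'s \<times> 'v \<times> 't \<Rightarrow> 'y" and g3 :: "'s \<times> 'v \<times> 't \<Rightarrow> 'z" and w
    using pmf_map_inj'[OF that, of J w] by simp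
  have swap2: "pmf (map_pmf (\<lambda>w. (?B w, ?C w)) J) (?B w, ?C w)
      = pmf (map_pmf (\<lambda>(s, v, t). (v, t)) J) ((\<lambda>(s, v, t). (v, t)) w)" for w
  proof -
    have "map_pmf (\<lambda>w. (?B w, ?C w)) J = map_pmf prod.swap (map_pmf (\<lambda>(s, v, t). (v, t)) J)"
      by (simp add: map_pmf_comp case_prod_unfold prod.swap_def)
    then show ?thesis
      using pmf_map_inj'[OF inj_swap[of UNIV], of "map_pmf (\<lambda>(s, v, t). (v, t)) J" "(\<lambda>(s, v, t). (v, t)) w"]
      by (simp only: case_prod_unfold prod.swap_def fst_conv snd_conv)
  qed
  have inj: "inj (\<lambda>w :: 's \<times> 'v \<times> 't. (?A w, ?B w, ?C w))" by (auto simp: inj_on_def)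
  have "cond_mutual_info J ?A ?B ?C
     = expec J (\<lambda>w. log 2 (pmf (map_pmf (\<lambda>w. (?A w, ?B w, ?C w)) J) (?A w, ?B w, ?C w)
        / (pmf (map_pmf ?A J) (?A w) * pmf (map_pmf (\<lambda>w. (?B w, ?C w)) J) (?B w, ?C w)))
       - log 2 (pmf (map_pmf (\<lambda>w. (?A w, ?C w)) J) (?A w, ?C w) / (pmf (map_pmf ?A J) (?A w) * pmf (map_pmf ?C J) (?C w))))"
    unfolding cond_mutual_info_eq[OF fin] mutual_info_eq[OF fin] by (simp add: int)
  also have "\<dots> = expec J (\<lambda>w. log_pmf J (\<lambda>w. w) w + log_pmf J ?C w - log_pmf J (\<lambda>(s, v, t). (s, v)) w - log_pmf J (\<lambda>(s, v, t). (v, t)) w)"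
  proof (intro integral_cong_AE)
    show "AE w in measure_pmf J. log 2 (pmf (map_pmf (\<lambda>w. (?A w, ?B w, ?C w)) J) (?A w, ?B w, ?C w)
        / (pmf (map_pmf ?A J) (?A w) * pmf (map_pmf (\<lambda>w. (?B w, ?C w)) J) (?B w, ?C w)))
       - log 2 (pmf (map_pmf (\<lambda>w. (?A w, ?C w)) J) (?A w, ?C w) / (pmf (map_pmf ?A J) (?A w) * pmf (map_pmf ?C J) (?C w)))
       = log_pmf J (\<lambda>w. w) w + log_pmf J ?C w - log_pmf J (\<lambda>(s, v, t). (s, v)) w - log_pmf J (\<lambda>(s, v, t). (v, t)) w"
      unfolding AE_measure_pmf_iff swap[OF inj] swap2
    proof
      fix w assume w: "w \<in> set_pmf J"
      have sv: "(\<lambda>w. (?A w, ?C w)) = (\<lambda>(s, v, t). (s, v))" "(?A w, ?C w) = (\<lambda>(s, v, t). (s, v)) w"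
        by (auto simp: fun_eq_iff case_prod_unfold)
      note p = pos[OF w, of "\<lambda>w. w"] pos[OF w, of ?A] pos[OF w, of ?C] pos[OF w, of "\<lambda>(s, v, t). (s, v)"]
        pos[OF w, of "\<lambda>(s, v, t). (v, t)"]
      show "log 2 (pmf (map_pmf (\<lambda>w. w) J) w
        / (pmf (map_pmf ?A J) (?A w) * pmf (map_pmf (\<lambda>(s, v, t). (v, t)) J) ((\<lambda>(s, v, t). (v, t)) w)))
       - log 2 (pmf (map_pmf (\<lambda>w. (?A w, ?C w)) J) (?A w, ?C w) / (pmf (map_pmf ?A J) (?A w) * pmf (map_pmf ?C J) (?C w)))
       = log_pmf J (\<lambda>w. w) w + log_pmf J ?C w - log_pmf J (\<lambda>(s, v, t). (s, v)) w - log_pmf J (\<lambda>(s, v, t). (v, t)) w"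
        unfolding sv log_pmf_def using p by (simp add: log_divide log_mult)
    qed
  qed simp_all
  also have "\<dots> = expec J (log_pmf J (\<lambda>w. w)) + expec J (log_pmf J ?C)
     - expec J (log_pmf J (\<lambda>(s, v, t). (s, v))) - expec J (log_pmf J (\<lambda>(s, v, t). (v, t)))"
    by (simp add: int)
  also have "\<dots> = cmi F (pmf J)"
    unfolding cmi_def log_pmf_def[abs_def] expectation_log_pmf_map[OF F] ..
  finally show ?thesis .
qed

section \<open>Conditional types and the distortion-rate function\<close>

lemma marg_nonneg: "(\<And>w. w \<in> F \<Longrightarrow> 0 \<le> V w) \<Longrightarrow> 0 \<le> marg F f V x"
  by (auto simp: marg_def intro!: sum_nonneg)

lemma continuous_on_marg: "continuous_on X (\<lambda>V :: 'w \<Rightarrow> real. marg F f V x)"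
  unfolding marg_def
  by (intro continuous_on_sum continuous_on_subset[OF continuous_on_product_coordinates subset_UNIV])

lemma continuous_on_neg_ent:
  fixes X :: "('w \<Rightarrow> real) set"
  assumes "\<And>V w. V \<in> X \<Longrightarrow> w \<in> F \<Longrightarrow> 0 \<le> V w"
  shows "continuous_on X (neg_ent F f)"
  unfolding neg_ent_def[abs_def]
  by (intro continuous_on_sum continuous_on_compose2[OF continuous_on_xlog] continuous_on_marg)
     (use assms in \<open>auto intro!: marg_nonneg\<close>)

text \<open>An instance of Tychonoff's theorem. Pinning the coordinates outside \<open>F\<close> to
  zero gives compactness in the full function space, on which \<open>marg\<close> and
  \<open>cmi\<close> are defined.\<close>

lemma compact_unit_box: "compact {V :: 'w \<Rightarrow> real. \<forall>w. 0 \<le> V w \<and> V w \<le> (if w \<in> F then 1 else 0)}"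
proof -
  have "compactin (product_topology (\<lambda>_. euclidean) UNIV) (PiE UNIV (\<lambda>w. {0..(if w \<in> F then 1 else (0::real))}))"
    by (subst compactin_PiE) auto
  also have "PiE UNIV (\<lambda>w. {0..(if w \<in> F then 1 else (0::real))}) = {V. \<forall>w. 0 \<le> V w \<and> V w \<le> (if w \<in> F then 1 else 0)}"
    by (auto simp: PiE_UNIV_domain Pi_def)
  finally show ?thesis unfolding euclidean_product_topology by (simp only: compactin_euclidean_iff)
qed

text \<open>Compactness of the simplex and continuity of the conditional mutual information turn the
  infimum defining the distortion-rate function into a bound that is stable under small
  perturbations of the source law and of the rate.\<close>

lemma distortion_rate_stable:
  fixes Q :: "('s::finite \<times> 'v::countable) pmf" and d :: "'s \<Rightarrow> 's \<Rightarrow> real"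
  assumes Q: "finite (set_pmf Q)" and r: "r \<ge> 0"
    and DE: "ereal DE \<le> cond_distortion_rate d r Q" and \<eta>: "\<eta> > 0"
  defines "F \<equiv> UNIV \<times> snd ` set_pmf Q \<times> UNIV"
  obtains \<epsilon> where "\<epsilon> > 0"
    and "\<And>V. (\<And>w. w \<in> F \<Longrightarrow> 0 \<le> V w) \<Longrightarrow> (\<Sum>w\<in>F. V w) = 1 \<Longrightarrow>
      (\<And>x. x \<in> UNIV \<times> snd ` set_pmf Q \<Longrightarrow> \<bar>marg F (\<lambda>(s, v, t). (s, v)) V x - pmf Q x\<bar> \<le> \<epsilon>) \<Longrightarrow>
      cmi F V \<le> r + \<epsilon> \<Longrightarrow> DE - \<eta> < (\<Sum>(s, v, t)\<in>F. V (s, v, t) * d s t)"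
proof -
  have F: "finite F" using Q by (auto simp: F_def)
  define SV where "SV = (UNIV :: 's set) \<times> snd ` set_pmf Q"
  have SV: "finite SV" using Q by (auto simp: SV_def)
  let ?sv = "\<lambda>(s :: 's, v :: 'v, t :: 's). (s, v)"
  let ?dist = "\<lambda>V :: 's \<times> 'v \<times> 's \<Rightarrow> real. (\<Sum>(s, v, t)\<in>F. V (s, v, t) * d s t)"
  \<comment> \<open>\<open>X\<close> holds the weights whose distortion is too small, and
    \<open>g\<close> measures by how much they violate the marginal and rate constraints. A zero of
    \<open>g\<close> on \<open>X\<close> would be a reconstruction kernel that beats the
    distortion-rate function.\<close>
  define X where "X = {V :: 's \<times> 'v \<times> 's \<Rightarrow> real. \<forall>w. 0 \<le> V w \<and> V w \<le> (if w \<in> F then 1 else 0)}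
     \<inter> ({V. (\<Sum>w\<in>F. V w) = 1} \<inter> {V. ?dist V \<le> DE - \<eta>})"
  define g where "g V = (\<Sum>x\<in>SV. \<bar>marg F ?sv V x - pmf Q x\<bar>) + max 0 (cmi F V - r)" for V
  have cont_dist: "continuous_on UNIV ?dist"
    unfolding case_prod_unfold
    by (intro continuous_on_sum continuous_on_mult continuous_on_const continuous_on_product_coordinates)
  have cont_tot: "continuous_on UNIV (\<lambda>V :: 's \<times> 'v \<times> 's \<Rightarrow> real. \<Sum>w\<in>F. V w)"
    by (intro continuous_on_sum continuous_on_product_coordinates)
  have "compact X" unfolding X_def
  proof (intro compact_Int_closed compact_unit_box closed_Int)
    show "closed {V :: 's \<times> 'v \<times> 's \<Rightarrow> real. (\<Sum>w\<in>F. V w) = 1}"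
      by (rule closed_Collect_eq) (intro cont_tot continuous_on_const)+
    show "closed {V. ?dist V \<le> DE - \<eta>}"
      by (rule closed_Collect_le) (intro cont_dist continuous_on_const)+
  qed
  have nn: "0 \<le> V w" if "V \<in> X" for V w using that by (cases w) (auto simp: X_def)
  have "continuous_on X g"
    unfolding g_def cmi_def[abs_def]
    by (intro continuous_intros continuous_on_marg continuous_on_neg_ent continuous_on_sum) (auto intro: nn)
  have pos: "g V > 0" if V: "V \<in> X" for V
  proof (rule ccontr)
    assume "\<not> 0 < g V"
    moreover have s0: "(\<Sum>x\<in>SV. \<bar>marg F ?sv V x - pmf Q x\<bar>) \<ge> 0" by (intro sum_nonneg) auto
    ultimately have z: "(\<Sum>x\<in>SV. \<bar>marg F ?sv V x - pmf Q x\<bar>) = 0" and cr: "cmi F V \<le> r"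
      unfolding g_def by linarith+
    have mq: "marg F ?sv V x = pmf Q x" if "x \<in> SV" for x
      using z that SV by (subst (asm) sum_nonneg_eq_0_iff) auto
    have Vout: "V w = 0" if "w \<notin> F" for w
    proof -
      have "0 \<le> V w \<and> V w \<le> (if w \<in> F then 1 else 0)" using V unfolding X_def by blast
      then show ?thesis using that by simp
    qed
    have tot: "(\<integral>\<^sup>+w. ennreal (V w) \<partial>count_space UNIV) = 1"
    proof -
      have "(\<integral>\<^sup>+w. ennreal (V w) \<partial>count_space UNIV) = (\<Sum>w\<in>F. ennreal (V w))"
        using Vout by (intro nn_integral_count_space' F) auto
      also have "\<dots> = ennreal (\<Sum>w\<in>F. V w)" using nn[OF V] by (simp add: sum_ennreal)
      finally show ?thesis using V by (simp add: X_def)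
    qed
    define J where "J = embed_pmf V"
    have pJ: "pmf J = V" unfolding J_def by (rule ext, rule pmf_embed_pmf[OF nn[OF V] tot])
    have JF: "set_pmf J \<subseteq> F"
    proof
      fix w assume "w \<in> set_pmf J"
      then have "V w \<noteq> 0" by (simp add: set_pmf_iff pJ)
      then show "w \<in> F" using Vout by blast
    qed
    \<comment> \<open>With \<open>t\<close> in front, disintegration over \<open>(s, v)\<close>
      gives the reconstruction kernel.\<close>
    define J' where "J' = map_pmf (\<lambda>(s, v, t). (t, (s, v))) J"
    have sndJ': "map_pmf snd J' = Q"
    proof (rule pmf_eqI)
      fix x
      have "map_pmf snd J' = map_pmf ?sv J" by (simp add: J'_def map_pmf_comp case_prod_unfold)
      then have e: "pmf (map_pmf snd J') x = marg F ?sv V x"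
        using pmf_map_marg[OF F JF, of ?sv x] pJ by simp
      show "pmf (map_pmf snd J') x = pmf Q x"
      proof (cases "x \<in> SV")
        case True then show ?thesis using e mq by simp
      next
        case False
        then have "{w \<in> F. ?sv w = x} = {}" by (auto simp: F_def SV_def)
        then have "marg F ?sv V x = 0" by (simp only: marg_def sum.empty)
        moreover have "x \<notin> set_pmf Q" using False by (cases x) (auto simp: SV_def intro: rev_image_eqI)
        then have "pmf Q x = 0" by (simp add: set_pmf_iff)
        ultimately show ?thesis using e by simp
      qed
    qed
    obtain \<kappa> where \<kappa>: "J' = do { b \<leftarrow> map_pmf snd J'; a \<leftarrow> \<kappa> b; return_pmf (a, b) }"
      using disintegration_pmf[of J'] by (elim exE conjE)
    define K where "K s v = \<kappa> (s, v)" for s v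
    have "recon_law Q K = map_pmf (\<lambda>(t, (s, v)). (s, v, t)) (do { b \<leftarrow> Q; a \<leftarrow> \<kappa> b; return_pmf (a, b) })"
      by (simp add: recon_law_def K_def map_bind_pmf case_prod_unfold)
    also have "\<dots> = map_pmf (\<lambda>(t, (s, v)). (s, v, t)) J'" using \<kappa> sndJ' by simp
    also have "\<dots> = J" by (simp add: J'_def map_pmf_comp case_prod_unfold)
    finally have RJ: "recon_law Q K = J" .
    have "cond_mutual_info (recon_law Q K) (\<lambda>(t, v, t'). t) (\<lambda>(t, v, t'). t') (\<lambda>(t, v, t'). v) \<le> r"
      unfolding RJ cond_mutual_info_cmi[OF F JF] pJ by (rule cr)
    then have "cond_distortion_rate d r Q \<le> ereal (expec (recon_law Q K) (\<lambda>(t, v, t'). d t t'))"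
      unfolding cond_distortion_rate_def using r by (auto intro!: INF_lower)
    also have "expec (recon_law Q K) (\<lambda>(t, v, t'). d t t') = ?dist V"
      unfolding RJ by (subst integral_measure_pmf[OF F]) (use JF in \<open>auto simp: pJ case_prod_unfold\<close>)
    finally have "ereal DE \<le> ereal (?dist V)" using DE by (rule order_trans[rotated])
    then show False using V \<eta> by (simp add: X_def)
  qed
  obtain c where c: "c > 0" "\<And>V. V \<in> X \<Longrightarrow> c \<le> g V"
  proof (cases "X = {}")
    case True then show ?thesis using that[of 1] by auto
  next
    case False
    obtain V0 where "V0 \<in> X" "\<And>V. V \<in> X \<Longrightarrow> g V0 \<le> g V"
      using continuous_attains_inf[OF \<open>compact X\<close> False \<open>continuous_on X g\<close>] by auto
    then show ?thesis using that[of "g V0"] pos by auto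
  qed
  \<comment> \<open>One violation of size \<open>\<epsilon>\<close> for each marginal constraint and
    one for the rate: together \<open>k * \<epsilon> = c / 2\<close>, below the minimum of
    \<open>g\<close>.\<close>
  define k where "k = real (card SV) + 1"
  have k: "k > 0" by (simp add: k_def)
  define \<epsilon> where "\<epsilon> = (c / 2) / k"
  have \<epsilon>: "\<epsilon> > 0" using c k by (simp add: \<epsilon>_def)
  show thesis
  proof (rule that[OF \<epsilon>])
    fix V :: "'s \<times> 'v \<times> 's \<Rightarrow> real"
    assume V0: "\<And>w. w \<in> F \<Longrightarrow> 0 \<le> V w" and V1: "(\<Sum>w\<in>F. V w) = 1"
      and close: "\<And>x. x \<in> UNIV \<times> snd ` set_pmf Q \<Longrightarrow> \<bar>marg F ?sv V x - pmf Q x\<bar> \<le> \<epsilon>"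
      and cm: "cmi F V \<le> r + \<epsilon>"
    \<comment> \<open>\<open>V\<close> is arbitrary off \<open>F\<close>. Setting it to zero there
      moves it into the compact box and changes no sum over \<open>F\<close>.\<close>
    define V' where "V' w = (if w \<in> F then V w else 0)" for w
    have marg': "marg F f V' = marg F f V" for f :: "_ \<Rightarrow> 'z"
      unfolding marg_def by (intro ext sum.cong) (auto simp: V'_def)
    have cmi': "cmi F V' = cmi F V" by (simp add: cmi_def neg_ent_def marg')
    have dist': "?dist V' = ?dist V" by (intro sum.cong) (auto simp: V'_def)
    have tot': "(\<Sum>w\<in>F. V' w) = 1" using V1 by (simp add: V'_def)
    show "DE - \<eta> < ?dist V"
    proof (rule ccontr)
      assume "\<not> DE - \<eta> < ?dist V"
      moreover have "V w \<le> 1" if "w \<in> F" for w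
        using member_le_sum[of w F V] V0 V1 F that by auto
      ultimately have "V' \<in> X" unfolding X_def using V0 tot' dist' by (auto simp: V'_def)
      then have "c \<le> g V'" by (rule c(2))
      also have "g V' \<le> (\<Sum>x\<in>SV. \<epsilon>) + \<epsilon>"
        unfolding g_def marg' cmi' using close cm \<epsilon> by (intro add_mono sum_mono) (auto simp: SV_def)
      also have "\<dots> = k * \<epsilon>" by (simp add: k_def distrib_right)
      also have "\<dots> = c / 2" using k by (simp add: \<epsilon>_def)
      finally show False using c by simp
    qed
  qed
qed

section \<open>Empirical frequencies and counting of conditional types\<close>

definition freq :: "nat \<Rightarrow> (nat \<Rightarrow> 'a) \<Rightarrow> 'a \<Rightarrow> real" where
  "freq n w a = real (card {i\<in>{..<n}. w i = a}) / real n"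

lemma sum_freq:
  assumes F: "finite F" "w ` {..<n} \<subseteq> F"
  shows "(\<Sum>a\<in>F. freq n w a * g a) = (\<Sum>i<n. g (w i)) / real n"
proof -
  have "(\<Sum>i<n. g (w i)) = (\<Sum>a\<in>F. real (card {i\<in>{..<n}. w i = a}) * g a)"
    by (rule sum_fun_comp) (use F in auto)
  then show ?thesis by (simp add: freq_def sum_divide_distrib)
qed

lemma marg_freq:
  assumes F: "finite F" "w ` {..<n} \<subseteq> F"
  shows "marg F f (freq n w) x = freq n (\<lambda>i. f (w i)) x"
proof -
  have "marg F f (freq n w) x = (\<Sum>a\<in>F. freq n w a * (if f a = x then 1 else 0))"
    unfolding marg_def using F(1) by (intro sum.mono_neutral_cong_left) auto
  also have "\<dots> = (\<Sum>i<n. if f (w i) = x then 1 else 0) / real n" by (rule sum_freq[OF F])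
  also have "(\<Sum>i<n. if f (w i) = x then 1 else (0::real)) = real (card {i\<in>{..<n}. f (w i) = x})"
    by (subst sum.inter_filter[symmetric]) auto
  finally show ?thesis unfolding freq_def[of n "\<lambda>i. f (w i)"] .
qed

lemma neg_ent_freq:
  assumes F: "finite F" "w ` {..<n} \<subseteq> F"
  shows "neg_ent F f (freq n w) = (\<Sum>i<n. log 2 (freq n (\<lambda>i. f (w i)) (f (w i)))) / real n"
  unfolding neg_ent_def marg_freq[OF F] xlog_def
  by (rule sum_freq) (use F in auto)

lemma freq_nonneg: "0 \<le> freq n w a" by (simp add: freq_def)

lemma freq_pos: "i < n \<Longrightarrow> 0 < freq n w (w i)"
  by (auto simp: freq_def card_gt_0_iff intro!: divide_pos_pos)

text \<open>Maximum likelihood: no kernel makes \<open>s\<close> more probable than its own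
  empirical conditional law does. The ratios of the two have average at most one, and x is at most
  exp (x - 1), so the product of the ratios is at most one.\<close>

lemma prod_le_prod_freq:
  fixes \<kappa> :: "'v \<Rightarrow> 's pmf"
  shows "(\<Prod>i<n. pmf (\<kappa> (v i)) (s i)) \<le> (\<Prod>i<n. freq n (\<lambda>i. (s i, v i)) (s i, v i) / freq n v (v i))"
proof (cases "\<exists>i<n. pmf (\<kappa> (v i)) (s i) = 0")
  case True
  then have zero: "(\<Prod>i<n. pmf (\<kappa> (v i)) (s i)) = 0" by (auto intro!: prod_zero)
  show ?thesis unfolding zero by (intro prod_nonneg) (simp add: freq_nonneg)
next
  case False
  define \<rho> where "\<rho> i = freq n (\<lambda>i. (s i, v i)) (s i, v i) / freq n v (v i)" for i
  have k: "pmf (\<kappa> (v i)) (s i) > 0" if "i < n" for i using False that by (simp add: pmf_pos)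
  have fpos: "freq n (\<lambda>i. (s i, v i)) (s i, v i) > 0" "freq n v (v i) > 0" if "i < n" for i
    using freq_pos[OF that, of "\<lambda>i. (s i, v i)"] freq_pos[OF that, of v] by auto
  then have \<rho>: "\<rho> i > 0" if "i < n" for i using that by (simp add: \<rho>_def)
  define FS where "FS = (\<lambda>i. (s i, v i)) ` {..<n}"
  have FS: "finite FS" by (simp add: FS_def)
  have "(\<Sum>i<n. pmf (\<kappa> (v i)) (s i) / \<rho> i) / real n
     = (\<Sum>(a, b)\<in>FS. freq n (\<lambda>i. (s i, v i)) (a, b) * (pmf (\<kappa> b) a / (freq n (\<lambda>i. (s i, v i)) (a, b) / freq n v b)))"
    using sum_freq[OF FS, of "\<lambda>i. (s i, v i)" n "\<lambda>(a, b). pmf (\<kappa> b) a / (freq n (\<lambda>i. (s i, v i)) (a, b) / freq n v b)"]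
    by (simp add: FS_def \<rho>_def case_prod_unfold)
  also have "\<dots> = (\<Sum>(a, b)\<in>FS. freq n v b * pmf (\<kappa> b) a)"
    using fpos by (intro sum.cong) (force simp: FS_def)+
  also have "\<dots> \<le> (\<Sum>(a, b)\<in>s ` {..<n} \<times> v ` {..<n}. freq n v b * pmf (\<kappa> b) a)"
    by (intro sum_mono2) (auto simp: FS_def freq_nonneg)
  also have "\<dots> = (\<Sum>b\<in>v ` {..<n}. freq n v b * (\<Sum>a\<in>s ` {..<n}. pmf (\<kappa> b) a))"
    by (subst sum.cartesian_product[symmetric], subst sum.swap) (simp add: sum_distrib_left)
  also have "\<dots> \<le> (\<Sum>b\<in>v ` {..<n}. freq n v b * 1)"
  proof (intro sum_mono mult_left_mono freq_nonneg)
    fix b show "(\<Sum>a\<in>s ` {..<n}. pmf (\<kappa> b) a) \<le> 1"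
      by (simp add: measure_measure_pmf_finite[symmetric])
  qed
  also have "\<dots> = (\<Sum>i<n. 1) / real n"
    by (rule sum_freq) auto
  finally have "(\<Sum>i<n. pmf (\<kappa> (v i)) (s i) / \<rho> i) / real n \<le> real n / real n" by simp
  then have le: "(\<Sum>i<n. pmf (\<kappa> (v i)) (s i) / \<rho> i) \<le> real n"
    by (cases "n = 0") (auto simp: divide_le_eq)
  have "(\<Prod>i<n. pmf (\<kappa> (v i)) (s i)) = (\<Prod>i<n. \<rho> i * (pmf (\<kappa> (v i)) (s i) / \<rho> i))"
    using \<rho> by (intro prod.cong) (auto simp: less_imp_neq[THEN not_sym])
  also have "\<dots> = (\<Prod>i<n. \<rho> i) * (\<Prod>i<n. pmf (\<kappa> (v i)) (s i) / \<rho> i)" by (rule prod.distrib)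
  also have "\<dots> \<le> (\<Prod>i<n. \<rho> i) * (\<Prod>i<n. exp (pmf (\<kappa> (v i)) (s i) / \<rho> i - 1))"
    using \<rho> k exp_ge_add_one_self[of "pmf (\<kappa> (v _)) (s _) / \<rho> _ - 1"]
    by (intro mult_left_mono prod_mono prod_nonneg) (auto simp: less_imp_le)
  also have "\<dots> = (\<Prod>i<n. \<rho> i) * exp ((\<Sum>i<n. pmf (\<kappa> (v i)) (s i) / \<rho> i) - real n)"
    by (simp add: exp_sum[symmetric] sum_subtractf)
  also have "\<dots> \<le> (\<Prod>i<n. \<rho> i) * 1"
    using le \<rho> by (intro mult_left_mono prod_nonneg) (auto simp: less_imp_le)
  finally show ?thesis by (simp add: \<rho>_def)
qed

text \<open>An empirical chain rule. Letter by letter, the conditional frequencies of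
  \<open>s\<close> given \<open>v\<close> and given \<open>(v, t)\<close> differ by a factor whose
  binary logarithm has mean \<open>- cmi F (freq n w)\<close>.\<close>

lemma prod_freq_cmi:
  fixes s :: "nat \<Rightarrow> 's" and v :: "nat \<Rightarrow> 'v" and t :: "nat \<Rightarrow> 't"
  defines "w \<equiv> \<lambda>i. (s i, v i, t i)"
  assumes F: "finite F" "w ` {..<n} \<subseteq> F"
  shows "(\<Prod>i<n. freq n (\<lambda>i. (s i, v i)) (s i, v i) / freq n v (v i))
    = 2 powr (- real n * cmi F (freq n w)) * (\<Prod>i<n. freq n w (w i) / freq n (\<lambda>i. (v i, t i)) (v i, t i))"
proof (cases "n = 0")
  case False
  define a where "a i = freq n w (w i)" for i
  define b where "b i = freq n v (v i)" for i
  define c where "c i = freq n (\<lambda>i. (s i, v i)) (s i, v i)" for i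
  define e where "e i = freq n (\<lambda>i. (v i, t i)) (v i, t i)" for i
  have pos: "a i > 0" "b i > 0" "c i > 0" "e i > 0" if "i < n" for i
    unfolding a_def b_def c_def e_def
    using that freq_pos[OF that, of w] freq_pos[OF that, of v] freq_pos[OF that, of "\<lambda>i. (s i, v i)"]
      freq_pos[OF that, of "\<lambda>i. (v i, t i)"] by auto
  define l where "l i = log 2 (a i) + log 2 (b i) - log 2 (c i) - log 2 (e i)" for i
  have "cmi F (freq n w) = (\<Sum>i<n. l i) / real n"
    unfolding cmi_def neg_ent_freq[OF F]
    by (simp add: w_def l_def a_def b_def c_def e_def sum.distrib sum_subtractf add_divide_distrib diff_divide_distrib)
  then have "- real n * cmi F (freq n w) = (\<Sum>i<n. - l i)"
    using False by (simp add: sum_negf)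
  then have "2 powr (- real n * cmi F (freq n w)) = (\<Prod>i<n. 2 powr (- l i))"
    by (simp add: powr_sum)
  also have "\<dots> = (\<Prod>i<n. c i * e i / (a i * b i))"
  proof (rule prod.cong[OF refl])
    fix i assume "i \<in> {..<n}"
    then have p: "a i > 0" "b i > 0" "c i > 0" "e i > 0" using pos by auto
    have "2 powr (- l i) = 2 powr (log 2 (c i * e i / (a i * b i)))"
      using p by (simp add: l_def log_mult log_divide algebra_simps)
    then show "2 powr (- l i) = c i * e i / (a i * b i)"
      using p by simp
  qed
  finally have "2 powr (- real n * cmi F (freq n w)) * (\<Prod>i<n. a i / e i)
     = (\<Prod>i<n. c i * e i / (a i * b i) * (a i / e i))" by (simp only: prod.distrib)
  also have "\<dots> = (\<Prod>i<n. c i / b i)" by (rule prod.cong) (use pos in \<open>force simp: field_simps\<close>)+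
  finally show ?thesis by (simp add: a_def b_def c_def e_def)
qed simp

text \<open>The kernel is first replaced by the empirical law given \<open>v\<close>, then by the
  one given \<open>(v, t)\<close>, which gains \<open>2 powr (- real n * c)\<close>. The latter is
  common to the whole class, so the remaining sum is part of the total mass of one product
  law.\<close>

lemma type_class_prob_le:
  fixes v :: "nat \<Rightarrow> 'v" and t :: "nat \<Rightarrow> 't" and \<kappa> :: "'v \<Rightarrow> 's::finite pmf"
  assumes F: "finite F" "UNIV \<times> v ` {..<n} \<times> t ` {..<n} \<subseteq> F"
    and B: "B \<subseteq> seqs n" and type: "\<And>s. s \<in> B \<Longrightarrow> freq n (\<lambda>i. (s i, v i, t i)) = \<tau>" and c: "c \<le> cmi F \<tau>"
  shows "(\<Sum>s\<in>B. \<Prod>i<n. pmf (\<kappa> (v i)) (s i)) \<le> 2 powr (- real n * c)"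
proof (cases "B = {}")
  case False
  then obtain s0 where s0: "s0 \<in> B" by auto
  define q where "q i a = \<tau> (a, v i, t i) / freq n (\<lambda>i. (v i, t i)) (v i, t i)" for i a
  have wF: "(\<lambda>i. (s i, v i, t i)) ` {..<n} \<subseteq> F" for s :: "nat \<Rightarrow> 's" using F(2) by auto
  have \<tau>0: "\<tau> x \<ge> 0" for x using type[OF s0] freq_nonneg by metis
  have q0: "q i a \<ge> 0" for i a by (simp add: q_def \<tau>0 freq_nonneg)
  have q1: "(\<Sum>a\<in>UNIV. q i a) = 1" if "i < n" for i
  proof -
    have "marg F (\<lambda>(s, v, t). (v, t)) \<tau> (v i, t i) = (\<Sum>a\<in>UNIV. \<tau> (a, v i, t i))"
      unfolding marg_def
    proof (rule sum.reindex_bij_witness[where i="\<lambda>a. (a, v i, t i)" and j=fst])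
      show "\<And>a. a \<in> UNIV \<Longrightarrow> (a, v i, t i) \<in> {w \<in> F. (case w of (s, v, t) \<Rightarrow> (v, t)) = (v i, t i)}"
        using F(2) that by auto
    qed auto
    moreover have "marg F (\<lambda>(s, v, t). (v, t)) \<tau> (v i, t i) = freq n (\<lambda>i. (v i, t i)) (v i, t i)"
      using marg_freq[OF F(1) wF[of s0], of "\<lambda>(s, v, t). (v, t)"] type[OF s0] by simp
    ultimately show ?thesis
      using freq_pos[OF that, of "\<lambda>i. (v i, t i)"] by (simp add: q_def sum_divide_distrib[symmetric])
  qed
  have "(\<Sum>s\<in>B. \<Prod>i<n. pmf (\<kappa> (v i)) (s i)) \<le> (\<Sum>s\<in>B. 2 powr (- real n * c) * (\<Prod>i<n. q i (s i)))"
  proof (rule sum_mono)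
    fix s assume s: "s \<in> B"
    have "(\<Prod>i<n. pmf (\<kappa> (v i)) (s i)) \<le> (\<Prod>i<n. freq n (\<lambda>i. (s i, v i)) (s i, v i) / freq n v (v i))"
      by (rule prod_le_prod_freq)
    also have "\<dots> = 2 powr (- real n * cmi F \<tau>) * (\<Prod>i<n. q i (s i))"
      unfolding prod_freq_cmi[OF F(1) wF] type[OF s] q_def ..
    also have "\<dots> \<le> 2 powr (- real n * c) * (\<Prod>i<n. q i (s i))"
      using c by (intro mult_right_mono prod_nonneg) (auto simp: q0 mult_left_mono)
    finally show "(\<Prod>i<n. pmf (\<kappa> (v i)) (s i)) \<le> 2 powr (- real n * c) * (\<Prod>i<n. q i (s i))" .
  qed
  also have "\<dots> = 2 powr (- real n * c) * (\<Sum>s\<in>B. \<Prod>i<n. q i (s i))" by (simp add: sum_distrib_left)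
  also have "(\<Sum>s\<in>B. \<Prod>i<n. q i (s i)) \<le> (\<Sum>s\<in>seqs n. \<Prod>i<n. q i (s i))"
    using B by (intro sum_mono2) (auto simp: seqs_def q0 intro!: prod_nonneg finite_PiE)
  also have "\<dots> = (\<Prod>i<n. \<Sum>a\<in>UNIV. q i a)" unfolding seqs_def by (rule prod_sum_PiE[symmetric]) auto
  also have "\<dots> = 1" by (rule prod.neutral) (use q1 in auto)
  finally show ?thesis by simp
qed simp

lemma finite_seqs: "finite (seqs n :: (nat \<Rightarrow> 'a::finite) set)"
  unfolding seqs_def by (intro finite_PiE) auto

text \<open>A type on \<open>F\<close> is a vector of \<open>card F\<close> counts in
  \<open>{..n}\<close>, so there are only polynomially many classes to add up.\<close>

lemma types_prob_le:
  fixes v :: "nat \<Rightarrow> 'v" and t :: "nat \<Rightarrow> 't" and \<kappa> :: "'v \<Rightarrow> 's::finite pmf"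
  assumes F: "finite F" "UNIV \<times> v ` {..<n} \<times> t ` {..<n} \<subseteq> F"
    and B: "B \<subseteq> seqs n" and c: "\<And>s. s \<in> B \<Longrightarrow> c \<le> cmi F (freq n (\<lambda>i. (s i, v i, t i)))"
  shows "(\<Sum>s\<in>B. \<Prod>i<n. pmf (\<kappa> (v i)) (s i)) \<le> (real n + 1) ^ card F * 2 powr (- real n * c)"
proof -
  define fr where "fr s = freq n (\<lambda>i. (s i, v i, t i))" for s :: "nat \<Rightarrow> 's"
  have finB: "finite B" using finite_subset[OF B finite_seqs] .
  have "(\<Sum>s\<in>B. \<Prod>i<n. pmf (\<kappa> (v i)) (s i)) = (\<Sum>\<tau>\<in>fr ` B. \<Sum>s\<in>{s\<in>B. fr s = \<tau>}. \<Prod>i<n. pmf (\<kappa> (v i)) (s i))"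
    by (rule sum.image_gen[OF finB])
  also have "\<dots> \<le> (\<Sum>\<tau>\<in>fr ` B. 2 powr (- real n * c))"
    by (intro sum_mono type_class_prob_le[OF F]) (use B c in \<open>auto simp: fr_def\<close>)
  also have "\<dots> = real (card (fr ` B)) * 2 powr (- real n * c)" by simp
  also have "real (card (fr ` B)) \<le> (real n + 1) ^ card F"
  proof -
    let ?H = "\<lambda>h x. if x \<in> F then real (h x) / real n else 0"
    have "fr ` B \<subseteq> ?H ` (PiE F (\<lambda>_. {..n}))"
    proof
      fix \<tau> assume "\<tau> \<in> fr ` B"
      then obtain s where s: "\<tau> = fr s" by auto
      define h where "h = (\<lambda>x\<in>F. card {i\<in>{..<n}. (s i, v i, t i) = x})"
      have "h \<in> PiE F (\<lambda>_. {..n})"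
      proof (rule PiE_I)
        fix x assume "x \<in> F"
        have "card {i\<in>{..<n}. (s i, v i, t i) = x} \<le> card {..<n}" by (rule card_mono) auto
        then show "h x \<in> {..n}" using \<open>x \<in> F\<close> by (simp add: h_def)
      qed (simp add: h_def)
      moreover have "\<tau> = ?H h"
      proof
        fix x
        show "\<tau> x = ?H h x"
        proof (cases "x \<in> F")
          case False
          then have "{i\<in>{..<n}. (s i, v i, t i) = x} = {}" using F(2) by auto
          then show ?thesis using False by (simp add: s fr_def freq_def)
        qed (simp add: s fr_def freq_def h_def)
      qed
      ultimately show "\<tau> \<in> ?H ` (PiE F (\<lambda>_. {..n}))" by blast
    qed
    then have "card (fr ` B) \<le> card (PiE F (\<lambda>_. {..n}))"
      using F(1) by (intro surj_card_le finite_PiE) auto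
    also have "\<dots> = (n + 1) ^ card F" using F(1) by (simp add: card_PiE)
    finally have "real (card (fr ` B)) \<le> real ((n + 1) ^ card F)" by (rule of_nat_mono)
    then show ?thesis by (simp add: add.commute)
  qed
  finally show ?thesis by (simp add: mult_right_mono)
qed

section \<open>Single-letter laws and their products\<close>

lemma weak_law:
  fixes \<phi> :: "'w \<Rightarrow> real"
  assumes Q: "finite (set_pmf Q)" and \<delta>: "\<delta> > 0" and n: "n > 0"
  shows "prb (iid n Q) {w. \<bar>(\<Sum>i<n. \<phi> (w i)) / real n - expec Q \<phi>\<bar> > \<delta>}
    \<le> expec Q (\<lambda>w. (\<phi> w - expec Q \<phi>)\<^sup>2) / (real n * \<delta>\<^sup>2)"
proof -
  define m where "m = expec Q \<phi>"
  define h where "h w = \<phi> w - m" for w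
  have fin: "finite (set_pmf (iid n Q))" unfolding iid_def by (rule finite_set_Pi_pmf) (use Q in auto)
  note int = integrable_measure_pmf_finite[OF fin] integrable_measure_pmf_finite[OF Q]
  have h0: "expec Q h = 0" by (simp add: h_def[abs_def] m_def int)
  have avg: "(\<Sum>i<n. \<phi> (w i)) / real n - m = (\<Sum>i<n. h (w i)) / real n" for w
    using n by (simp add: h_def sum_subtractf field_simps)
  have "prb (iid n Q) {w. \<bar>(\<Sum>i<n. \<phi> (w i)) / real n - m\<bar> > \<delta>}
      = expec (iid n Q) (indicator {w. \<bar>(\<Sum>i<n. \<phi> (w i)) / real n - m\<bar> > \<delta>})" by simp
  also have "\<dots> \<le> expec (iid n Q) (\<lambda>w. (\<Sum>i<n. h (w i))\<^sup>2 / (real n * \<delta>)\<^sup>2)"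
  proof (intro integral_mono int)
    fix w
    show "indicator {w. \<bar>(\<Sum>i<n. \<phi> (w i)) / real n - m\<bar> > \<delta>} w \<le> (\<Sum>i<n. h (w i))\<^sup>2 / (real n * \<delta>)\<^sup>2"
    proof (cases "\<bar>(\<Sum>i<n. \<phi> (w i)) / real n - m\<bar> > \<delta>")
      case True
      then have "real n * \<delta> \<le> \<bar>\<Sum>i<n. h (w i)\<bar>" using n unfolding avg by (simp add: field_simps)
      then have "(real n * \<delta>)\<^sup>2 \<le> (\<Sum>i<n. h (w i))\<^sup>2" using \<delta> by (intro abs_le_square_iff[THEN iffD1]) (simp add: abs_mult)
      moreover have "(real n * \<delta>)\<^sup>2 > 0" using n \<delta> by simp
      ultimately have "1 \<le> (\<Sum>i<n. h (w i))\<^sup>2 / (real n * \<delta>)\<^sup>2" by (simp only: le_divide_eq_1_pos)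
      then show ?thesis using True by simp
    qed auto
  qed
  also have "\<dots> = real n * expec Q (\<lambda>w. (h w)\<^sup>2) / (real n * \<delta>)\<^sup>2"
    using expectation_square_sum_iid[OF finite_lessThan[of n] Q h0, of undefined]
    by (simp add: iid_def)
  also have "\<dots> = expec Q (\<lambda>w. (h w)\<^sup>2) / (real n * \<delta>\<^sup>2)"
    using n by (simp add: power2_eq_square)
  finally show ?thesis by (simp add: m_def h_def)
qed

lemma eventually_weak_law:
  fixes \<Phi> :: "('a \<Rightarrow> real) set"
  assumes Q: "finite (set_pmf Q)" and \<Phi>: "finite \<Phi>" and \<delta>: "\<delta> > 0" and \<epsilon>: "\<epsilon> > 0"
  shows "\<forall>\<^sub>F n in sequentially. prb (iid n Q)
    {w. \<exists>\<phi>\<in>\<Phi>. \<bar>(\<Sum>i<n. \<phi> (w i)) / real n - expec Q \<phi>\<bar> > \<delta>} \<le> \<epsilon>"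
proof -
  define v where "v \<phi> = expec Q (\<lambda>w. (\<phi> w - expec Q \<phi>)\<^sup>2)" for \<phi> :: "'a \<Rightarrow> real"
  have "((\<lambda>n. (\<Sum>\<phi>\<in>\<Phi>. v \<phi>) / \<delta>\<^sup>2 * inverse (real n)) \<longlongrightarrow> (\<Sum>\<phi>\<in>\<Phi>. v \<phi>) / \<delta>\<^sup>2 * 0) sequentially"
    by (intro tendsto_mult tendsto_const LIMSEQ_inverse_real_of_nat tendsto_inverse_0_at_top filterlim_real_sequentially)
  then have "\<forall>\<^sub>F n in sequentially. (\<Sum>\<phi>\<in>\<Phi>. v \<phi>) / \<delta>\<^sup>2 * inverse (real n) < \<epsilon>"
    by (rule order_tendstoD) (use \<epsilon> in simp)
  then show ?thesis
    using eventually_gt_at_top[of 0]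
  proof eventually_elim
    case (elim n)
    have "prb (iid n Q) {w. \<exists>\<phi>\<in>\<Phi>. \<bar>(\<Sum>i<n. \<phi> (w i)) / real n - expec Q \<phi>\<bar> > \<delta>}
       \<le> (\<Sum>\<phi>\<in>\<Phi>. prb (iid n Q) {w. \<bar>(\<Sum>i<n. \<phi> (w i)) / real n - expec Q \<phi>\<bar> > \<delta>})"
      by (rule prob_le_sum_cover) (use \<Phi> in auto)
    also have "\<dots> \<le> (\<Sum>\<phi>\<in>\<Phi>. v \<phi> / (real n * \<delta>\<^sup>2))"
      unfolding v_def by (intro sum_mono weak_law Q \<delta>) (use elim in simp)
    also have "\<dots> = (\<Sum>\<phi>\<in>\<Phi>. v \<phi>) / \<delta>\<^sup>2 * inverse (real n)"
      by (simp add: sum_divide_distrib[symmetric] field_simps)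
    finally show ?case using elim by simp
  qed
qed

section \<open>Product laws on sequences and the single-letter channel\<close>

abbreviation prod_pmf :: "nat \<Rightarrow> (nat \<Rightarrow> 'a pmf) \<Rightarrow> (nat \<Rightarrow> 'a) pmf" where
  "prod_pmf n \<equiv> Pi_pmf {..<n} undefined"

lemma set_prod_pmf: "set_pmf (prod_pmf n p) = PiE {..<n} (\<lambda>i. set_pmf (p i))"
  by (auto simp: set_Pi_pmf PiE_dflt_def PiE_def Pi_def extensional_def)

lemma set_prod_pmf_seqs: "set_pmf (prod_pmf n p) \<subseteq> seqs n"
  by (auto simp: set_prod_pmf seqs_def)

lemma restrict_prod_pmf: "f \<in> set_pmf (prod_pmf n p) \<Longrightarrow> restrict f {..<n} = f"
  by (auto simp: set_prod_pmf)

lemma prod_pmf_bind: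
  "prod_pmf n (\<lambda>i. bind_pmf (p i) (k i)) = do { f \<leftarrow> prod_pmf n p; prod_pmf n (\<lambda>i. k i (f i)) }"
  by (rule Pi_pmf_bind) simp

lemma prod_pmf_return: "prod_pmf n (\<lambda>i. return_pmf (f i)) = return_pmf (\<lambda>i\<in>{..<n}. f i)"
  by (simp add: restrict_def)

lemma prod_pmf_map: "prod_pmf n (\<lambda>i. map_pmf g (p i)) = map_pmf (\<lambda>f. \<lambda>i\<in>{..<n}. g (f i)) (prod_pmf n p)"
  by (simp add: map_pmf_def prod_pmf_bind prod_pmf_return)

lemma prod_pmf_cong: "(\<And>i. i < n \<Longrightarrow> p i = p' i) \<Longrightarrow> prod_pmf n p = prod_pmf n p'"
  by (rule Pi_pmf_cong) auto

lemma pmf_prod_pmf: "f \<in> seqs n \<Longrightarrow> pmf (prod_pmf n p) f = (\<Prod>i<n. pmf (p i) (f i))"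
  by (subst pmf_Pi') (auto simp: seqs_def PiE_def extensional_def)

text \<open>In names, \<open>T\<close> and \<open>t\<close> stand for the reconstruction of the state.\<close>

locale single_letter =
  fixes P :: "('e::finite \<times> 's::finite) pmf"
    and W :: "'x::finite \<Rightarrow> 's \<Rightarrow> ('y::finite \<times> 'z::finite) pmf"
    and PU :: "'e \<Rightarrow> nat pmf" and PX :: "nat \<Rightarrow> 'e \<Rightarrow> 'x pmf"
    and PT :: "'x \<Rightarrow> 'e \<Rightarrow> 'z \<Rightarrow> 's pmf"
  assumes finU: "finite (\<Union>e. set_pmf (PU e))"
begin

definition Pe where "Pe = map_pmf fst P"
definition PS :: "'e \<Rightarrow> 's pmf" where
  "PS = (SOME \<kappa>. P = do { e \<leftarrow> Pe; s \<leftarrow> \<kappa> e; return_pmf (e, s) })"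
definition q where "q = bind_pmf Pe PU"
text \<open>The reverse channel from the auxiliary letter to the side information. The ideal law
  starts from the codeword and needs the law of \<open>e\<close> in this direction.\<close>

definition PE :: "nat \<Rightarrow> 'e pmf" where
  "PE = (SOME \<kappa>. do { e \<leftarrow> Pe; u \<leftarrow> PU e; return_pmf (e, u) } = do { u \<leftarrow> q; e \<leftarrow> \<kappa> u; return_pmf (e, u) })"
definition out1 :: "nat \<Rightarrow> ('e \<times> 's \<times> 'x \<times> 'y \<times> 'z \<times> 's) pmf" where
  "out1 u = do { e \<leftarrow> PE u; s \<leftarrow> PS e; x \<leftarrow> PX u e; (y, z) \<leftarrow> W x s; t \<leftarrow> PT x e z; return_pmf (e, s, x, y, z, t) }"
definition Q where
  "Q = do { (e, s) \<leftarrow> P; u \<leftarrow> PU e; x \<leftarrow> PX u e; (y, z) \<leftarrow> W x s; t \<leftarrow> PT x e z; return_pmf (e, s, u, x, y, z, t) }"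

definition VY1 where "VY1 u = map_pmf (\<lambda>(e, s, x, y, z, t). y) (out1 u)"
definition VT1 where "VT1 u = map_pmf (\<lambda>(e, s, x, y, z, t). t) (out1 u)"
definition VYT1 where "VYT1 u = map_pmf (\<lambda>(e, s, x, y, z, t). (y, t)) (out1 u)"

lemma PS: "P = do { e \<leftarrow> Pe; s \<leftarrow> PS e; return_pmf (e, s) }"
  using someI_ex[OF disintegration_pmf_fst[of P]] unfolding PS_def Pe_def .

lemma PE: "do { e \<leftarrow> Pe; u \<leftarrow> PU e; return_pmf (e, u) } = do { u \<leftarrow> q; e \<leftarrow> PE u; return_pmf (e, u) }"
proof -
  define J where "J = do { e \<leftarrow> Pe; u \<leftarrow> PU e; return_pmf (e, u) }"
  obtain \<kappa> where \<kappa>: "J = do { b \<leftarrow> map_pmf snd J; a \<leftarrow> \<kappa> b; return_pmf (a, b) }"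
    using disintegration_pmf[of J] by (elim exE conjE)
  have "map_pmf snd J = q" by (simp add: J_def q_def map_bind_pmf bind_return_pmf')
  then have "\<exists>\<kappa>. J = do { u \<leftarrow> q; e \<leftarrow> \<kappa> u; return_pmf (e, u) }" using \<kappa> by (intro exI[of _ \<kappa>]) simp
  from someI_ex[OF this] show ?thesis unfolding PE_def J_def .
qed

lemma bind_q_PE: "bind_pmf q PE = Pe"
proof -
  have "bind_pmf q PE = map_pmf fst (do { u \<leftarrow> q; e \<leftarrow> PE u; return_pmf (e, u) })"
    by (simp add: map_bind_pmf bind_return_pmf')
  also have "\<dots> = Pe" unfolding PE[symmetric] by (simp add: map_bind_pmf map_pmf_def bind_assoc_pmf bind_return_pmf bind_return_pmf')
  finally show ?thesis .
qed

text \<open>The state depends on \<open>u\<close> only through \<open>e\<close>, so drawing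
  \<open>s\<close> commutes with drawing \<open>u\<close>; then the pair of \<open>e\<close> and
  \<open>u\<close> can be generated with \<open>u\<close> first.\<close>

lemma Q_out1: "Q = do { u \<leftarrow> q; (e, s, x, y, z, t) \<leftarrow> out1 u; return_pmf (e, s, u, x, y, z, t) }"
proof -
  define K where "K = (\<lambda>(e, u). do { s \<leftarrow> PS e; x \<leftarrow> PX u e; (y, z) \<leftarrow> W x s; t \<leftarrow> PT x e z; return_pmf (e, s, u, x, y, z, t) })"
  have "Q = do { e \<leftarrow> Pe; s \<leftarrow> PS e; u \<leftarrow> PU e; x \<leftarrow> PX u e; (y, z) \<leftarrow> W x s; t \<leftarrow> PT x e z; return_pmf (e, s, u, x, y, z, t) }"
    unfolding Q_def by (subst PS) (simp add: bind_assoc_pmf bind_return_pmf)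
  also have "\<dots> = do { e \<leftarrow> Pe; u \<leftarrow> PU e; K (e, u) }"
    unfolding K_def by (subst bind_commute_pmf) simp
  also have "\<dots> = bind_pmf (do { e \<leftarrow> Pe; u \<leftarrow> PU e; return_pmf (e, u) }) K"
    by (simp add: bind_assoc_pmf bind_return_pmf)
  also have "\<dots> = do { u \<leftarrow> q; e \<leftarrow> PE u; K (e, u) }" unfolding PE by (simp add: bind_assoc_pmf bind_return_pmf)
  also have "\<dots> = do { u \<leftarrow> q; (e, s, x, y, z, t) \<leftarrow> out1 u; return_pmf (e, s, u, x, y, z, t) }"
    by (simp add: out1_def K_def bind_assoc_pmf bind_return_pmf case_prod_unfold)
  finally show ?thesis .
qed

lemma finite_q: "finite (set_pmf q)"
  by (rule finite_subset[OF _ finU]) (auto simp: q_def)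

lemma finite_Q: "finite (set_pmf Q)"
  unfolding Q_out1 using finite_q by (auto simp: case_prod_unfold)

end

section \<open>Information density and change of measure\<close>

definition idens :: "('u \<Rightarrow> 'v pmf) \<Rightarrow> 'v pmf \<Rightarrow> 'u \<Rightarrow> 'v \<Rightarrow> real" where
  "idens V p u v = log 2 (pmf (V u) v / pmf p v)"

lemma mutual_info_idens:
  fixes U :: "'w \<Rightarrow> 'u::countable" and A :: "'w \<Rightarrow> 'v::countable"
  assumes fin: "finite (set_pmf Q)"
    and joint: "map_pmf (\<lambda>w. (U w, A w)) Q = do { u \<leftarrow> q; v \<leftarrow> V u; return_pmf (u, v) }"
  shows "mutual_info Q U A = expec Q (\<lambda>w. idens V (bind_pmf q V) (U w) (A w))"
proof -
  have q: "map_pmf U Q = q"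
  proof -
    have "map_pmf U Q = map_pmf fst (map_pmf (\<lambda>w. (U w, A w)) Q)" by (simp add: map_pmf_comp)
    also have "\<dots> = q" unfolding joint
      by (simp add: map_pmf_def bind_assoc_pmf bind_return_pmf bind_return_pmf')
    finally show ?thesis .
  qed
  have p: "map_pmf A Q = bind_pmf q V"
  proof -
    have "map_pmf A Q = map_pmf snd (map_pmf (\<lambda>w. (U w, A w)) Q)" by (simp add: map_pmf_comp)
    also have "\<dots> = bind_pmf q V" unfolding joint by (simp add: map_bind_pmf bind_return_pmf')
    finally show ?thesis .
  qed
  have fq: "finite (set_pmf q)" unfolding q[symmetric] using fin by simp
  have pj: "pmf (map_pmf (\<lambda>w. (U w, A w)) Q) (u, v) = pmf q u * pmf (V u) v" for u v
    unfolding joint by (rule pmf_bind_Pair)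
  show ?thesis unfolding mutual_info_eq[OF fin] pj q p idens_def
  proof (intro integral_cong_AE)
    show "AE w in measure_pmf Q. log 2 (pmf q (U w) * pmf (V (U w)) (A w) / (pmf q (U w) * pmf (bind_pmf q V) (A w)))
       = log 2 (pmf (V (U w)) (A w) / pmf (bind_pmf q V) (A w))"
      unfolding AE_measure_pmf_iff
    proof
      fix w assume "w \<in> set_pmf Q"
      then have "U w \<in> set_pmf q" unfolding q[symmetric] by simp
      then have "pmf q (U w) \<noteq> 0" by (simp add: set_pmf_iff)
      then show "log 2 (pmf q (U w) * pmf (V (U w)) (A w) / (pmf q (U w) * pmf (bind_pmf q V) (A w)))
       = log 2 (pmf (V (U w)) (A w) / pmf (bind_pmf q V) (A w))" by simp
    qed
  qed auto
qed

lemma pmf_bind_pos: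
  "u \<in> set_pmf q \<Longrightarrow> pmf (V u) v \<noteq> 0 \<Longrightarrow> pmf (bind_pmf q V) v > 0"
  by (rule pmf_positive) (auto simp: set_pmf_iff[of v])

text \<open>Positivity of every letter matters: \<open>log 2 0\<close> is \<open>0\<close>, so at an
  impossible letter the density would contribute a factor one instead of zero.\<close>

lemma prod_pmf_idens:
  assumes v: "v \<in> seqs n" and u: "\<And>i. i < n \<Longrightarrow> u i \<in> set_pmf q" and pos: "\<And>i. i < n \<Longrightarrow> pmf (V (u i)) (v i) \<noteq> 0"
  shows "pmf (prod_pmf n (\<lambda>i. V (u i))) v
     = 2 powr (\<Sum>i<n. idens V (bind_pmf q V) (u i) (v i)) * pmf (iid n (bind_pmf q V)) v"
proof -
  have "(\<Prod>i<n. pmf (V (u i)) (v i)) = (\<Prod>i<n. 2 powr idens V (bind_pmf q V) (u i) (v i) * pmf (bind_pmf q V) (v i))"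
  proof (rule prod.cong[OF refl])
    fix i assume "i \<in> {..<n}"
    then have "pmf (V (u i)) (v i) > 0" "pmf (bind_pmf q V) (v i) > 0"
      using pos[of i] pmf_bind_pos[of "u i" q V "v i"] u[of i] by (auto simp: pmf_pos)
    then show "pmf (V (u i)) (v i) = 2 powr idens V (bind_pmf q V) (u i) (v i) * pmf (bind_pmf q V) (v i)"
      by (simp add: idens_def)
  qed
  then show ?thesis by (simp add: pmf_prod_pmf[OF v] iid_def powr_sum prod.distrib)
qed

lemma prod_pmf_idens_le:
  assumes v: "v \<in> seqs n" and u: "\<And>i. i < n \<Longrightarrow> u i \<in> set_pmf q"
    and le: "(\<Sum>i<n. idens V (bind_pmf q V) (u i) (v i)) \<le> \<beta>"
  shows "pmf (prod_pmf n (\<lambda>i. V (u i))) v \<le> 2 powr \<beta> * pmf (iid n (bind_pmf q V)) v"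
proof (cases "\<exists>i<n. pmf (V (u i)) (v i) = 0")
  case True
  then have "pmf (prod_pmf n (\<lambda>i. V (u i))) v = 0" unfolding pmf_prod_pmf[OF v] by (auto intro: prod_zero)
  then show ?thesis by simp
next
  case False
  then show ?thesis using le by (subst prod_pmf_idens[OF v u]) (auto intro!: mult_right_mono)
qed

lemma seqs_eqI: "f \<in> seqs n \<Longrightarrow> g \<in> seqs n \<Longrightarrow> (\<And>i. i < n \<Longrightarrow> f i = g i) \<Longrightarrow> f = g"
  unfolding seqs_def by (rule PiE_ext) auto

section \<open>The random code at blocklength n\<close>

locale n_letter = single_letter P W PU PX PT
  for P :: "('e::finite \<times> 's::finite) pmf"
    and W :: "'x::finite \<Rightarrow> 's \<Rightarrow> ('y::finite \<times> 'z::finite) pmf"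
    and PU PX and PT :: "'x \<Rightarrow> 'e \<Rightarrow> 'z \<Rightarrow> 's pmf" +
  fixes n :: nat and M G L :: "nat set"
  assumes MGL: "finite M" "M \<noteq> {}" "finite G" "G \<noteq> {}" "finite L" "L \<noteq> {}"
begin

definition PEn where "PEn u = prod_pmf n (\<lambda>i. PE (u i))"
definition Kern where
  "Kern e u = do { s \<leftarrow> prod_pmf n (\<lambda>i. PS (e i)); x \<leftarrow> prod_pmf n (\<lambda>i. PX (u i) (e i));
     yz \<leftarrow> prod_pmf n (\<lambda>i. W (x i) (s i));
     let y = (\<lambda>i\<in>{..<n}. fst (yz i)); z = (\<lambda>i\<in>{..<n}. snd (yz i)) in do {
     t \<leftarrow> prod_pmf n (\<lambda>i. PT (x i) (e i) (z i)); return_pmf (s, x, y, z, t) } }"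

lemma finite_prod_pmf: "(\<And>i. i < n \<Longrightarrow> finite (set_pmf (p i))) \<Longrightarrow> finite (set_pmf (prod_pmf n p))"
  by (rule finite_set_Pi_pmf) auto

lemma finite_Kern: "finite (set_pmf (Kern e u))"
  by (simp add: Kern_def Let_def finite_prod_pmf)

sublocale random_code M G L undefined "iid n q" PEn Kern "\<lambda>(s, x, y, z, t). y" "\<lambda>(s, x, y, z, t). t"
  by unfold_locales
     (use MGL finite_q in \<open>simp_all add: iid_def PEn_def finite_prod_pmf finite_Kern\<close>)

definition zipn where "zipn = (\<lambda>(e, s, x, y, z, t). \<lambda>i\<in>{..<n}. (e i, s i, x i, y i, z i, t i))"

text \<open>Memorylessness: composing product kernels is the product of the composed kernels, so
  given the codeword the letters are independent.\<close>

lemma zipn_outp: "map_pmf zipn (outp u) = prod_pmf n (\<lambda>i. out1 (u i))"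
proof -
  have r: "prod_pmf n (\<lambda>i. PT (x i) (e i) ((\<lambda>i\<in>{..<n}. snd (yz i)) i)) = prod_pmf n (\<lambda>i. PT (x i) (e i) (snd (yz i)))"
    for x e and yz :: "nat \<Rightarrow> 'y \<times> 'z" by (rule prod_pmf_cong) simp
  have r2: "zipn (e, s, x, \<lambda>i\<in>{..<n}. fst (yz i), \<lambda>i\<in>{..<n}. snd (yz i), t)
     = (\<lambda>i\<in>{..<n}. (e i, s i, x i, fst (yz i), snd (yz i), t i))" for e s x t and yz :: "nat \<Rightarrow> 'y \<times> 'z"
    by (auto simp: zipn_def restrict_def)
  show ?thesis
    unfolding outp_def PEn_def Kern_def out1_def case_prod_unfold prod_pmf_bind prod_pmf_return Let_def r
    by (simp add: map_bind_pmf bind_assoc_pmf bind_return_pmf r2)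
qed

lemma outp_seqs:
  assumes "(e, s, x, y, z, t) \<in> set_pmf (outp u)"
  shows "e \<in> seqs n" "y \<in> seqs n" "t \<in> seqs n"
proof -
  show "e \<in> seqs n" "y \<in> seqs n" "t \<in> seqs n"
    using assms
    by (auto simp: outp_def PEn_def Kern_def Let_def seqs_def dest!: subsetD[OF set_prod_pmf_seqs]
        split: if_splits)
qed

lemma restrict_seqs: "f \<in> seqs n \<Longrightarrow> (\<lambda>i\<in>{..<n}. f i) = f"
  by (auto simp: seqs_def)

lemma map_outp:
  assumes "\<And>e s x y z t. (e, s, x, y, z, t) \<in> set_pmf (outp u) \<Longrightarrow>
    h (e, s, x, y, z, t) = (\<lambda>i\<in>{..<n}. g (e i, s i, x i, y i, z i, t i))"
  shows "map_pmf h (outp u) = prod_pmf n (\<lambda>i. map_pmf g (out1 (u i)))"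
proof -
  have "map_pmf h (outp u) = map_pmf (\<lambda>w. \<lambda>i\<in>{..<n}. g (zipn w i)) (outp u)"
  proof (rule map_pmf_cong[OF refl])
    fix w assume w: "w \<in> set_pmf (outp u)"
    obtain e s x y z t where we: "w = (e, s, x, y, z, t)" by (cases w)
    show "h w = (\<lambda>i\<in>{..<n}. g (zipn w i))"
      unfolding we assms[OF w[unfolded we]] by (auto simp: zipn_def)
  qed
  also have "\<dots> = map_pmf (\<lambda>f. \<lambda>i\<in>{..<n}. g (f i)) (map_pmf zipn (outp u))" by (simp add: map_pmf_comp)
  finally show ?thesis by (simp only: zipn_outp prod_pmf_map)
qed


lemma VY_prod: "VY u = prod_pmf n (\<lambda>i. VY1 (u i))"
  unfolding VY_def VY1_def by (rule map_outp) (auto dest!: outp_seqs(2) simp: restrict_seqs)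

lemma VT_prod: "VT u = prod_pmf n (\<lambda>i. VT1 (u i))"
  unfolding VT_def VT1_def by (rule map_outp) (auto dest!: outp_seqs(3) simp: restrict_seqs)

lemma VYT_prod: "map_pmf (\<lambda>(e, s, x, y, z, t). \<lambda>i\<in>{..<n}. (y i, t i)) (outp u) = prod_pmf n (\<lambda>i. VYT1 (u i))"
  unfolding VYT1_def by (rule map_outp) auto

lemma bind_iid: "bind_pmf (iid n p) (\<lambda>u. prod_pmf n (\<lambda>i. V (u i))) = iid n (bind_pmf p V)"
  by (simp add: iid_def prod_pmf_bind)

lemma pY_iid: "pY = iid n (bind_pmf q VY1)" unfolding pY_bind by (simp add: VY_prod[abs_def] bind_iid)
lemma pT_iid: "pT = iid n (bind_pmf q VT1)" unfolding pT_bind by (simp add: VT_prod[abs_def] bind_iid)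


lemma pE_iid: "pE = iid n Pe" unfolding pE_def PEn_def by (simp add: bind_iid bind_q_PE)

definition zipQ where "zipQ = (\<lambda>(u, e, s, x, y, z, t). \<lambda>i\<in>{..<n}. (e i, s i, u i, x i, y i, z i, t i))"

text \<open>This identifies the law of one random codeword with its outputs as \<open>n\<close>
  independent copies of \<open>Q\<close>, which makes the weak law applicable to every typicality
  event.\<close>

lemma zipQ_avg_law: "map_pmf zipQ avg_law = iid n Q"
proof -
  have h: "map_pmf (\<lambda>w. zipQ (u, w)) (outp u) = prod_pmf n (\<lambda>i. map_pmf (\<lambda>(e, s, x, y, z, t). (e, s, u i, x, y, z, t)) (out1 (u i)))"
    for u
  proof -
    have "prod_pmf n (\<lambda>i. map_pmf (\<lambda>(e, s, x, y, z, t). (e, s, u i, x, y, z, t)) (out1 (u i)))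
       = map_pmf (\<lambda>f. \<lambda>i\<in>{..<n}. case f i of (e, s, x, y, z, t) \<Rightarrow> (e, s, u i, x, y, z, t)) (prod_pmf n (\<lambda>i. out1 (u i)))"
      by (simp add: map_pmf_def prod_pmf_bind prod_pmf_return case_prod_unfold)
    also have "\<dots> = map_pmf (\<lambda>w. zipQ (u, w)) (outp u)"
      unfolding zipn_outp[symmetric] map_pmf_comp
      by (rule map_pmf_cong) (auto simp: zipn_def zipQ_def restrict_def fun_eq_iff)
    finally show ?thesis by simp
  qed
  have "map_pmf zipQ avg_law = do { u \<leftarrow> iid n q; map_pmf (\<lambda>w. zipQ (u, w)) (outp u) }"
    by (simp add: avg_law_def map_bind_pmf map_pmf_def bind_assoc_pmf bind_return_pmf case_prod_unfold)
  also have "\<dots> = iid n (bind_pmf q (\<lambda>u. map_pmf (\<lambda>(e, s, x, y, z, t). (e, s, u, x, y, z, t)) (out1 u)))"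
    unfolding h iid_def prod_pmf_bind ..
  also have "bind_pmf q (\<lambda>u. map_pmf (\<lambda>(e, s, x, y, z, t). (e, s, u, x, y, z, t)) (out1 u)) = Q"
    unfolding Q_out1 by (simp add: map_pmf_def case_prod_unfold)
  finally show ?thesis .
qed

definition zip2 where "zip2 y t = (\<lambda>i\<in>{..<n}. (y i, t i))"

lemma inj_zip2: "inj_on (\<lambda>t. zip2 y t) (seqs n)"
proof (rule inj_onI)
  fix t t' assume t: "t \<in> seqs n" "t' \<in> seqs n" and e: "zip2 y t = zip2 y t'"
  have "t i = t' i" if "i < n" for i using fun_cong[OF e, of i] that by (simp add: zip2_def)
  then show "t = t'" using t unfolding seqs_def by (intro PiE_ext) auto
qed

lemma prob_outp_YT:
  assumes y: "y \<in> seqs n" and B: "B \<subseteq> seqs n"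
  shows "prb (outp u) {(e, s, x, y', z, t). y' = y \<and> t \<in> B}
    = (\<Sum>t\<in>B. pmf (prod_pmf n (\<lambda>i. VYT1 (u i))) (zip2 y t))"
proof -
  have finB: "finite B" by (rule finite_subset[OF B finite_seqs])
  let ?h = "\<lambda>(e :: nat \<Rightarrow> 'e, s :: nat \<Rightarrow> 's, x :: nat \<Rightarrow> 'x, y, z :: nat \<Rightarrow> 'z, t). zip2 y t"
  have "prb (outp u) {(e, s, x, y', z, t). y' = y \<and> t \<in> B}
      = prb (outp u) (?h -` (zip2 y ` B))"
  \<comment> \<open>The two events agree only on the support: \<open>zip2\<close> ignores values off
    \<open>{..<n}\<close>, and outputs are determined by their letters only because they are
    extensional.\<close>
  proof (rule measure_pmf.finite_measure_eq_AE)
    show "AE w in measure_pmf (outp u). (w \<in> {(e, s, x, y', z, t). y' = y \<and> t \<in> B}) = (w \<in> ?h -` (zip2 y ` B))"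
      unfolding AE_measure_pmf_iff
    proof
      fix w assume w: "w \<in> set_pmf (outp u)"
      obtain e s x y' z t where we: "w = (e, s, x, y', z, t)" by (cases w)
      note sq = outp_seqs[OF w[unfolded we]]
      have "y' = y \<and> t = t'" if "zip2 y' t = zip2 y t'" "t' \<in> B" for t'
      proof -
        have eq: "y' i = y i \<and> t i = t' i" if "i < n" for i
          using fun_cong[OF \<open>zip2 y' t = zip2 y t'\<close>, of i] that by (simp add: zip2_def)
        have "t' \<in> seqs n" using that B by auto
        then show ?thesis using eq seqs_eqI[OF sq(2) y] seqs_eqI[OF sq(3) \<open>t' \<in> seqs n\<close>] by auto
      qed
      then show "(w \<in> {(e, s, x, y', z, t). y' = y \<and> t \<in> B}) = (w \<in> ?h -` (zip2 y ` B))"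
        unfolding we by auto
    qed
  qed auto
  also have "\<dots> = prb (prod_pmf n (\<lambda>i. VYT1 (u i))) (zip2 y ` B)"
    unfolding VYT_prod[symmetric] by (simp only: measure_map_pmf zip2_def)
  also have "\<dots> = (\<Sum>t\<in>B. pmf (prod_pmf n (\<lambda>i. VYT1 (u i))) (zip2 y t))"
    using finB by (simp add: measure_measure_pmf_finite sum.reindex[OF inj_on_subset[OF inj_zip2 B]])
  finally show ?thesis .
qed

lemma prob_avg_YT:
  assumes y: "y \<in> seqs n" and B: "B \<subseteq> seqs n"
  shows "prb avg_law {(u, e, s, x, y', z, t). y' = y \<and> t \<in> B}
    = (\<Sum>t\<in>B. pmf (iid n (bind_pmf q VYT1)) (zip2 y t))"
proof -
  have "prb avg_law {(u, e, s, x, y', z, t). y' = y \<and> t \<in> B}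
     = expec (iid n q) (\<lambda>u. prb (outp u) {(e, s, x, y', z, t). y' = y \<and> t \<in> B})"
    using expectation_outp[of "{(u, e, s, x, y', z, t). y' = y \<and> t \<in> B}"] by (simp add: case_prod_unfold)
  also have "\<dots> = (\<Sum>t\<in>B. expec (iid n q) (\<lambda>u. pmf (prod_pmf n (\<lambda>i. VYT1 (u i))) (zip2 y t)))"
    unfolding prob_outp_YT[OF y B] by (rule Bochner_Integration.integral_sum) (rule intq)
  also have "\<dots> = (\<Sum>t\<in>B. pmf (iid n (bind_pmf q VYT1)) (zip2 y t))"
    unfolding bind_iid[symmetric] pmf_bind ..
  finally show ?thesis .
qed

end

lemma exists_le_expectation:
  fixes f :: "'a \<Rightarrow> real"
  assumes "finite (set_pmf p)"
  shows "\<exists>x\<in>set_pmf p. f x \<le> expec p f"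
proof (rule ccontr)
  assume "\<not> ?thesis"
  then have lt: "expec p f < f x" if "x \<in> set_pmf p" for x using that by force
  define m where "m = Min (f ` set_pmf p)"
  have m: "m \<in> f ` set_pmf p" unfolding m_def using assms set_pmf_not_empty[of p] by (intro Min_in) auto
  have "m = expec p (\<lambda>_. m)" by simp
  also have "\<dots> \<le> expec p f"
  proof (intro integral_mono_AE integrable_measure_pmf_finite assms)
    show "AE x in measure_pmf p. m \<le> f x"
      unfolding AE_measure_pmf_iff m_def using assms by auto
  qed
  finally show False using m lt by force
qed

text \<open>A single kernel indexed by \<open>(u, y)\<close> serves all \<open>u\<close>, so that
  type counting can treat the pair as the side information letter.\<close>

lemma pmf_pair_disintegrate:
  fixes V :: "'u \<Rightarrow> ('y \<times> 't) pmf"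
  obtains \<kappa> :: "'u \<times> 'y \<Rightarrow> 't pmf" where "\<And>u y t. pmf (V u) (y, t) = pmf (map_pmf fst (V u)) y * pmf (\<kappa> (u, y)) t"
proof -
  have "\<exists>\<kappa>. \<forall>y t. pmf J (y, t) = pmf (map_pmf fst J) y * pmf (\<kappa> y) t" for J :: "('y \<times> 't) pmf"
  proof -
    obtain \<kappa> where \<kappa>: "J = do { y \<leftarrow> map_pmf fst J; t \<leftarrow> \<kappa> y; return_pmf (y, t) }"
      using disintegration_pmf_fst[of J] by (elim exE)
    have "pmf J (y, t) = pmf (map_pmf fst J) y * pmf (\<kappa> y) t" for y t
      using pmf_bind_Pair[of "map_pmf fst J" \<kappa> y t] unfolding \<kappa>[symmetric] .
    then show ?thesis by blast
  qed
  then have "\<forall>u. \<exists>\<kappa>. \<forall>y t. pmf (V u) (y, t) = pmf (map_pmf fst (V u)) y * pmf (\<kappa> y) t" by blast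
  then obtain \<kappa> where "\<forall>u y t. pmf (V u) (y, t) = pmf (map_pmf fst (V u)) y * pmf (\<kappa> u y) t" by metis
  then show thesis by (intro that[of "\<lambda>(u, y). \<kappa> u y"]) simp
qed

section \<open>Test functions defining typicality\<close>

context single_letter
begin

definition pY1 where "pY1 = bind_pmf q VY1"
definition pT1 where "pT1 = bind_pmf q VT1"


definition QTY where "QTY = map_pmf (\<lambda>(e, s, u, x, y, z, t). (t, y)) Q"
definition QTUY where "QTUY = map_pmf (\<lambda>(e, s, u, x, y, z, t). (t, (u, y))) Q"

definition \<phi>Y where "\<phi>Y = (\<lambda>(e :: 'e, s :: 's, u, x :: 'x, y, z :: 'z, t :: 's). idens VY1 pY1 u y)"
definition \<phi>E where "\<phi>E = (\<lambda>(e, s :: 's, u, x :: 'x, y :: 'y, z :: 'z, t :: 's). idens PE Pe u e)"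
definition \<phi>T where "\<phi>T = (\<lambda>(e :: 'e, s :: 's, u, x :: 'x, y :: 'y, z :: 'z, t). idens VT1 pT1 u t)"
definition \<phi>D where "\<phi>D d = (\<lambda>(e :: 'e, s :: 's, u :: nat, x :: 'x, y :: 'y, z :: 'z, t :: 's). d s t :: real)"
definition ind1 where "ind1 a = (\<lambda>(e :: 'e, s :: 's, u :: nat, x :: 'x, y :: 'y, z :: 'z, t :: 's). if (t, y) = a then 1 else 0 :: real)"
definition ind2 where "ind2 a = (\<lambda>(e :: 'e, s :: 's, u :: nat, x :: 'x, y :: 'y, z :: 'z, t :: 's). if (t, (u, y)) = a then 1 else 0 :: real)"
text \<open>Concentration of these sample means gives everything asked of a typical outcome: the
  three densities, the distortion, and the empirical laws of \<open>(t, y)\<close> and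
  \<open>(t, (u, y))\<close>. The indicators also cover pairs of probability zero as long as the
  side information letter is possible.\<close>

definition tests where
  "tests d = {\<phi>Y, \<phi>E, \<phi>T, \<phi>D d} \<union> ind1 ` (UNIV \<times> snd ` set_pmf QTY) \<union> ind2 ` (UNIV \<times> snd ` set_pmf QTUY)"

lemma finite_tests: "finite (tests d)"
  unfolding tests_def QTY_def QTUY_def using finite_Q by auto

lemma expectation_ind1: "expec Q (ind1 a) = pmf QTY a"
proof -
  have "pmf QTY a = expec QTY (indicator {a})" by (simp add: measure_pmf_single)
  also have "\<dots> = expec Q (ind1 a)"
    unfolding QTY_def integral_map_pmf
    by (rule Bochner_Integration.integral_cong) (auto simp: ind1_def indicator_def)
  finally show ?thesis by simp
qed

lemma expectation_ind2: "expec Q (ind2 a) = pmf QTUY a"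
proof -
  have "pmf QTUY a = expec QTUY (indicator {a})" by (simp add: measure_pmf_single)
  also have "\<dots> = expec Q (ind2 a)"
    unfolding QTUY_def integral_map_pmf
    by (rule Bochner_Integration.integral_cong) (auto simp: ind2_def indicator_def)
  finally show ?thesis by simp
qed

lemma joint_Q:
  "map_pmf (\<lambda>(e, s, u, x, y, z, t). (u, g (e, s, x, y, z, t))) Q = do { u \<leftarrow> q; v \<leftarrow> map_pmf g (out1 u); return_pmf (u, v) }"
  unfolding Q_out1 by (simp add: map_pmf_def bind_assoc_pmf bind_return_pmf case_prod_unfold)

lemma map_fst_out1: "map_pmf fst (out1 u) = PE u"
  by (simp add: out1_def map_pmf_def bind_assoc_pmf bind_return_pmf bind_return_pmf' case_prod_unfold)

lemma mutual_info_UY: "mutual_info Q (\<lambda>(e, s, u, x, y, z, t). u) (\<lambda>(e, s, u, x, y, z, t). y) = expec Q \<phi>Y"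
proof -
  have "map_pmf (\<lambda>w. ((\<lambda>(e, s, u, x, y, z, t). u) w, (\<lambda>(e, s, u, x, y, z, t). y) w)) Q = do { u \<leftarrow> q; v \<leftarrow> VY1 u; return_pmf (u, v) }"
    using joint_Q[of "\<lambda>(e, s, x, y, z, t). y"] by (simp add: VY1_def case_prod_unfold)
  from mutual_info_idens[OF finite_Q this] show ?thesis
    by (simp add: \<phi>Y_def pY1_def case_prod_unfold)
qed

lemma mutual_info_UT: "mutual_info Q (\<lambda>(e, s, u, x, y, z, t). u) (\<lambda>(e, s, u, x, y, z, t). t) = expec Q \<phi>T"
proof -
  have "map_pmf (\<lambda>w. ((\<lambda>(e, s, u, x, y, z, t). u) w, (\<lambda>(e, s, u, x, y, z, t). t) w)) Q = do { u \<leftarrow> q; v \<leftarrow> VT1 u; return_pmf (u, v) }"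
    using joint_Q[of "\<lambda>(e, s, x, y, z, t). t"] by (simp add: VT1_def case_prod_unfold)
  from mutual_info_idens[OF finite_Q this] show ?thesis
    by (simp add: \<phi>T_def pT1_def case_prod_unfold)
qed

lemma mutual_info_UE: "mutual_info Q (\<lambda>(e, s, u, x, y, z, t). u) (\<lambda>(e, s, u, x, y, z, t). e) = expec Q \<phi>E"
proof -
  have "map_pmf (\<lambda>w. ((\<lambda>(e, s, u, x, y, z, t). u) w, (\<lambda>(e, s, u, x, y, z, t). e) w)) Q = do { u \<leftarrow> q; v \<leftarrow> PE u; return_pmf (u, v) }"
    using joint_Q[of fst] by (simp add: map_fst_out1 case_prod_unfold)
  from mutual_info_idens[OF finite_Q this] show ?thesis
    by (simp add: \<phi>E_def bind_q_PE case_prod_unfold)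
qed

lemma snd_QTY: "snd ` set_pmf QTY = set_pmf pY1"
proof -
  have "map_pmf snd QTY = pY1"
    unfolding QTY_def pY1_def VY1_def[abs_def] Q_out1
    by (simp add: map_pmf_def bind_assoc_pmf bind_return_pmf case_prod_unfold)
  then show ?thesis by (metis set_map_pmf)
qed

lemma snd_QTUY: "snd ` set_pmf QTUY = {(u, y). u \<in> set_pmf q \<and> y \<in> set_pmf (VY1 u)}"
proof -
  have "map_pmf snd QTUY = do { u \<leftarrow> q; y \<leftarrow> VY1 u; return_pmf (u, y) }"
    unfolding QTUY_def VY1_def[abs_def] Q_out1
    by (simp add: map_pmf_def bind_assoc_pmf bind_return_pmf case_prod_unfold)
  then have "snd ` set_pmf QTUY = set_pmf (do { u \<leftarrow> q; y \<leftarrow> VY1 u; return_pmf (u, y) })" by (metis set_map_pmf)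
  then show ?thesis by auto
qed

end

section \<open>Typicality and the random codebook\<close>

definition rate_bound ::
  "('s \<Rightarrow> 's \<Rightarrow> real) \<Rightarrow> nat \<Rightarrow> real \<Rightarrow> real \<Rightarrow> ('s::finite \<times> 'v) pmf \<Rightarrow> real \<Rightarrow> bool"
where
  "rate_bound d n \<theta> \<delta> J r \<longleftrightarrow> (\<forall>s v t. (\<forall>i<n. v i \<in> snd ` set_pmf J) \<longrightarrow>
     (\<forall>x\<in>UNIV \<times> snd ` set_pmf J. \<bar>freq n (\<lambda>i. (s i, v i)) x - pmf J x\<bar> \<le> \<delta>) \<longrightarrow>
     avg_dist d n s t \<le> \<theta> \<longrightarrow> r \<le> cmi (UNIV \<times> snd ` set_pmf J \<times> UNIV) (freq n (\<lambda>i. (s i, v i, t i))))"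

text \<open>The contrapositive of \<open>distortion_rate_stable\<close>, applied to joint
  frequencies. The gain of \<open>\<epsilon>\<close> over \<open>r\<close> is the source of the
  exponential decay of the leakage.\<close>

lemma rate_bound_exists:
  fixes J :: "('s::finite \<times> 'v::countable) pmf"
  assumes J: "finite (set_pmf J)" and r: "r \<ge> 0"
    and DE: "ereal DE \<le> cond_distortion_rate d r J" and \<eta>: "\<eta> > 0"
  shows "\<exists>\<epsilon>>0. \<forall>n>0. \<forall>\<delta>\<le>\<epsilon>. rate_bound d n (DE - \<eta>) \<delta> J (r + \<epsilon>)"
proof -
  let ?F = "(UNIV :: 's set) \<times> snd ` set_pmf J \<times> (UNIV :: 's set)"
  have F: "finite ?F" using J by auto
  obtain \<epsilon> where \<epsilon>: "\<epsilon> > 0"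
    "\<And>V. (\<And>w. w \<in> ?F \<Longrightarrow> 0 \<le> V w) \<Longrightarrow> (\<Sum>w\<in>?F. V w) = 1 \<Longrightarrow>
      (\<And>x. x \<in> UNIV \<times> snd ` set_pmf J \<Longrightarrow> \<bar>marg ?F (\<lambda>(s, v, t). (s, v)) V x - pmf J x\<bar> \<le> \<epsilon>) \<Longrightarrow>
      cmi ?F V \<le> r + \<epsilon> \<Longrightarrow> DE - \<eta> < (\<Sum>(s, v, t)\<in>?F. V (s, v, t) * d s t)"
    using distortion_rate_stable[OF J r DE \<eta>] by blast
  have "rate_bound d n (DE - \<eta>) \<delta> J (r + \<epsilon>)" if n: "n > 0" and \<delta>: "\<delta> \<le> \<epsilon>" for n \<delta>
    unfolding rate_bound_def
  proof (intro allI impI, rule ccontr)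
    fix s :: "nat \<Rightarrow> 's" and v :: "nat \<Rightarrow> 'v" and t :: "nat \<Rightarrow> 's"
    assume v: "\<forall>i<n. v i \<in> snd ` set_pmf J"
      and close: "\<forall>x\<in>UNIV \<times> snd ` set_pmf J. \<bar>freq n (\<lambda>i. (s i, v i)) x - pmf J x\<bar> \<le> \<delta>"
      and dist: "avg_dist d n s t \<le> DE - \<eta>"
      and c: "\<not> r + \<epsilon> \<le> cmi ?F (freq n (\<lambda>i. (s i, v i, t i)))"
    let ?V = "freq n (\<lambda>i. (s i, v i, t i))"
    have sub: "(\<lambda>i. (s i, v i, t i)) ` {..<n} \<subseteq> ?F" using v by auto
    have "DE - \<eta> < (\<Sum>(s, v, t)\<in>?F. ?V (s, v, t) * d s t)"
    proof (rule \<epsilon>(2))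
      show "(\<Sum>w\<in>?F. ?V w) = 1" using sum_freq[OF F sub, of "\<lambda>_. 1"] n by simp
      fix x :: "'s \<times> 'v" assume x: "x \<in> UNIV \<times> snd ` set_pmf J"
      show "\<bar>marg ?F (\<lambda>(s, v, t). (s, v)) ?V x - pmf J x\<bar> \<le> \<epsilon>"
        unfolding marg_freq[OF F sub] using close[rule_format, OF x] \<delta> by simp
    qed (use c in \<open>auto simp: freq_nonneg\<close>)
    also have "\<dots> = avg_dist d n s t"
      using sum_freq[OF F sub, of "\<lambda>(s, v, t). d s t"] by (simp add: avg_dist_def case_prod_unfold)
    finally show False using dist by simp
  qed
  then show ?thesis using \<epsilon>(1) by blast
qed

lemma sum_indicator_freq: "(\<Sum>i<n. if w i = a then 1 else 0) / real n = freq n w a"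
proof -
  have "(\<Sum>i<n. if w i = a then 1 else (0::real)) = real (card {i\<in>{..<n}. w i = a})"
    by (subst sum.inter_filter[symmetric]) auto
  then show ?thesis by (simp only: freq_def)
qed

section \<open>Hitting probabilities of distortion balls\<close>

context n_letter
begin

text \<open>The law of \<open>y\<close> factors out and types are counted for the rest. It is used
  with \<open>v\<close> equal to the pair of \<open>u\<close> and \<open>y\<close> for one codeword,
  and with \<open>v\<close> equal to \<open>y\<close> for the average over codewords.\<close>

lemma sum_zip2_le:
  fixes V :: "nat \<Rightarrow> ('y \<times> 's) pmf" and v :: "nat \<Rightarrow> 'v"
  assumes y: "y \<in> seqs n" and B: "B \<subseteq> seqs n"
    and \<kappa>: "\<And>i t. i < n \<Longrightarrow> pmf (V i) (y i, t) = pmf (map_pmf fst (V i)) (y i) * pmf (\<kappa> (v i)) t"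
    and F: "finite F" "UNIV \<times> v ` {..<n} \<times> t ` {..<n} \<subseteq> F"
    and c: "\<And>s. s \<in> B \<Longrightarrow> c \<le> cmi F (freq n (\<lambda>i. (s i, v i, t i)))"
  shows "(\<Sum>s\<in>B. pmf (prod_pmf n V) (zip2 y s))
    \<le> pmf (prod_pmf n (\<lambda>i. map_pmf fst (V i))) y * ((real n + 1) ^ card F * 2 powr (- real n * c))"
proof -
  have "pmf (prod_pmf n V) (zip2 y s) = pmf (prod_pmf n (\<lambda>i. map_pmf fst (V i))) y * (\<Prod>i<n. pmf (\<kappa> (v i)) (s i))"
    if "s \<in> B" for s
  proof -
    have "zip2 y s \<in> seqs n" by (simp add: zip2_def seqs_def)
    then have "pmf (prod_pmf n V) (zip2 y s) = (\<Prod>i<n. pmf (V i) (y i, s i))"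
      by (subst pmf_prod_pmf) (simp_all add: zip2_def)
    also have "\<dots> = (\<Prod>i<n. pmf (map_pmf fst (V i)) (y i) * pmf (\<kappa> (v i)) (s i))"
      by (rule prod.cong) (simp_all add: \<kappa>)
    finally show ?thesis by (simp only: prod.distrib pmf_prod_pmf[OF y])
  qed
  then have "(\<Sum>s\<in>B. pmf (prod_pmf n V) (zip2 y s))
     = pmf (prod_pmf n (\<lambda>i. map_pmf fst (V i))) y * (\<Sum>s\<in>B. \<Prod>i<n. pmf (\<kappa> (v i)) (s i))"
    unfolding sum_distrib_left by (rule sum.cong[OF refl])
  also have "\<dots> \<le> pmf (prod_pmf n (\<lambda>i. map_pmf fst (V i))) y * ((real n + 1) ^ card F * 2 powr (- real n * c))"
    by (intro mult_left_mono types_prob_le[OF F B c]) auto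
  finally show ?thesis .
qed

definition atyp where
  "atyp d \<delta> = {w. \<exists>\<phi>\<in>tests d. \<bar>(\<Sum>i<n. \<phi> (w i)) / real n - expec Q \<phi>\<bar> > \<delta>}"

definition FY where "FY = (UNIV :: 's set) \<times> snd ` set_pmf QTY \<times> (UNIV :: 's set)"
definition FUY where "FUY = (UNIV :: 's set) \<times> snd ` set_pmf QTUY \<times> (UNIV :: 's set)"

lemma finite_FY: "finite FY" and finite_FUY: "finite FUY"
  using finite_Q by (auto simp: FY_def FUY_def QTY_def QTUY_def)

definition IY where "IY = expec Q \<phi>Y"
definition IE where "IE = expec Q \<phi>E"
definition IT where "IT = expec Q \<phi>T"

text \<open>Of the density test only the upper half is present: it limits how strongly a single
  codeword can favour a given \<open>y\<close>. The lower half belongs to the decoder and sits in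
  \<open>dec_set\<close>.\<close>

definition Typ where
  "Typ \<delta> = {(u, y, t). (\<forall>i<n. u i \<in> set_pmf q \<and> y i \<in> set_pmf (VY1 (u i)))
     \<and> (\<Sum>i<n. idens VY1 pY1 (u i) (y i)) \<le> real n * (IY + \<delta>)
     \<and> (\<forall>x\<in>UNIV \<times> snd ` set_pmf QTY. \<bar>freq n (\<lambda>i. (t i, y i)) x - pmf QTY x\<bar> \<le> \<delta>)
     \<and> (\<forall>x\<in>UNIV \<times> snd ` set_pmf QTUY. \<bar>freq n (\<lambda>i. (t i, (u i, y i))) x - pmf QTUY x\<bar> \<le> \<delta>)}"

definition Near where "Near d \<theta> t = {s. avg_dist d n s t \<le> \<theta>}"

definition dec_set where
  "dec_set \<delta> = {(u, y). (\<forall>i<n. y i \<in> set_pmf (VY1 (u i))) \<and> y \<in> seqs n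
     \<and> real n * (IY - \<delta>) \<le> (\<Sum>i<n. idens VY1 pY1 (u i) (y i))}"

lemma prob_avg_le_atyp:
  assumes "\<And>u e s x y z t. (u, e, s, x, y, z, t) \<in> set_pmf avg_law \<Longrightarrow>
    zipQ (u, e, s, x, y, z, t) \<notin> atyp d \<delta> \<Longrightarrow> (u, e, s, x, y, z, t) \<notin> B"
  shows "prb avg_law B \<le> prb (iid n Q) (atyp d \<delta>)"
proof -
  have "prb avg_law B \<le> prb avg_law (zipQ -` atyp d \<delta>)"
  proof (rule measure_pmf.finite_measure_mono_AE)
    show "AE w in measure_pmf avg_law. w \<in> B \<longrightarrow> w \<in> zipQ -` atyp d \<delta>"
      unfolding AE_measure_pmf_iff
    proof (intro ballI impI)
      fix w assume "w \<in> set_pmf avg_law" "w \<in> B"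
      then show "w \<in> zipQ -` atyp d \<delta>" using assms by (cases w) blast
    qed
  qed auto
  then show ?thesis by (simp only: zipQ_avg_law[symmetric] measure_map_pmf)
qed

lemma avg_law_support:
  assumes "(u, e, s, x, y, z, t) \<in> set_pmf avg_law"
  shows "i < n \<Longrightarrow> u i \<in> set_pmf q" "i < n \<Longrightarrow> y i \<in> set_pmf (VY1 (u i))" "y \<in> seqs n" "t \<in> seqs n"
    "e \<in> seqs n"
proof -
  have u: "u \<in> set_pmf (iid n q)" and o: "(e, s, x, y, z, t) \<in> set_pmf (outp u)"
    using assms by (auto simp: avg_law_def)
  show "i < n \<Longrightarrow> u i \<in> set_pmf q" using u by (auto simp: iid_def set_prod_pmf)
  show "y \<in> seqs n" "t \<in> seqs n" "e \<in> seqs n" using outp_seqs[OF o] by auto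
  have "y \<in> set_pmf (VY u)" using o by (force simp: VY_def)
  then show "i < n \<Longrightarrow> y i \<in> set_pmf (VY1 (u i))" by (auto simp: VY_prod set_prod_pmf)
qed

lemma not_atyp:
  assumes n: "n > 0" and w: "zipQ (u, e, s, x, y, z, t) \<notin> atyp d \<delta>"
  shows "(\<Sum>i<n. idens VY1 pY1 (u i) (y i)) \<le> real n * (IY + \<delta>)"
    "real n * (IY - \<delta>) \<le> (\<Sum>i<n. idens VY1 pY1 (u i) (y i))"
    "(\<Sum>i<n. idens PE Pe (u i) (e i)) \<le> real n * (IE + \<delta>)"
    "(\<Sum>i<n. idens VT1 pT1 (u i) (t i)) \<le> real n * (IT + \<delta>)"
    "avg_dist d n s t \<le> expec Q (\<phi>D d) + \<delta>"
    "a \<in> UNIV \<times> snd ` set_pmf QTY \<Longrightarrow> \<bar>freq n (\<lambda>i. (t i, y i)) a - pmf QTY a\<bar> \<le> \<delta>"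
    "b \<in> UNIV \<times> snd ` set_pmf QTUY \<Longrightarrow> \<bar>freq n (\<lambda>i. (t i, (u i, y i))) b - pmf QTUY b\<bar> \<le> \<delta>"
proof -
  have le: "\<bar>(\<Sum>i<n. \<phi> (zipQ (u, e, s, x, y, z, t) i)) / real n - expec Q \<phi>\<bar> \<le> \<delta>"
    if "\<phi> \<in> tests d" for \<phi> using w that by (force simp: atyp_def)
  have Y: "\<bar>(\<Sum>i<n. idens VY1 pY1 (u i) (y i)) / real n - IY\<bar> \<le> \<delta>"
    using le[of \<phi>Y] by (simp add: tests_def IY_def \<phi>Y_def zipQ_def)
  then show "(\<Sum>i<n. idens VY1 pY1 (u i) (y i)) \<le> real n * (IY + \<delta>)"
    "real n * (IY - \<delta>) \<le> (\<Sum>i<n. idens VY1 pY1 (u i) (y i))"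
    using n by (auto simp: abs_le_iff field_simps)
  have "\<bar>(\<Sum>i<n. idens PE Pe (u i) (e i)) / real n - IE\<bar> \<le> \<delta>"
    using le[of \<phi>E] by (simp add: tests_def IE_def \<phi>E_def zipQ_def)
  then show "(\<Sum>i<n. idens PE Pe (u i) (e i)) \<le> real n * (IE + \<delta>)"
    using n by (auto simp: abs_le_iff field_simps)
  have "\<bar>(\<Sum>i<n. idens VT1 pT1 (u i) (t i)) / real n - IT\<bar> \<le> \<delta>"
    using le[of \<phi>T] by (simp add: tests_def IT_def \<phi>T_def zipQ_def)
  then show "(\<Sum>i<n. idens VT1 pT1 (u i) (t i)) \<le> real n * (IT + \<delta>)"
    using n by (auto simp: abs_le_iff field_simps)
  have "\<bar>avg_dist d n s t - expec Q (\<phi>D d)\<bar> \<le> \<delta>"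
    using le[of "\<phi>D d"] by (simp add: tests_def avg_dist_def \<phi>D_def zipQ_def)
  then show "avg_dist d n s t \<le> expec Q (\<phi>D d) + \<delta>" by linarith
  show "\<bar>freq n (\<lambda>i. (t i, y i)) a - pmf QTY a\<bar> \<le> \<delta>" if "a \<in> UNIV \<times> snd ` set_pmf QTY"
  proof -
    have "(\<Sum>i<n. ind1 a (zipQ (u, e, s, x, y, z, t) i)) = (\<Sum>i<n. if (t i, y i) = a then 1 else 0)"
      by (rule sum.cong) (simp_all add: ind1_def zipQ_def)
    then show ?thesis using le[of "ind1 a"] that
      unfolding expectation_ind1 by (simp only: sum_indicator_freq) (simp add: tests_def)
  qed
  show "\<bar>freq n (\<lambda>i. (t i, (u i, y i))) b - pmf QTUY b\<bar> \<le> \<delta>" if "b \<in> UNIV \<times> snd ` set_pmf QTUY"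
  proof -
    have "(\<Sum>i<n. ind2 b (zipQ (u, e, s, x, y, z, t) i)) = (\<Sum>i<n. if (t i, (u i, y i)) = b then 1 else 0)"
      by (rule sum.cong) (simp_all add: ind2_def zipQ_def)
    then show ?thesis using le[of "ind2 b"] that
      unfolding expectation_ind2 by (simp only: sum_indicator_freq) (simp add: tests_def)
  qed
qed

text \<open>Two factors: passing from \<open>VY u\<close> to \<open>pY\<close> costs at most
  \<open>2 powr (real n * (IY + \<delta>))\<close> by typicality, and given \<open>(u, y)\<close>
  the ball is hit with probability about \<open>2 powr (- real n * r2)\<close> by type
  counting.\<close>

lemma outp_hit_le:
  assumes u: "u \<in> set_pmf (iid n q)" and y: "y \<in> seqs n"
    and rb: "r2 \<le> 0 \<or> rate_bound d n \<theta> \<delta> QTUY r2"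
  shows "prb (outp u) {(e, s, x, y', z, t'). y' = y \<and> (u, y, t') \<in> Typ \<delta> \<and> t' \<in> Near d \<theta> t}
    \<le> 2 powr (real n * (IY + \<delta>)) * (real n + 1) ^ card FUY * 2 powr (- real n * r2) * pmf pY y"
proof -
  define B where "B = {t'\<in>seqs n. (u, y, t') \<in> Typ \<delta> \<and> t' \<in> Near d \<theta> t}"
  let ?K = "(real n + 1) ^ card FUY * 2 powr (- real n * r2)"
  have B: "B \<subseteq> seqs n" by (auto simp: B_def)
  have ui: "u i \<in> set_pmf q" if "i < n" for i using u that by (auto simp: iid_def set_prod_pmf)
  have "prb (outp u) {(e, s, x, y', z, t'). y' = y \<and> (u, y, t') \<in> Typ \<delta> \<and> t' \<in> Near d \<theta> t}
     \<le> prb (outp u) {(e, s, x, y', z, t'). y' = y \<and> t' \<in> B}"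
    by (rule measure_pmf.finite_measure_mono_AE) (auto simp: AE_measure_pmf_iff B_def dest: outp_seqs)
  also have "\<dots> \<le> pmf (VY u) y * ?K"
  \<comment> \<open>For such \<open>r2\<close> the factor \<open>?K\<close> is at least one, so the
    ball may simply be ignored.\<close>
  proof (cases "r2 \<le> 0")
    case True
    have "prb (outp u) {(e, s, x, y', z, t'). y' = y \<and> t' \<in> B}
       \<le> prb (outp u) {(e, s, x, y', z, t'). y' = y}"
      by (rule measure_pmf.finite_measure_mono) auto
    also have "\<dots> = pmf (VY u) y"
      unfolding VY_def pmf_map by (rule arg_cong[where f="prb (outp u)"]) auto
    also have "\<dots> \<le> pmf (VY u) y * ?K"
    proof -
      have "1 * 1 \<le> ?K"
      proof (rule mult_mono)
        show "1 \<le> (real n + 1) ^ card FUY" by (rule one_le_power) simp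
        have "0 \<le> - real n * r2" using True by (simp add: mult_nonneg_nonpos)
        then show "1 \<le> 2 powr (- real n * r2)" by (rule ge_one_powr_ge_zero[rotated]) simp
      qed auto
      then have "pmf (VY u) y * 1 \<le> pmf (VY u) y * ?K" by (intro mult_left_mono) auto
      then show ?thesis by simp
    qed
    finally show ?thesis .
  next
    case False
    then have rb: "rate_bound d n \<theta> \<delta> QTUY r2" using rb by simp
    obtain \<kappa> where \<kappa>: "\<And>u y t. pmf (VYT1 u) (y, t) = pmf (map_pmf fst (VYT1 u)) y * pmf (\<kappa> (u, y)) t"
      using pmf_pair_disintegrate[of VYT1] by blast
    have fst: "map_pmf fst (VYT1 u) = VY1 u" for u
      by (simp add: VYT1_def VY1_def map_pmf_comp case_prod_unfold)
    show ?thesis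
    \<comment> \<open>A typical member of \<open>B\<close> is what guarantees that all letters
      \<open>(u i, y i)\<close> lie in the support, as \<open>rate_bound\<close> requires.\<close>
    proof (cases "B = {}")
      case True
      then show ?thesis by (simp add: case_prod_unfold)
    next
      case ne: False
      then have sup: "(u i, y i) \<in> snd ` set_pmf QTUY" if "i < n" for i
        using that unfolding snd_QTUY B_def Typ_def by auto
      have "(\<Sum>s\<in>B. pmf (prod_pmf n (\<lambda>i. VYT1 (u i))) (zip2 y s))
         \<le> pmf (prod_pmf n (\<lambda>i. map_pmf fst (VYT1 (u i)))) y * ?K"
      proof (rule sum_zip2_le[OF y B, where v="\<lambda>i. (u i, y i)" and \<kappa>=\<kappa> and t=t])
        show "UNIV \<times> (\<lambda>i. (u i, y i)) ` {..<n} \<times> t ` {..<n} \<subseteq> FUY" using sup by (auto simp: FUY_def)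
        fix s assume "s \<in> B"
        then show "r2 \<le> cmi FUY (freq n (\<lambda>i. (s i, (u i, y i), t i)))"
          using rb sup unfolding rate_bound_def FUY_def B_def Typ_def Near_def by auto
      qed (use \<kappa> finite_FUY in auto)
      then show ?thesis unfolding prob_outp_YT[OF y B] fst VY_prod .
    qed
  qed
  finally have main: "prb (outp u) {(e, s, x, y', z, t'). y' = y \<and> (u, y, t') \<in> Typ \<delta> \<and> t' \<in> Near d \<theta> t} \<le> pmf (VY u) y * ?K" .
  show ?thesis
  proof (cases "\<exists>t'. (u, y, t') \<in> Typ \<delta>")
    case True
    then have "(\<Sum>i<n. idens VY1 pY1 (u i) (y i)) \<le> real n * (IY + \<delta>)" by (auto simp: Typ_def)
    then have "pmf (VY u) y \<le> 2 powr (real n * (IY + \<delta>)) * pmf pY y"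
      unfolding VY_prod pY_iid pY1_def by (intro prod_pmf_idens_le[OF y] ui)
    then have "pmf (VY u) y * ?K \<le> 2 powr (real n * (IY + \<delta>)) * pmf pY y * ?K"
      by (intro mult_right_mono) auto
    from order_trans[OF main this] show ?thesis by (simp only: mult_ac)
  next
    case False
    then show ?thesis by (simp add: case_prod_unfold)
  qed
qed

lemma avg_hit_le:
  assumes y: "y \<in> set_pmf pY" and rb: "rate_bound d n \<theta> \<delta> QTY r1"
  shows "prb avg_law {(u, e, s, x, y', z, t'). y' = y \<and> (u, y, t') \<in> Typ \<delta> \<and> t' \<in> Near d \<theta> t}
    \<le> (real n + 1) ^ card FY * 2 powr (- real n * r1) * pmf pY y"
proof -
  define B where "B = {t'\<in>seqs n. (\<forall>x\<in>UNIV \<times> snd ` set_pmf QTY. \<bar>freq n (\<lambda>i. (t' i, y i)) x - pmf QTY x\<bar> \<le> \<delta>) \<and> t' \<in> Near d \<theta> t}"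
  have B: "B \<subseteq> seqs n" by (auto simp: B_def)
  have ys: "y \<in> seqs n" using y set_prod_pmf_seqs unfolding pY_iid unfolding iid_def by blast
  have yi: "y i \<in> snd ` set_pmf QTY" if "i < n" for i
    using y that unfolding pY_iid unfolding snd_QTY iid_def set_prod_pmf pY1_def by auto
  have "prb avg_law {(u, e, s, x, y', z, t'). y' = y \<and> (u, y, t') \<in> Typ \<delta> \<and> t' \<in> Near d \<theta> t}
     \<le> prb avg_law {(u, e, s, x, y', z, t'). y' = y \<and> t' \<in> B}"
    by (rule measure_pmf.finite_measure_mono_AE)
       (auto simp: AE_measure_pmf_iff B_def Typ_def dest: avg_law_support)
  also have "\<dots> \<le> pmf (prod_pmf n (\<lambda>i. map_pmf fst (bind_pmf q VYT1))) y * ((real n + 1) ^ card FY * 2 powr (- real n * r1))"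
  proof -
    \<comment> \<open>The averaged law is a single law, seen here as a family over the one-element
      type.\<close>
    obtain \<kappa> where \<kappa>: "\<And>u y t. pmf ((\<lambda>_::unit. bind_pmf q VYT1) u) (y, t)
       = pmf (map_pmf fst ((\<lambda>_::unit. bind_pmf q VYT1) u)) y * pmf (\<kappa> (u, y)) t"
      using pmf_pair_disintegrate[of "\<lambda>_::unit. bind_pmf q VYT1"] by blast
    have "(\<Sum>s\<in>B. pmf (prod_pmf n (\<lambda>i. bind_pmf q VYT1)) (zip2 y s))
         \<le> pmf (prod_pmf n (\<lambda>i. map_pmf fst (bind_pmf q VYT1))) y * ((real n + 1) ^ card FY * 2 powr (- real n * r1))"
    proof (rule sum_zip2_le[OF ys B, where v=y and \<kappa>="\<lambda>y. \<kappa> ((), y)" and t=t])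
      show "UNIV \<times> y ` {..<n} \<times> t ` {..<n} \<subseteq> FY" using yi by (auto simp: FY_def)
      fix s assume "s \<in> B"
      then show "r1 \<le> cmi FY (freq n (\<lambda>i. (s i, y i, t i)))"
        using rb yi unfolding rate_bound_def FY_def B_def Near_def by auto
    qed (use \<kappa> finite_FY in auto)
    then show ?thesis unfolding prob_avg_YT[OF ys B] unfolding iid_def .
  qed
  also have "map_pmf fst (bind_pmf q VYT1) = bind_pmf q VY1"
    by (simp add: VYT1_def[abs_def] VY1_def[abs_def] map_bind_pmf map_pmf_comp case_prod_unfold)
  also have "pmf (prod_pmf n (\<lambda>i. bind_pmf q VY1)) y = pmf pY y"
    unfolding pY_iid unfolding iid_def ..
  finally show ?thesis by (simp add: mult_ac)
qed

end

section \<open>Expected defects of a random codebook\<close>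

context n_letter
begin

abbreviation wrong where
  "wrong \<delta> C \<equiv> {((m, \<gamma>, l), e, s, x, y, z, t). m \<noteq> dec (dec_set \<delta>) C y \<gamma>}"

abbreviation atypical where
  "atypical d \<delta> C \<equiv> {(i, e, s, x, y, z, t).
     (C i, y, t) \<notin> Typ \<delta> \<or> avg_dist d n s t > expec Q (\<phi>D d) + \<delta>}"

lemma expectation_enc_tv_le:
  assumes n: "n > 0"
  shows "expec books enc_tv
    \<le> sqrt (2 powr (real n * (IE + \<delta>)) / real (card L)) + 2 * prb (iid n Q) (atyp d \<delta>)"
proof -
  define A where "A = {(u, e). e \<in> seqs n \<and> (\<Sum>i<n. idens PE Pe (u i) (e i)) \<le> real n * (IE + \<delta>)}"
  have "expec books enc_tv
    \<le> sqrt (2 powr (real n * (IE + \<delta>)) / real (card L)) + 2 * prb avg_law {(u, e, x). (u, e) \<notin> A}"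
  proof (rule expectation_enc_tv)
    fix u e assume u: "u \<in> set_pmf (iid n q)" and e: "(u, e) \<in> A"
    show "pmf (PEn u) e \<le> 2 powr (real n * (IE + \<delta>)) * pmf pE e"
      unfolding pE_iid PEn_def bind_q_PE[symmetric]
      by (rule prod_pmf_idens_le) (use u e in \<open>auto simp: A_def iid_def set_prod_pmf bind_q_PE\<close>)
  qed simp
  also have "prb avg_law {(u, e, x). (u, e) \<notin> A} \<le> prb (iid n Q) (atyp d \<delta>)"
    by (rule prob_avg_le_atyp) (auto simp: A_def dest: not_atyp(3)[OF n] avg_law_support(5))
  finally show ?thesis by simp
qed

lemma expectation_cov_tv_le:
  assumes n: "n > 0"
  shows "expec books cov_tv
    \<le> sqrt (2 powr (real n * (IT + \<delta>)) / NK) + 2 * prb (iid n Q) (atyp d \<delta>)"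
proof -
  define A where "A = {(u, t). t \<in> seqs n \<and> (\<Sum>i<n. idens VT1 pT1 (u i) (t i)) \<le> real n * (IT + \<delta>)}"
  have "expec books cov_tv
    \<le> sqrt (2 powr (real n * (IT + \<delta>)) / NK)
      + 2 * prb avg_law {(u, e, x). (u, case x of (s, x, y, z, t) \<Rightarrow> t) \<notin> A}"
  proof (rule expectation_cov_tv)
    fix u t assume u: "u \<in> set_pmf (iid n q)" and t: "(u, t) \<in> A"
    show "pmf (VT u) t \<le> 2 powr (real n * (IT + \<delta>)) * pmf pT t"
      unfolding pT_iid VT_prod
      by (rule prod_pmf_idens_le) (use u t in \<open>auto simp: A_def iid_def set_prod_pmf pT1_def\<close>)
  qed simp
  also have "prb avg_law {(u, e, x). (u, case x of (s, x, y, z, t) \<Rightarrow> t) \<notin> A}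
     \<le> prb (iid n Q) (atyp d \<delta>)"
    by (rule prob_avg_le_atyp) (auto simp: A_def dest: not_atyp(4)[OF n] avg_law_support(4))
  finally show ?thesis by simp
qed

text \<open>The union bound over competitors would also charge for confusing two values of
  \<open>l\<close>. With one message that confusion is harmless and the decoder cannot err, which
  permits a rate of \<open>l\<close> above I(U;Y).\<close>

lemma expectation_decoding_error_le:
  assumes n: "n > 0"
  shows "expec books
      (\<lambda>C. prb (ideal C) (wrong \<delta> C))
    \<le> (if card M = 1 then 0 else real (card M) * real (card L) / 2 powr (real n * (IY - \<delta>)))
      + prb (iid n Q) (atyp d \<delta>)"
proof (cases "card M = 1")
  case True
  then obtain m0 where m0: "M = {m0}" by (rule card_1_singletonE)
  have "prb (ideal C) (wrong \<delta> C) = 0" for C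
  proof -
    have "m = dec (dec_set \<delta>) C y \<gamma>" if "((m, \<gamma>, l), w) \<in> set_pmf (ideal C)" for m \<gamma> l w y
    proof -
      have "m \<in> M" using that idx by (auto simp: ideal_def idx_def)
      then show ?thesis using dec_in[of "dec_set \<delta>" C y \<gamma>] m0 by simp
    qed
    then show ?thesis by (subst measure_pmf_zero_iff) fastforce
  qed
  then show ?thesis using True by simp
next
  case False
  have eq: "wrong \<delta> C
     = {((m, \<gamma>, l), e, x). m \<noteq> dec (dec_set \<delta>) C (case x of (s, x, y, z, t) \<Rightarrow> y) \<gamma>}" for C by auto
  have "expec books
      (\<lambda>C. prb (ideal C) {((m, \<gamma>, l), e, x). m \<noteq> dec (dec_set \<delta>) C (case x of (s, x, y, z, t) \<Rightarrow> y) \<gamma>})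
    \<le> prb avg_law {(u, e, x). (u, case x of (s, x, y, z, t) \<Rightarrow> y) \<notin> dec_set \<delta>}
       + real (card M) * real (card L) / 2 powr (real n * (IY - \<delta>))"
  proof (rule expectation_decoding_error)
    fix u y assume u: "u \<in> set_pmf (iid n q)" and y: "(u, y) \<in> dec_set \<delta>"
    have "pmf (prod_pmf n (\<lambda>i. VY1 (u i))) y = 2 powr (\<Sum>i<n. idens VY1 (bind_pmf q VY1) (u i) (y i)) * pmf (iid n (bind_pmf q VY1)) y"
      by (rule prod_pmf_idens) (use u y in \<open>auto simp: dec_set_def iid_def set_prod_pmf set_pmf_iff\<close>)
    moreover have "2 powr (real n * (IY - \<delta>)) * pmf (iid n (bind_pmf q VY1)) y
       \<le> 2 powr (\<Sum>i<n. idens VY1 (bind_pmf q VY1) (u i) (y i)) * pmf (iid n (bind_pmf q VY1)) y"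
      using y by (intro mult_right_mono) (auto simp: dec_set_def pY1_def)
    ultimately show "2 powr (real n * (IY - \<delta>)) * pmf pY y \<le> pmf (VY u) y"
      unfolding VY_prod pY_iid by simp
  qed simp
  also have "prb avg_law {(u, e, x). (u, case x of (s, x, y, z, t) \<Rightarrow> y) \<notin> dec_set \<delta>}
     \<le> prb (iid n Q) (atyp d \<delta>)"
    by (rule prob_avg_le_atyp) (auto simp: dec_set_def dest: not_atyp(2)[OF n] avg_law_support(2,3))
  finally show ?thesis unfolding eq if_not_P[OF False] by linarith
qed

lemma expectation_atypical_le:
  assumes n: "n > 0"
  shows "expec books (\<lambda>C. prb (ideal C) (atypical d \<delta> C))
    \<le> prb (iid n Q) (atyp d \<delta>)"
proof -
  let ?B = "{(u, e, s, x, y, z, t). (u, y, t) \<notin> Typ \<delta> \<or> avg_dist d n s t > expec Q (\<phi>D d) + \<delta>}"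
  have "atypical d \<delta> C
     = {(i, e, x). (C i, e, x) \<in> ?B}" for C :: "nat \<times> nat \<times> nat \<Rightarrow> nat \<Rightarrow> nat" by auto
  then have "expec books (\<lambda>C. prb (ideal C) (atypical d \<delta> C))
     = prb avg_law ?B"
    using expectation_ideal[of ?B] by simp
  also have "\<dots> \<le> prb (iid n Q) (atyp d \<delta>)"
  proof (rule prob_avg_le_atyp)
    fix u e s x y z t assume w: "(u, e, s, x, y, z, t) \<in> set_pmf avg_law" and na: "zipQ (u, e, s, x, y, z, t) \<notin> atyp d \<delta>"
    show "(u, e, s, x, y, z, t) \<notin> ?B"
      using not_atyp[OF n na] avg_law_support[OF w] by (auto simp: Typ_def not_less)
  qed
  finally show ?thesis .
qed

lemma expectation_leak_le:
  assumes r2: "r2 \<le> 0 \<or> rate_bound d n \<theta> \<delta> QTUY r2" and r1: "rate_bound d n \<theta> \<delta> QTY r1"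
  shows "expec books (leak (Typ \<delta>) (Near d \<theta>) (seqs n) N)
    \<le> real N * (2 powr (real n * (IY + \<delta>)) * (real n + 1) ^ card FUY * 2 powr (- real n * r2)
         * ln (real (card (seqs n :: (nat \<Rightarrow> 's) set))) / NK + 2 * ((real n + 1) ^ card FY * 2 powr (- real n * r1)))"
proof (rule expectation_leak)
  show "finite (seqs n :: (nat \<Rightarrow> 's) set)" by (rule finite_seqs)
  show "seqs n \<noteq> ({} :: (nat \<Rightarrow> 's) set)" by (auto simp: seqs_def)
  show "0 < 2 powr (real n * (IY + \<delta>)) * (real n + 1) ^ card FUY * 2 powr (- real n * r2)" by simp
next
  fix u y and t :: "nat \<Rightarrow> 's" assume u: "u \<in> set_pmf (iid n q)" and y: "y \<in> set_pmf pY"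
  have "y \<in> seqs n" using y set_prod_pmf_seqs unfolding pY_iid unfolding iid_def by blast
  from outp_hit_le[OF u this r2, of t]
  show "prb (outp u) {(e, x). (case x of (s, x, y, z, t) \<Rightarrow> y) = y \<and>
      (u, y, case x of (s, x, y, z, t) \<Rightarrow> t) \<in> Typ \<delta> \<and> (case x of (s, x, y, z, t) \<Rightarrow> t) \<in> Near d \<theta> t}
    \<le> 2 powr (real n * (IY + \<delta>)) * (real n + 1) ^ card FUY * 2 powr (- real n * r2) * pmf pY y"
    by (rule order_trans[OF eq_refl, rotated]) (rule arg_cong[where f="prb (outp u)"], auto)
next
  fix y and t :: "nat \<Rightarrow> 's" assume y: "y \<in> set_pmf pY"
  from avg_hit_le[OF this r1, of t]
  show "prb avg_law {(u, e, x). (case x of (s, x, y, z, t) \<Rightarrow> y) = y \<and>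
      (u, y, case x of (s, x, y, z, t) \<Rightarrow> t) \<in> Typ \<delta> \<and> (case x of (s, x, y, z, t) \<Rightarrow> t) \<in> Near d \<theta> t}
    \<le> (real n + 1) ^ card FY * 2 powr (- real n * r1) * pmf pY y"
    by (rule order_trans[OF eq_refl, rotated]) (rule arg_cong[where f="prb avg_law"], auto)
qed

abbreviation defect_bound where
  "defect_bound \<delta> r1 r2 N \<equiv>
      sqrt (2 powr (real n * (IE + \<delta>)) / real (card L)) + sqrt (2 powr (real n * (IT + \<delta>)) / NK)
      + (if card M = 1 then 0 else real (card M) * real (card L) / 2 powr (real n * (IY - \<delta>)))
      + real N * (2 powr (real n * (IY + \<delta>)) * (real n + 1) ^ card FUY * 2 powr (- real n * r2)
         * ln (real (card (seqs n :: (nat \<Rightarrow> 's) set))) / NK + 2 * ((real n + 1) ^ card FY * 2 powr (- real n * r1)))"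

text \<open>All failure modes are added up, so that one application of the mean yields a codebook
  that is good in every respect.\<close>

definition defect where
  "defect d \<delta> \<theta> N C = enc_tv C + cov_tv C
     + prb (ideal C) (wrong \<delta> C)
     + prb (ideal C) (atypical d \<delta> C)
     + leak (Typ \<delta>) (Near d \<theta>) (seqs n) N C"

text \<open>The factor 6 is 2 + 2 + 1 + 1: each of the two coverings pays twice for atypical
  outcomes, decoding and typicality once each.\<close>

lemma codebook_exists:
  assumes n: "n > 0" and r2: "r2 \<le> 0 \<or> rate_bound d n \<theta> \<delta> QTUY r2" and r1: "rate_bound d n \<theta> \<delta> QTY r1"
  shows "\<exists>C\<in>set_pmf books. defect d \<delta> \<theta> N C \<le>
      defect_bound \<delta> r1 r2 N
      + 6 * prb (iid n Q) (atyp d \<delta>)"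
proof -
  obtain C where C: "C \<in> set_pmf books" "defect d \<delta> \<theta> N C \<le> expec books (defect d \<delta> \<theta> N)"
    using exists_le_expectation[OF fin_books] by blast
  have "expec books (defect d \<delta> \<theta> N) =
    expec books enc_tv + expec books cov_tv
     + expec books (\<lambda>C. prb (ideal C) (wrong \<delta> C))
     + expec books (\<lambda>C. prb (ideal C) (atypical d \<delta> C))
     + expec books (leak (Typ \<delta>) (Near d \<theta>) (seqs n) N)"
    unfolding defect_def[abs_def] by (simp only: Bochner_Integration.integral_add intb Bochner_Integration.integrable_add)
  then show ?thesis
    using C expectation_enc_tv_le[OF n, of \<delta> d] expectation_cov_tv_le[OF n, of \<delta> d]
      expectation_decoding_error_le[OF n, of \<delta> d] expectation_atypical_le[OF n, of \<delta> d]
      expectation_leak_le[OF r2 r1, of N]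
    by (intro bexI[of _ C]) linarith+
qed

end

section \<open>The code and its performance\<close>

lemma avg_dist_restrict: "avg_dist d n s (restrict t {..<n}) = avg_dist d n s t"
  by (simp add: avg_dist_def)

lemma avg_dist_nonneg: "(\<And>a b. 0 \<le> d a b) \<Longrightarrow> 0 \<le> avg_dist d n s t"
  by (simp add: avg_dist_def sum_nonneg)

lemma avg_dist_le:
  assumes "\<And>a b. d a b \<le> B" "n > 0"
  shows "avg_dist d n s t \<le> B"
proof -
  have "(\<Sum>i<n. d (s i) (t i)) \<le> real (card {..<n}) * B" by (rule sum_bounded_above) (rule assms)
  then show ?thesis using assms(2) by (simp add: avg_dist_def divide_le_eq mult.commute)
qed

definition good_code where
  "good_code P W d RE n R Rc \<epsilon> D DE c \<longleftrightarrow> is_code n R Rc c \<and>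
     prb (code_law P W n R Rc c) {(m, \<gamma>, se, s, x, y, z, sh). m \<noteq> decoder c y \<gamma>} \<le> \<epsilon> \<and>
     map_pmf (\<lambda>(m, \<gamma>, se, s, x, y, z, sh). sh) (code_law P W n R Rc c) = iid n (map_pmf snd P) \<and>
     expec (code_law P W n R Rc c) (\<lambda>(m, \<gamma>, se, s, x, y, z, sh). avg_dist d n s sh) \<le> D \<and>
     secure_against_henchman P W d RE n R Rc c DE"

lemma achievable_good_code:
  "achievable P W d RE D DE R Rc \<longleftrightarrow> R \<ge> 0 \<and> Rc \<ge> 0 \<and>
     (\<forall>\<epsilon>>0. \<forall>\<^sub>F n in sequentially. \<exists>c. good_code P W d RE n R Rc \<epsilon> D DE c)"
  unfolding achievable_def good_code_def ..

section \<open>The code obtained from a codebook\<close>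

context n_letter
begin

text \<open>The index \<open>l\<close> stays inside the encoder. The estimator applies the
  single-letter kernel letterwise and then repairs its output by \<open>\<kappa>\<close>, which sees
  nothing but that output.\<close>

definition rand_code ::
  "(nat \<times> nat \<times> nat \<Rightarrow> nat \<Rightarrow> nat) \<Rightarrow> real \<Rightarrow> ((nat \<Rightarrow> 's) \<Rightarrow> (nat \<Rightarrow> 's) pmf) \<Rightarrow> ('e, 's, 'x, 'y, 'z) ca_code"
where
  "rand_code C \<delta> \<kappa> = \<lparr>
     encoder = \<lambda>m e \<gamma>. do { l \<leftarrow> lik C m \<gamma> e; prod_pmf n (\<lambda>i. PX (C (m, \<gamma>, l) i) (e i)) },
     decoder = dec (dec_set \<delta>) C,
     estimator = \<lambda>\<gamma> x e z. do { t \<leftarrow> prod_pmf n (\<lambda>i. PT (x i) (e i) (z i)); \<kappa> t } \<rparr>"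

lemma split_iid_P:
  "map_pmf (\<lambda>es. (\<lambda>i\<in>{..<n}. fst (es i), \<lambda>i\<in>{..<n}. snd (es i))) (iid n P)
   = do { e \<leftarrow> pE; s \<leftarrow> prod_pmf n (\<lambda>i. PS (e i)); return_pmf (e, s) }"
proof -
  have "iid n P = do { e \<leftarrow> pE; s \<leftarrow> prod_pmf n (\<lambda>i. PS (e i)); return_pmf (\<lambda>i\<in>{..<n}. (e i, s i)) }"
    unfolding pE_iid unfolding iid_def by (subst PS) (simp only: prod_pmf_bind prod_pmf_return)
  then have "map_pmf (\<lambda>es. (\<lambda>i\<in>{..<n}. fst (es i), \<lambda>i\<in>{..<n}. snd (es i))) (iid n P)
     = do { e \<leftarrow> pE; s \<leftarrow> prod_pmf n (\<lambda>i. PS (e i)); return_pmf (\<lambda>i\<in>{..<n}. e i, \<lambda>i\<in>{..<n}. s i) }"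
    by (simp add: map_bind_pmf cong: restrict_cong)
  also have "\<dots> = do { e \<leftarrow> pE; s \<leftarrow> prod_pmf n (\<lambda>i. PS (e i)); return_pmf (e, s) }"
    unfolding pE_iid unfolding iid_def by (intro bind_pmf_cong refl) (simp add: restrict_prod_pmf)
  finally show ?thesis .
qed

lemma code_law_rand_code:
  assumes M: "M = index_set n R" and G: "G = index_set n Rc"
  shows "code_law P W n R Rc (rand_code C \<delta> \<kappa>) =
    do { ((m, \<gamma>, l), e, s, x, y, z, t) \<leftarrow> actual C; t' \<leftarrow> \<kappa> t; return_pmf (m, \<gamma>, e, s, x, y, z, t') }"
proof -
  define fin where "fin m \<gamma> e s x = do { yz \<leftarrow> prod_pmf n (\<lambda>i. W (x i) (s i));
     let y = (\<lambda>i\<in>{..<n}. fst (yz i)); z = (\<lambda>i\<in>{..<n}. snd (yz i)) in do {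
     t \<leftarrow> prod_pmf n (\<lambda>i. PT (x i) (e i) (z i)); t' \<leftarrow> \<kappa> t; return_pmf (m, \<gamma>, e, s, x, y, z, t') } }"
    for m \<gamma> :: nat and e s x
  have "code_law P W n R Rc (rand_code C \<delta> \<kappa>) = do { m \<leftarrow> pmf_of_set M; \<gamma> \<leftarrow> pmf_of_set G;
     (e, s) \<leftarrow> map_pmf (\<lambda>es. (\<lambda>i\<in>{..<n}. fst (es i), \<lambda>i\<in>{..<n}. snd (es i))) (iid n P);
     l \<leftarrow> lik C m \<gamma> e; x \<leftarrow> prod_pmf n (\<lambda>i. PX (C (m, \<gamma>, l) i) (e i)); fin m \<gamma> e s x }"
    unfolding code_law_def M[symmetric] G[symmetric] bind_map_pmf
    by (simp add: rand_code_def fin_def[abs_def] Let_def bind_assoc_pmf del: restrict_apply)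
  also have "\<dots> = do { m \<leftarrow> pmf_of_set M; \<gamma> \<leftarrow> pmf_of_set G; e \<leftarrow> pE; s \<leftarrow> prod_pmf n (\<lambda>i. PS (e i));
     l \<leftarrow> lik C m \<gamma> e; x \<leftarrow> prod_pmf n (\<lambda>i. PX (C (m, \<gamma>, l) i) (e i)); fin m \<gamma> e s x }"
    unfolding split_iid_P by (simp add: bind_assoc_pmf bind_return_pmf)
  \<comment> \<open>The state and the index \<open>l\<close> are both drawn given \<open>e\<close>
    without reference to each other, so their order is immaterial.\<close>
  also have "\<dots> = do { m \<leftarrow> pmf_of_set M; \<gamma> \<leftarrow> pmf_of_set G; e \<leftarrow> pE; l \<leftarrow> lik C m \<gamma> e;
     s \<leftarrow> prod_pmf n (\<lambda>i. PS (e i)); x \<leftarrow> prod_pmf n (\<lambda>i. PX (C (m, \<gamma>, l) i) (e i)); fin m \<gamma> e s x }"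
    by (intro bind_pmf_cong refl bind_commute_pmf)
  also have "\<dots> = do { ((m, \<gamma>, l), e, s, x, y, z, t) \<leftarrow> actual C; t' \<leftarrow> \<kappa> t; return_pmf (m, \<gamma>, e, s, x, y, z, t') }"
    by (simp add: actual_def Kern_def fin_def[abs_def] Let_def bind_assoc_pmf bind_return_pmf)
  finally show ?thesis .
qed

lemma is_code_rand_code:
  assumes M: "M = index_set n R" and G: "G = index_set n Rc"
    and \<kappa>: "\<And>t. t \<in> seqs n \<Longrightarrow> set_pmf (\<kappa> t) \<subseteq> seqs n"
  shows "is_code n R Rc (rand_code C \<delta> \<kappa>)"
  unfolding is_code_def
proof (intro conjI ballI)
  fix m e \<gamma>
  show "set_pmf (encoder (rand_code C \<delta> \<kappa>) m e \<gamma>) \<subseteq> seqs n"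
    using set_prod_pmf_seqs by (auto simp: rand_code_def)
next
  fix y \<gamma> show "decoder (rand_code C \<delta> \<kappa>) y \<gamma> \<in> index_set n R"
    using dec_in[of "dec_set \<delta>" C y \<gamma>] by (simp add: rand_code_def M[symmetric])
next
  fix \<gamma> x e z
  show "set_pmf (estimator (rand_code C \<delta> \<kappa>) \<gamma> x e z) \<subseteq> seqs n"
    using set_prod_pmf_seqs \<kappa> by (fastforce simp: rand_code_def)
qed

lemma leak_nonneg: "0 \<le> leak Ty (Near d \<theta>) (seqs n) N C"
proof -
  have "0 \<le> Max (hit_mass Ty (Near d \<theta>) C y ` seqs n)" for y
  proof -
    have "seqs n \<noteq> ({} :: (nat \<Rightarrow> 's) set)" by (auto simp: seqs_def)
    then have "Max (hit_mass Ty (Near d \<theta>) C y ` seqs n) \<in> hit_mass Ty (Near d \<theta>) C y ` seqs n"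
      by (intro Max_in) (auto simp: finite_seqs)
    then show ?thesis by (auto simp: hit_mass_def intro!: sum_nonneg)
  qed
  then show ?thesis by (auto simp: leak_def intro!: divide_nonneg_nonneg mult_nonneg_nonneg sum_nonneg)
qed

lemma enc_cov_tv_nonneg: "0 \<le> enc_tv C" "0 \<le> cov_tv C"
  by (auto simp: enc_tv_def cov_tv_def intro!: divide_nonneg_nonneg sum_nonneg)

lemma prob_actual_list_hit_le:
  assumes C: "C \<in> set_pmf books" and g: "\<And>y k. g y k \<in> seqs n" and Ks: "finite Ks"
  shows "prb (actual C) {(i, e, s, x, y, z, t). \<exists>k\<in>Ks. avg_dist d n t (g y k) \<le> \<theta>}
    \<le> enc_tv C + leak (Typ \<delta>) (Near d \<theta>) (seqs n) (card Ks) C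
      + prb (ideal C) (atypical d \<delta> C)"
proof -
  let ?A = "{(i, e, s, x, y, z, t). \<exists>k\<in>Ks. avg_dist d n t (g y k) \<le> \<theta>}"
  let ?H = "{(i, e, x). (\<exists>k\<in>Ks. (case x of (s, x, y, z, t) \<Rightarrow> t) \<in> Near d \<theta> (g (case x of (s, x, y, z, t) \<Rightarrow> y) k)) \<and>
     (C i, case x of (s, x, y, z, t) \<Rightarrow> y, case x of (s, x, y, z, t) \<Rightarrow> t) \<in> Typ \<delta>}"
  let ?B = "atypical d \<delta> C"
  have "prb (actual C) ?A \<le> prb (ideal C) ?A + enc_tv C" by (rule prob_actual_le[OF C])
  also have "prb (ideal C) ?A \<le> prb (ideal C) (?H \<union> ?B)"
    by (rule measure_pmf.finite_measure_mono) (auto simp: Near_def)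
  also have "\<dots> \<le> prb (ideal C) ?H + prb (ideal C) ?B"
    by (rule measure_Un_le) auto
  also have "prb (ideal C) ?H \<le> leak (Typ \<delta>) (Near d \<theta>) (seqs n) (card Ks) C"
    by (rule prob_list_hit_le[OF C finite_seqs g Ks])
  finally show ?thesis by linarith
qed

text \<open>The alternative \<open>DE \<le> 0\<close> covers a slack larger than the target, where
  nonnegativity of the distortion is enough.\<close>

lemma rand_code_performance:
  fixes d :: "'s \<Rightarrow> 's \<Rightarrow> real"
  assumes C: "C \<in> set_pmf books" and n: "n > 0" and \<delta>: "\<delta> \<ge> 0"
    and M: "M = index_set n R" and G: "G = index_set n Rc" and N: "N = card (index_set n RE)"
    and finE: "finite (index_set n RE)"
    and marginal: "pT1 = map_pmf snd P" and d: "\<And>a b. 0 \<le> d a b" "\<And>a b. d a b \<le> dmax"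
    and defect: "defect d \<delta> \<theta> N C \<le> \<epsilon>"
    and \<epsilon>1: "\<epsilon> \<le> \<epsilon>1" and D1: "expec Q (\<phi>D d) + \<delta> + dmax * (2 * \<epsilon>) \<le> D1"
    and DE: "DE \<le> 0 \<or> DE \<le> \<theta> * (1 - 2 * \<epsilon>) \<and> 0 \<le> \<theta>"
  shows "\<exists>c. good_code P W d RE n R Rc \<epsilon>1 D1 DE c"
proof -
  define bad where "bad = {(i :: nat \<times> nat \<times> nat, e :: nat \<Rightarrow> 'e, s, x :: nat \<Rightarrow> 'x, y, z :: nat \<Rightarrow> 'z, t).
    (C i, y, t) \<notin> Typ \<delta> \<or> avg_dist d n s t > expec Q (\<phi>D d) + \<delta>}"
  define tv where "tv = enc_tv C + cov_tv C"
  define b where "b = prb (ideal C) bad"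
  define lk where "lk = leak (Typ \<delta>) (Near d \<theta>) (seqs n) N C"
  define er where "er = prb (ideal C) (wrong \<delta> C)"
  have tot: "tv + er + b + lk \<le> \<epsilon>" using defect unfolding defect_def tv_def b_def lk_def er_def bad_def .
  have nn: "0 \<le> enc_tv C" "0 \<le> cov_tv C" "0 \<le> er" "0 \<le> b" "0 \<le> lk"
    using enc_cov_tv_nonneg leak_nonneg by (auto simp: er_def b_def lk_def)
  define \<mu> where "\<mu> = map_pmf (\<lambda>(i, e, s, x, y, z, t). t) (actual C)"
  have finA: "finite (set_pmf (actual C))"
  proof -
    have "finite (set_pmf (lik C m \<gamma> e))" for m \<gamma> e by (rule finite_subset[OF lik(2) L(1)])
    then show ?thesis unfolding actual_def using MGL fin_pE finite_Kern by auto
  qed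
  have "prb \<mu> A \<le> prb pT A + tv" for A
  proof -
    have "prb \<mu> A = prb (actual C) {(i, e, x). (case x of (s, x, y, z, t) \<Rightarrow> t) \<in> A}"
      unfolding \<mu>_def measure_map_pmf by (rule arg_cong[where f="prb (actual C)"]) auto
    also have "\<dots> \<le> prb (ideal C) {(i, e, x). (case x of (s, x, y, z, t) \<Rightarrow> t) \<in> A} + enc_tv C"
      by (rule prob_actual_le[OF C])
    also have "\<dots> \<le> prb pT A + cov_tv C + enc_tv C"
      using prob_ideal_T_le[OF C, of A] by simp
    finally show ?thesis by (simp add: tv_def)
  qed
  then obtain \<kappa> where \<kappa>: "bind_pmf \<mu> \<kappa> = pT" "\<And>t. set_pmf (\<kappa> t) \<subseteq> insert t (set_pmf pT)"
    "prb (do { t \<leftarrow> \<mu>; t' \<leftarrow> \<kappa> t; return_pmf (t, t') }) {(t, t'). t \<noteq> t'} \<le> tv"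
    using coupling_kernel[of \<mu> pT tv] finA fin_pT by (auto simp: \<mu>_def)
  define c where "c = rand_code C \<delta> \<kappa>"
  \<comment> \<open>This law keeps the reconstruction before and after the repair, so bounds on
    \<open>actual C\<close> transfer to the code except on the event \<open>ne\<close> that the two
    differ.\<close>
  define ext where "ext = do { (i, e, s, x, y, z, t) \<leftarrow> actual C; t' \<leftarrow> \<kappa> t; return_pmf ((i, e, s, x, y, z, t), t') }"
  define pr where "pr = (\<lambda>(((m :: nat, \<gamma> :: nat, l :: nat), e :: nat \<Rightarrow> 'e, s :: nat \<Rightarrow> 's, x :: nat \<Rightarrow> 'x, y :: nat \<Rightarrow> 'y, z :: nat \<Rightarrow> 'z, t :: nat \<Rightarrow> 's), t' :: nat \<Rightarrow> 's).
     (m, \<gamma>, e, s, x, y, z, t'))"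
  have law: "code_law P W n R Rc c = map_pmf pr ext"
    unfolding c_def code_law_rand_code[OF M G] ext_def pr_def
    by (simp add: map_bind_pmf case_prod_unfold)
  have fin_ext: "finite (set_pmf ext)"
  proof -
    have "finite (set_pmf (\<kappa> t))" for t using finite_subset[OF \<kappa>(2)] fin_pT by blast
    then show ?thesis unfolding ext_def using finA by (auto simp: case_prod_unfold)
  qed
  note inte = integrable_measure_pmf_finite[OF fin_ext]
  have fst_ext: "map_pmf fst ext = actual C"
    unfolding ext_def by (simp add: map_bind_pmf case_prod_unfold bind_return_pmf')
  have prob_fst: "prb ext {(w, t'). w \<in> A} = prb (actual C) A" for A
    unfolding fst_ext[symmetric] measure_map_pmf by (rule arg_cong[where f="prb ext"]) auto
  define ne where "ne = {((i :: nat \<times> nat \<times> nat, e :: nat \<Rightarrow> 'e, s :: nat \<Rightarrow> 's, x :: nat \<Rightarrow> 'x, y :: nat \<Rightarrow> 'y, z :: nat \<Rightarrow> 'z, t), t' :: nat \<Rightarrow> 's). t \<noteq> t'}"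
  have pne: "prb ext ne \<le> tv"
  proof -
    have "do { t \<leftarrow> \<mu>; t' \<leftarrow> \<kappa> t; return_pmf (t, t') } = map_pmf (\<lambda>((i, e, s, x, y, z, t), t'). (t, t')) ext"
      unfolding \<mu>_def ext_def by (simp add: map_bind_pmf bind_map_pmf case_prod_unfold)
    then have "prb (do { t \<leftarrow> \<mu>; t' \<leftarrow> \<kappa> t; return_pmf (t, t') }) {(t, t'). t \<noteq> t'}
      = prb ext ((\<lambda>((i, e, s, x, y, z, t), t'). (t, t')) -` {(t, t'). t \<noteq> t'})"
      by (simp only: measure_map_pmf)
    also have "(\<lambda>((i, e, s, x, y, z, t), t'). (t, t')) -` {(t, t'). t \<noteq> t'} = ne" by (auto simp: ne_def)
    finally show ?thesis using \<kappa>(3) by simp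
  qed
  have "is_code n R Rc c"
    unfolding c_def
  proof (rule is_code_rand_code[OF M G])
    fix t :: "nat \<Rightarrow> 's" assume "t \<in> seqs n"
    moreover have "set_pmf pT \<subseteq> seqs n" unfolding pT_iid unfolding iid_def by (rule set_prod_pmf_seqs)
    ultimately show "set_pmf (\<kappa> t) \<subseteq> seqs n" using \<kappa>(2)[of t] by blast
  qed
  moreover have "prb (code_law P W n R Rc c) {(m, \<gamma>, se, s, x, y, z, sh). m \<noteq> decoder c y \<gamma>} \<le> \<epsilon>1"
  proof -
    let ?A = "wrong \<delta> C"
    have "prb (code_law P W n R Rc c) {(m, \<gamma>, se, s, x, y, z, sh). m \<noteq> decoder c y \<gamma>}
      = prb ext {(w, t'). w \<in> ?A}"
      unfolding law measure_map_pmf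
      by (rule arg_cong[where f="prb ext"]) (auto simp: pr_def c_def rand_code_def)
    also have "\<dots> = prb (actual C) ?A" by (rule prob_fst)
    also have "\<dots> \<le> er + enc_tv C" unfolding er_def by (rule prob_actual_le[OF C])
    finally show ?thesis using tot nn \<epsilon>1 by (simp add: tv_def)
  qed
  moreover have "map_pmf (\<lambda>(m, \<gamma>, se, s, x, y, z, sh). sh) (code_law P W n R Rc c) = iid n (map_pmf snd P)"
  proof -
    have "map_pmf (\<lambda>(m, \<gamma>, se, s, x, y, z, sh). sh) (code_law P W n R Rc c) = map_pmf snd ext"
      unfolding law map_pmf_comp by (rule map_pmf_cong) (auto simp: pr_def)
    also have "\<dots> = bind_pmf \<mu> \<kappa>"
      unfolding ext_def \<mu>_def by (simp add: map_bind_pmf bind_map_pmf case_prod_unfold bind_return_pmf')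
    finally show ?thesis unfolding \<kappa>(1) pT_iid pT1_def[symmetric] marginal .
  qed
  moreover have "expec (code_law P W n R Rc c) (\<lambda>(m, \<gamma>, se, s, x, y, z, sh). avg_dist d n s sh) \<le> D1"
  proof -
    let ?D = "expec Q (\<phi>D d) + \<delta>"
    have "0 \<le> dmax" using d order_trans by blast
    have "0 \<le> expec Q (\<phi>D d)" 
      by (intro Bochner_Integration.integral_nonneg) (auto simp: \<phi>D_def d)
    then have "0 \<le> ?D" using \<delta> by simp
    \<comment> \<open>Distortion is at most \<open>?D\<close> unless the repair acts or the outcome
      is atypical, and then it is at most \<open>dmax\<close>.\<close>
    let ?f = "\<lambda>w. ?D + dmax * indicator ne w + dmax * indicator {(w, t'). w \<in> bad} w"
    have "expec (code_law P W n R Rc c) (\<lambda>(m, \<gamma>, se, s, x, y, z, sh). avg_dist d n s sh)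
      = expec ext (\<lambda>w. (\<lambda>(m, \<gamma>, se, s, x, y, z, sh). avg_dist d n s sh) (pr w))"
      unfolding law by (rule integral_map_pmf)
    also have "\<dots> \<le> expec ext ?f"
    proof (intro integral_mono inte)
      fix w :: "((nat \<times> nat \<times> nat) \<times> (nat \<Rightarrow> 'e) \<times> (nat \<Rightarrow> 's) \<times> (nat \<Rightarrow> 'x) \<times> (nat \<Rightarrow> 'y) \<times> (nat \<Rightarrow> 'z) \<times> (nat \<Rightarrow> 's)) \<times> (nat \<Rightarrow> 's)"
      obtain m \<gamma> l e s x y z t t' where w: "w = (((m, \<gamma>, l), e, s, x, y, z, t), t')" by (metis surj_pair)
      have le: "avg_dist d n s t' \<le> dmax" by (rule avg_dist_le) (use d n in auto)
      show "(\<lambda>(m, \<gamma>, se, s, x, y, z, sh). avg_dist d n s sh) (pr w) \<le> ?f w"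
      proof (cases "w \<in> ne \<or> w \<in> {(w, t'). w \<in> bad}")
        case True
        then have "dmax \<le> dmax * indicator ne w + dmax * indicator {(w, t'). w \<in> bad} w"
          using \<open>0 \<le> dmax\<close> by (auto simp: indicator_def)
        then show ?thesis using le \<open>0 \<le> ?D\<close> by (simp add: w pr_def)
      next
        case False
        then have "t = t'" "avg_dist d n s t \<le> ?D" by (auto simp: w ne_def bad_def not_less)
        then show ?thesis using \<open>0 \<le> dmax\<close> by (auto simp: w pr_def intro!: add_increasing2)
      qed
    qed
    also have "\<dots> = ?D + dmax * prb ext ne + dmax * prb ext {(w, t'). w \<in> bad}"
      by (simp add: inte)
    also have "\<dots> \<le> ?D + dmax * tv + dmax * (b + enc_tv C)"
      using pne prob_fst[of bad] prob_actual_le[OF C, of bad] \<open>0 \<le> dmax\<close>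
      by (intro add_mono mult_left_mono) (auto simp: b_def)
    also have "\<dots> = ?D + dmax * (tv + (b + enc_tv C))" by (simp add: algebra_simps)
    \<comment> \<open>\<open>enc_tv C\<close> occurs twice, in \<open>tv\<close> for the repair and
      again for the passage from the ideal to the actual law; doubling \<open>\<epsilon>\<close>
      covers this.\<close>
    also have "\<dots> \<le> ?D + dmax * (2 * \<epsilon>)"
      using tot nn \<open>0 \<le> dmax\<close> by (intro add_left_mono mult_left_mono) (auto simp: tv_def)
    finally show ?thesis using D1 by linarith
  qed
  moreover have "secure_against_henchman P W d RE n R Rc c DE"
    unfolding secure_against_henchman_def
  proof (intro allI impI)
    fix fE :: "(nat \<Rightarrow> 's) \<Rightarrow> (nat \<Rightarrow> 'y) \<Rightarrow> nat \<Rightarrow> nat" and gE :: "(nat \<Rightarrow> 'y) \<Rightarrow> nat \<Rightarrow> nat \<Rightarrow> 's"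
    assume fE: "\<forall>sh y \<gamma>. fE sh y \<gamma> \<in> index_set n RE"
    let ?E = "expec (code_law P W n R Rc c) (\<lambda>(m, \<gamma>, se, s, x, y, z, sh). avg_dist d n sh (gE y (fE sh y \<gamma>)))"
    have E0: "0 \<le> ?E" 
      by (intro Bochner_Integration.integral_nonneg) (auto intro!: avg_dist_nonneg d)
    show "DE \<le> ?E"
    proof (cases "DE \<le> 0")
      case False
      then have DE: "DE \<le> \<theta> * (1 - 2 * \<epsilon>)" "0 \<le> \<theta>" using DE by auto
      \<comment> \<open>The eavesdropper's output need not be extensional. Restricting it leaves the
        distortion unchanged and puts it among the targets in \<open>seqs n\<close>.\<close>
      define g where "g y k = restrict (gE y k) {..<n}" for y k
      have g: "g y k \<in> seqs n" for y k by (simp add: g_def seqs_def)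
      let ?H = "{(i, e, s, x, y, z, t). \<exists>k\<in>index_set n RE. avg_dist d n t (g y k) \<le> \<theta>}"
      \<comment> \<open>A Markov-type lower bound: off the two exceptional events the distortion
        exceeds \<open>\<theta>\<close>, and on them the expression is at most zero.\<close>
      let ?f = "\<lambda>w. \<theta> * (1 - indicator ne w - indicator {(w, t'). w \<in> ?H} w)"
      have pH: "prb ext {(w, t'). w \<in> ?H} \<le> enc_tv C + lk + b"
        unfolding prob_fst lk_def N b_def bad_def by (rule prob_actual_list_hit_le[OF C g finE])
      have "\<theta> * (1 - 2 * \<epsilon>) \<le> \<theta> * (1 - prb ext ne - prb ext {(w, t'). w \<in> ?H})"
        using pne pH tot nn DE(2) by (intro mult_left_mono) (auto simp: tv_def)
      also have "\<dots> = expec ext ?f"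
        by (simp add: inte)
      also have "\<dots> \<le> expec ext (\<lambda>w. (\<lambda>(m, \<gamma>, se, s, x, y, z, sh). avg_dist d n sh (gE y (fE sh y \<gamma>))) (pr w))"
      proof (intro integral_mono inte)
        fix w :: "((nat \<times> nat \<times> nat) \<times> (nat \<Rightarrow> 'e) \<times> (nat \<Rightarrow> 's) \<times> (nat \<Rightarrow> 'x) \<times> (nat \<Rightarrow> 'y) \<times> (nat \<Rightarrow> 'z) \<times> (nat \<Rightarrow> 's)) \<times> (nat \<Rightarrow> 's)"
        obtain m \<gamma> l e s x y z t t' where w: "w = (((m, \<gamma>, l), e, s, x, y, z, t), t')" by (metis surj_pair)
        have val: "(\<lambda>(m, \<gamma>, se, s, x, y, z, sh). avg_dist d n sh (gE y (fE sh y \<gamma>))) (pr w)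
           = avg_dist d n t' (g y (fE t' y \<gamma>))"
          by (simp add: w pr_def g_def avg_dist_restrict)
        show "?f w \<le> (\<lambda>(m, \<gamma>, se, s, x, y, z, sh). avg_dist d n sh (gE y (fE sh y \<gamma>))) (pr w)"
        proof (cases "w \<in> ne \<or> w \<in> {(w, t'). w \<in> ?H}")
          case True
          then have "1 - indicator ne w - indicator {(w, t'). w \<in> ?H} w \<le> (0::real)"
            by (auto simp: indicator_def)
          then have "?f w \<le> 0" using DE(2) by (rule mult_nonneg_nonpos[rotated])
          also have "0 \<le> avg_dist d n t' (g y (fE t' y \<gamma>))" by (rule avg_dist_nonneg) (rule d)
          finally show ?thesis unfolding val .
        next
          case False
          then have "t = t'" "\<not> avg_dist d n t (g y (fE t' y \<gamma>)) \<le> \<theta>"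
            using fE by (auto simp: w ne_def)
          then show ?thesis unfolding val using False by simp
        qed
      qed
      also have "\<dots> = ?E" unfolding law by (rule integral_map_pmf[symmetric])
      finally show ?thesis using DE by linarith
    qed (use E0 in linarith)
  qed
  ultimately show ?thesis unfolding good_code_def by blast
qed

end

section \<open>Sizes of index sets and exponents\<close>

lemma index_set_card:
  assumes "r \<ge> 0"
  shows "finite (index_set n r)" "index_set n r \<noteq> {}"
    "2 powr (real n * r) / 2 \<le> real (card (index_set n r))" "real (card (index_set n r)) \<le> 2 powr (real n * r)"
proof -
  define a where "a = 2 powr (real n * r)"
  have a: "a \<ge> 1" unfolding a_def using assms by (intro ge_one_powr_ge_zero) auto
  have eq: "index_set n r = {1..nat \<lfloor>a\<rfloor>}"
    using a by (auto simp: index_set_def a_def[symmetric] le_nat_floor le_nat_iff le_floor_iff)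
  show "finite (index_set n r)" by (simp add: eq)
  have "1 \<le> \<lfloor>a\<rfloor>" using a by simp
  then have "1 \<le> nat \<lfloor>a\<rfloor>" by linarith
  then show "index_set n r \<noteq> {}" by (auto simp: eq)
  have c: "real (card (index_set n r)) = real_of_int \<lfloor>a\<rfloor>" using a by (simp add: eq)
  show "real (card (index_set n r)) \<le> 2 powr (real n * r)" unfolding c a_def by simp
  show "2 powr (real n * r) / 2 \<le> real (card (index_set n r))"
    unfolding c a_def[symmetric] using a \<open>1 \<le> \<lfloor>a\<rfloor>\<close> by linarith
qed

lemma poly_exp_tendsto_0:
  fixes x :: real assumes "x > 0"
  shows "(\<lambda>n. (real n + 1) ^ k * 2 powr (- real n * x)) \<longlonglongrightarrow> 0"
  using assms by real_asymp

text \<open>The constant \<open>c\<close> absorbs rounding: each index set loses at most a factor 2,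
  so \<open>c\<close> is 2 for \<open>L\<close> and 8 for the whole codebook.\<close>

lemma sqrt_div_le:
  assumes A: "A \<le> 2 powr \<alpha>" "0 \<le> A" and B: "2 powr \<beta> / c \<le> B" and c: "1 \<le> c"
  shows "sqrt (A / B) \<le> c * 2 powr ((\<alpha> - \<beta>) / 2)"
proof -
  have "0 < 2 powr \<beta> / c" using c by simp
  then have "A / B \<le> 2 powr \<alpha> / (2 powr \<beta> / c)" using A B by (intro frac_le) auto
  also have "\<dots> = c * 2 powr (\<alpha> - \<beta>)" using c by (simp add: powr_diff)
  \<comment> \<open>Giving away another factor \<open>c\<close> produces a perfect square.\<close>
  also have "\<dots> \<le> c\<^sup>2 * 2 powr (\<alpha> - \<beta>)" using c by (intro mult_right_mono) (auto simp: power2_eq_square)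
  also have "\<dots> = (c * 2 powr ((\<alpha> - \<beta>) / 2))\<^sup>2"
    by (simp add: power_mult_distrib power2_eq_square[of "2 powr _"] powr_add[symmetric])
  finally have "sqrt (A / B) \<le> sqrt ((c * 2 powr ((\<alpha> - \<beta>) / 2))\<^sup>2)" by (rule real_sqrt_le_mono)
  then show ?thesis using c by simp
qed

text \<open>Applied to \<open>U\<close> and the side information, this makes the rate chosen for
  \<open>l\<close> nonnegative.\<close>

lemma mutual_info_nonneg:
  fixes A :: "'w \<Rightarrow> 'a::countable" and B :: "'w \<Rightarrow> 'b::countable"
  assumes fin: "finite (set_pmf Q)"
  shows "0 \<le> mutual_info Q A B"
proof -
  interpret sigma_finite_measure "count_space (UNIV :: ('a \<times> 'b) set)"
    by (rule sigma_finite_measure_count_space)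
  define p where "p = pair_pmf (map_pmf A Q) (map_pmf B Q)"
  define j where "j = map_pmf (\<lambda>w. (A w, B w)) Q"
  have ac: "set_pmf j \<subseteq> set_pmf p" by (auto simp: p_def j_def)
  have finj: "finite (set_pmf j)" using fin by (simp add: j_def)
  have "0 \<le> KL_divergence 2 (density (count_space UNIV) (pmf p)) (density (count_space UNIV) (pmf j))"
  proof (rule KL_density_density_nonneg)
    show "prob_space (density (count_space UNIV) (pmf p))" "prob_space (density (count_space UNIV) (pmf j))"
      unfolding measure_pmf_eq_density[symmetric] by unfold_locales
    show "integrable (count_space UNIV) (\<lambda>x. pmf j x * log 2 (pmf j x / pmf p x))"
      using integrable_measure_pmf_finite[OF finj, of "\<lambda>x. log 2 (pmf j x / pmf p x)"]
      unfolding measure_pmf_eq_density by (subst (asm) integrable_density) auto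
  qed (use ac in \<open>auto simp: AE_count_space set_pmf_iff\<close>)
  also have "\<dots> = expec j (\<lambda>x. log 2 (pmf j x / pmf p x))"
    unfolding measure_pmf_eq_density[symmetric] by (rule KL_divergence_pmf[OF finj ac])
  also have "\<dots> = mutual_info Q A B"
    unfolding mutual_info_eq[OF fin] by (simp add: j_def p_def pmf_pair)
  finally show ?thesis .
qed

context n_letter
begin

text \<open>Here 13 is 2 + 8 + 1 + 2 for the two coverings, decoding and the mean leakage; the
  logarithmic term is the leakage through a single codeword. The covering exponents need
  \<open>2 * x\<close> because of the square root. The extra power of \<open>real n + 1\<close> pays
  for \<open>ln (card (seqs n))\<close>.\<close>

lemma defect_bound_le:
  assumes n: "n > 0" and M: "M = index_set n R1" and G: "G = index_set n Rc1" and L: "L = index_set n R'"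
    and rates: "R1 \<ge> 0" "Rc1 \<ge> 0" "R' \<ge> 0" "RE \<ge> 0"
    and x: "x \<ge> 0" "IE + \<delta> - R' \<le> - 2 * x" "IT + \<delta> - (R1 + Rc1 + R') \<le> - 2 * x"
      "R1 = 0 \<or> R1 + R' - (IY - \<delta>) \<le> - x"
      "RE + (IY + \<delta>) - r2 - (R1 + Rc1 + R') \<le> - x" "RE - r1 \<le> - x"
    and K: "K \<ge> card FUY + 1" "K \<ge> card FY"
  shows "defect_bound \<delta> r1 r2 (card (index_set n RE))
      \<le> (13 + 8 * ln (real CARD('s))) * ((real n + 1) ^ K * 2 powr (- real n * x))"
proof -
  define g where "g = (real n + 1) ^ K * 2 powr (- real n * x)"
  define lnS where "lnS = ln (real CARD('s))"
  have lnS: "lnS \<ge> 0" unfolding lnS_def by (intro ln_ge_zero) (simp add: Suc_leI)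
  have mono: "2 powr (real n * a) \<le> 2 powr (- real n * x)" if "a \<le> - x" for a
    using mult_left_mono[OF that, of "real n"] by simp
  have pg: "c * 2 powr (real n * a) \<le> c * g" if "a \<le> - x" "0 \<le> c" for a c
  proof -
    have "2 powr (real n * a) \<le> 1 * 2 powr (- real n * x)" using mono[OF that(1)] by simp
    also have "\<dots> \<le> g" unfolding g_def by (intro mult_right_mono one_le_power) auto
    finally show ?thesis using that(2) by (rule mult_left_mono)
  qed
  note cM = index_set_card[OF rates(1), of n, folded M] and cG = index_set_card[OF rates(2), of n, folded G]
    and cL = index_set_card[OF rates(3), of n, folded L] and cE = index_set_card[OF rates(4), of n]
  have NKge: "2 powr (real n * (R1 + Rc1 + R')) / 8 \<le> NK"
  proof -
    have "2 powr (real n * (R1 + Rc1 + R')) / 8 = (2 powr (real n * R1) / 2) * (2 powr (real n * Rc1) / 2) * (2 powr (real n * R') / 2)"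
      by (simp add: powr_add distrib_left)
    also have "\<dots> \<le> real (card M) * real (card G) * real (card L)"
      using cM cG cL by (intro mult_mono) auto
    finally show ?thesis using NK(1) by simp
  qed
  have T1: "sqrt (2 powr (real n * (IE + \<delta>)) / real (card L)) \<le> 2 * g"
  proof -
    have "sqrt (2 powr (real n * (IE + \<delta>)) / real (card L)) \<le> 2 * 2 powr ((real n * (IE + \<delta>) - real n * R') / 2)"
      by (rule sqrt_div_le) (use cL in auto)
    also have "(real n * (IE + \<delta>) - real n * R') / 2 = real n * ((IE + \<delta> - R') / 2)" by (simp add: algebra_simps)
    also have "2 * 2 powr \<dots> \<le> 2 * g" using x by (intro pg) auto
    finally show ?thesis .
  qed
  have T2: "sqrt (2 powr (real n * (IT + \<delta>)) / NK) \<le> 8 * g"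
  proof -
    have "sqrt (2 powr (real n * (IT + \<delta>)) / NK) \<le> 8 * 2 powr ((real n * (IT + \<delta>) - real n * (R1 + Rc1 + R')) / 2)"
      by (rule sqrt_div_le) (use NKge in auto)
    also have "(real n * (IT + \<delta>) - real n * (R1 + Rc1 + R')) / 2 = real n * ((IT + \<delta> - (R1 + Rc1 + R')) / 2)"
      by (simp add: algebra_simps)
    also have "8 * 2 powr \<dots> \<le> 8 * g" using x by (intro pg) auto
    finally show ?thesis .
  qed
  have T3: "(if card M = 1 then 0 else real (card M) * real (card L) / 2 powr (real n * (IY - \<delta>))) \<le> 1 * g"
  proof (cases "card M = 1")
    case True then show ?thesis by (simp add: g_def)
  next
    case False
    \<comment> \<open>At rate zero the message set has exactly one element, which this case
      excludes.\<close>
    have "R1 \<noteq> 0"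
    proof
      assume "R1 = 0"
      then have "real (card M) \<le> 1" "card M > 0" using cM by (auto simp: card_gt_0_iff)
      then show False using False by simp
    qed
    have "real (card M) * real (card L) / 2 powr (real n * (IY - \<delta>))
       \<le> 2 powr (real n * R1) * 2 powr (real n * R') / 2 powr (real n * (IY - \<delta>))"
      using cM cL by (intro divide_right_mono mult_mono) auto
    also have "\<dots> = 1 * 2 powr (real n * (R1 + R' - (IY - \<delta>)))"
      by (simp add: powr_add[symmetric] powr_diff[symmetric] algebra_simps)
    also have "\<dots> \<le> 1 * g" using x(4) \<open>R1 \<noteq> 0\<close> by (intro pg) auto
    finally show ?thesis using False by simp
  qed
  have lnseqs: "ln (real (card (seqs n :: (nat \<Rightarrow> 's) set))) = real n * lnS"
    by (simp add: seqs_def card_PiE lnS_def ln_realpow)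
  have T4: "real (card (index_set n RE)) * (2 powr (real n * (IY + \<delta>)) * (real n + 1) ^ card FUY * 2 powr (- real n * r2)
         * ln (real (card (seqs n :: (nat \<Rightarrow> 's) set))) / NK) \<le> 8 * lnS * g"
  proof -
    have "real (card (index_set n RE)) * (2 powr (real n * (IY + \<delta>)) * (real n + 1) ^ card FUY * 2 powr (- real n * r2)
         * ln (real (card (seqs n :: (nat \<Rightarrow> 's) set))) / NK)
      \<le> 2 powr (real n * RE) * (2 powr (real n * (IY + \<delta>)) * (real n + 1) ^ card FUY * 2 powr (- real n * r2)
         * (real n * lnS) / (2 powr (real n * (R1 + Rc1 + R')) / 8))"
      unfolding lnseqs using cE NKge NK(2) lnS
      by (intro mult_mono divide_left_mono mult_nonneg_nonneg divide_nonneg_nonneg mult_pos_pos) auto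
    also have "\<dots> = 8 * lnS * ((real n * (real n + 1) ^ card FUY) * 2 powr (real n * (RE + (IY + \<delta>) - r2 - (R1 + Rc1 + R'))))"
      by (simp add: powr_add powr_diff powr_minus field_simps)
    also have "\<dots> \<le> 8 * lnS * ((real n + 1) ^ K * 2 powr (- real n * x))"
    proof (intro mult_left_mono mult_mono mono x(5))
      have "real n * (real n + 1) ^ card FUY \<le> (real n + 1) ^ (card FUY + 1)" by (simp add: mult_right_mono)
      also have "\<dots> \<le> (real n + 1) ^ K" by (rule power_increasing[OF K(1)]) simp
      finally show "real n * (real n + 1) ^ card FUY \<le> (real n + 1) ^ K" .
    qed (use lnS in auto)
    finally show ?thesis by (simp add: g_def)
  qed
  have T5: "real (card (index_set n RE)) * (2 * ((real n + 1) ^ card FY * 2 powr (- real n * r1))) \<le> 2 * g"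
  proof -
    have "real (card (index_set n RE)) * (2 * ((real n + 1) ^ card FY * 2 powr (- real n * r1)))
      \<le> 2 powr (real n * RE) * (2 * ((real n + 1) ^ card FY * 2 powr (- real n * r1)))"
      using cE by (intro mult_right_mono) auto
    also have "\<dots> = 2 * ((real n + 1) ^ card FY * 2 powr (real n * (RE - r1)))"
      by (simp add: powr_diff powr_minus algebra_simps divide_inverse)
    also have "\<dots> \<le> 2 * ((real n + 1) ^ K * 2 powr (- real n * x))"
      by (intro mult_left_mono mult_mono mono x(6) power_increasing K(2)) auto
    finally show ?thesis by (simp add: g_def)
  qed
  show ?thesis
    using T1 T2 T3 T4 T5 unfolding g_def[symmetric] lnS_def[symmetric] distrib_left distrib_right by linarith
qed

end

section \<open>Choice of rates and slacks\<close>

context single_letter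
begin

lemma achievable_with_slack:
  fixes d :: "'s \<Rightarrow> 's \<Rightarrow> real"
  assumes d: "\<And>a b. 0 \<le> d a b" and RE: "RE \<ge> 0" and marginal: "pT1 = map_pmf snd P"
    and R: "R \<ge> 0" "R \<le> expec Q \<phi>Y - expec Q \<phi>E"
    and Rc: "Rc \<ge> 0" "Rc \<ge> expec Q \<phi>T - expec Q \<phi>Y"
    and D: "expec Q (\<phi>D d) \<le> D"
    and DE1: "ereal DE \<le> cond_distortion_rate d RE QTY"
    and DE2: "RE > Rc \<Longrightarrow> ereal DE \<le> cond_distortion_rate d (RE - Rc) QTUY"
    and DE0: "DE \<ge> 0" and \<eta>: "\<eta> > 0"
  shows "achievable P W d RE (D + \<eta>) (DE - \<eta>) (max 0 (R - \<eta>)) (Rc + \<eta>)"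
proof -
  let ?a = "expec Q \<phi>Y" and ?b = "expec Q \<phi>E" and ?c = "expec Q \<phi>T"
  define R1 where "R1 = max 0 (R - \<eta>)"
  \<comment> \<open>For \<open>R1 > 0\<close> the sum \<open>R1 + R'\<close> lies
    \<open>\<eta> / 4\<close> below I(U;Y), for decoding, while lowering \<open>R\<close> by
    \<open>\<eta>\<close> leaves \<open>R'\<close> at least \<open>3 * \<eta> / 4\<close> above
    I(U;S_e). For \<open>R1 = 0\<close> it exceeds I(U;Y), hence I(U;S_e), by
    \<open>\<eta> / 4\<close>.\<close>
  define R' where "R' = (if R1 = 0 then ?a + \<eta> / 4 else ?a - R1 - \<eta> / 4)"
  have b0: "0 \<le> ?b" unfolding mutual_info_UE[symmetric] by (rule mutual_info_nonneg[OF finite_Q])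
  have R'b: "R' \<ge> ?b + \<eta> / 4" and R1R': "R1 + R' \<ge> ?a - \<eta> / 4"
    using R \<eta> by (auto simp: R'_def R1_def max_def split: if_splits)
  have R'0: "R' \<ge> 0" using R'b b0 \<eta> by simp
  have finQ: "finite (set_pmf QTY)" "finite (set_pmf QTUY)"
    using finite_Q by (auto simp: QTY_def QTUY_def)
  obtain \<epsilon>1 where \<epsilon>1: "\<epsilon>1 > 0" "\<And>n \<delta>. n > 0 \<Longrightarrow> \<delta> \<le> \<epsilon>1 \<Longrightarrow> rate_bound d n (DE - \<eta> / 2) \<delta> QTY (RE + \<epsilon>1)"
    using rate_bound_exists[OF finQ(1) RE DE1, of "\<eta> / 2"] \<eta> by auto
  obtain \<epsilon>2 where \<epsilon>2: "\<epsilon>2 > 0"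
    "\<And>n \<delta>. RE > Rc \<Longrightarrow> n > 0 \<Longrightarrow> \<delta> \<le> \<epsilon>2 \<Longrightarrow> rate_bound d n (DE - \<eta> / 2) \<delta> QTUY (RE - Rc + \<epsilon>2)"
  proof (cases "RE > Rc")
    case True
    then have "RE - Rc \<ge> 0" by simp
    from rate_bound_exists[OF finQ(2) this DE2[OF True], of "\<eta> / 2"] \<eta> that show ?thesis by auto
  next
    case False
    then show ?thesis using that[of 1] by auto
  qed
  \<comment> \<open>If \<open>RE \<le> Rc\<close>, the common randomness of rate
    \<open>Rc + \<eta>\<close> already outweighs the henchman, and no gain given
    \<open>(u, y)\<close> is required.\<close>
  define r2 where "r2 = (if RE > Rc then RE - Rc + \<epsilon>2 else 0)"
  \<comment> \<open>The tightest constraint is the covering of \<open>e\<close>: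
    \<open>\<delta> - \<eta> / 4 \<le> - 2 * x\<close> holds with \<open>\<eta> / 8\<close> for
    \<open>\<delta>\<close> and \<open>\<eta> / 16\<close> for \<open>x\<close>.\<close>
  define \<delta> where "\<delta> = min (min \<epsilon>1 \<epsilon>2) (\<eta> / 8)"
  define x where "x = min \<epsilon>1 (\<eta> / 16)"
  have \<delta>: "\<delta> > 0" "\<delta> \<le> \<epsilon>1" "\<delta> \<le> \<epsilon>2" "\<delta> \<le> \<eta> / 8" using \<epsilon>1 \<epsilon>2 \<eta> by (auto simp: \<delta>_def)
  have x: "x > 0" "x \<le> \<epsilon>1" "x \<le> \<eta> / 16" using \<epsilon>1 \<eta> by (auto simp: x_def)
  define dmax where "dmax = Max (range (\<lambda>(a, b). d a b))"
  have dmax: "d a b \<le> dmax" for a b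
    unfolding dmax_def by (rule Max_ge) (auto intro: rev_image_eqI[of "(a, b)"])
  have dmax0: "0 \<le> dmax" using d dmax order_trans by blast
  define K where "K = card ((UNIV :: 's set) \<times> snd ` set_pmf QTUY \<times> (UNIV :: 's set)) + 1
     + card ((UNIV :: 's set) \<times> snd ` set_pmf QTY \<times> (UNIV :: 's set))"
  define cst where "cst = 13 + 8 * ln (real CARD('s))"
  have "\<forall>\<^sub>F n in sequentially. \<exists>c. good_code P W d RE n R1 (Rc + \<eta>) \<epsilon> (D + \<eta>) (DE - \<eta>) c"
    if \<epsilon>: "\<epsilon> > 0" for \<epsilon>
  proof -
    \<comment> \<open>Both the distortion and the security target may lose \<open>\<eta> / 2\<close>
      through \<open>2 * \<epsilon>'\<close>; adding one to \<open>dmax\<close> and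
      \<open>DE\<close> keeps the denominators positive.\<close>
    define \<epsilon>' where "\<epsilon>' = min \<epsilon> (min (\<eta> / (4 * (dmax + 1))) (\<eta> / (4 * (DE + 1))))"
    have \<epsilon>': "\<epsilon>' > 0" "\<epsilon>' \<le> \<epsilon>" "\<epsilon>' \<le> \<eta> / (4 * (dmax + 1))" "\<epsilon>' \<le> \<eta> / (4 * (DE + 1))"
      using \<epsilon> \<eta> dmax0 DE0 by (auto simp: \<epsilon>'_def)
    have ed: "dmax * (2 * \<epsilon>') \<le> \<eta> / 2"
    proof -
      have "(dmax + 1) * \<epsilon>' \<le> \<eta> / 4" using \<epsilon>'(3) dmax0 by (simp add: field_simps)
      then show ?thesis using \<epsilon>'(1) by (simp add: algebra_simps)
    qed
    have eDE: "DE * (2 * \<epsilon>') \<le> \<eta> / 2"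
    proof -
      have "(DE + 1) * \<epsilon>' \<le> \<eta> / 4" using \<epsilon>'(4) DE0 by (simp add: field_simps)
      then show ?thesis using \<epsilon>'(1) by (simp add: algebra_simps)
    qed
    have "(\<lambda>n. cst * ((real n + 1) ^ K * 2 powr (- real n * x))) \<longlonglongrightarrow> cst * 0"
      by (intro tendsto_mult tendsto_const poly_exp_tendsto_0 x)
    then have "\<forall>\<^sub>F n in sequentially. cst * ((real n + 1) ^ K * 2 powr (- real n * x)) < \<epsilon>' / 2"
      by (rule order_tendstoD) (use \<epsilon>' in simp)
    \<comment> \<open>Multiplied by the 6 of \<open>codebook_exists\<close>, this is the second half
      of the budget \<open>\<epsilon>'\<close>.\<close>
    moreover have "\<forall>\<^sub>F n in sequentially. prb (iid n Q)
        {w. \<exists>\<phi>\<in>tests d. \<bar>(\<Sum>i<n. \<phi> (w i)) / real n - expec Q \<phi>\<bar> > \<delta>} \<le> \<epsilon>' / 12"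
      by (rule eventually_weak_law[OF finite_Q finite_tests \<delta>(1)]) (use \<epsilon>' in simp)
    ultimately show ?thesis using eventually_gt_at_top[of 0]
    proof eventually_elim
      case (elim n)
      have r0: "R1 \<ge> 0" "Rc + \<eta> \<ge> 0" using Rc \<eta> by (auto simp: R1_def)
      interpret nl: n_letter P W PU PX PT n "index_set n R1" "index_set n (Rc + \<eta>)" "index_set n R'"
        by unfold_locales (use index_set_card[OF r0(1)] index_set_card[OF r0(2)] index_set_card[OF R'0] in auto)
      have rb2: "r2 \<le> 0 \<or> rate_bound d n (DE - \<eta> / 2) \<delta> QTUY r2"
        using \<epsilon>2(2)[of n \<delta>] elim(3) \<delta> by (auto simp: r2_def)
      have rb1: "rate_bound d n (DE - \<eta> / 2) \<delta> QTY (RE + \<epsilon>1)" using \<epsilon>1(2)[of n \<delta>] elim(3) \<delta> by auto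
      obtain C where C: "C \<in> set_pmf nl.books" and
        defect: "nl.defect d \<delta> (DE - \<eta> / 2) (card (index_set n RE)) C \<le>
          nl.defect_bound \<delta> (RE + \<epsilon>1) r2 (card (index_set n RE))
      + 6 * prb (iid n Q) (nl.atyp d \<delta>)"
        using nl.codebook_exists[OF elim(3) rb2 rb1, of "card (index_set n RE)"] by (elim bexE)
      note defect
      also have "nl.defect_bound \<delta> (RE + \<epsilon>1) r2 (card (index_set n RE))
        \<le> cst * ((real n + 1) ^ K * 2 powr (- real n * x))"
        unfolding cst_def
      proof (rule nl.defect_bound_le[OF elim(3) refl refl refl r0 R'0 RE])
        show "nl.IE + \<delta> - R' \<le> - 2 * x" unfolding nl.IE_def using R'b \<delta> x by linarith
        show "nl.IT + \<delta> - (R1 + (Rc + \<eta>) + R') \<le> - 2 * x" unfolding nl.IT_def using R1R' Rc \<delta> x by linarith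
        show "R1 = 0 \<or> R1 + R' - (nl.IY - \<delta>) \<le> - x" unfolding nl.IY_def R'_def using \<delta> x by auto
        show "RE + (nl.IY + \<delta>) - r2 - (R1 + (Rc + \<eta>) + R') \<le> - x"
          unfolding nl.IY_def r2_def using R1R' \<delta> x \<epsilon>2(1) by auto
        show "card nl.FUY + 1 \<le> K" "card nl.FY \<le> K" by (auto simp: K_def nl.FUY_def nl.FY_def)
      qed (use x in auto)
      finally have defect_le: "nl.defect d \<delta> (DE - \<eta> / 2) (card (index_set n RE)) C \<le> \<epsilon>'"
        using elim(1,2) unfolding nl.atyp_def by linarith
      have "DE - \<eta> \<le> 0 \<or> DE - \<eta> \<le> (DE - \<eta> / 2) * (1 - 2 * \<epsilon>') \<and> 0 \<le> DE - \<eta> / 2"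
      proof (cases "DE - \<eta> \<le> 0")
        case False
        have "(DE - \<eta> / 2) * (1 - 2 * \<epsilon>') = DE - \<eta> / 2 - DE * (2 * \<epsilon>') + \<eta> * \<epsilon>'" by (simp add: algebra_simps)
        moreover have "\<eta> * \<epsilon>' \<ge> 0" using \<eta> \<epsilon>' by simp
        ultimately show ?thesis using eDE False \<eta> by linarith
      qed simp
      moreover have "expec Q (\<phi>D d) + \<delta> + dmax * (2 * \<epsilon>') \<le> D + \<eta>"
        using D ed \<delta> \<eta> by linarith
      ultimately show ?case
        by (intro nl.rand_code_performance[OF C elim(3) less_imp_le[OF \<delta>(1)] refl refl refl index_set_card(1)[OF RE]
            marginal d dmax defect_le \<epsilon>'(2)])
    qed
  qed
  then show ?thesis unfolding achievable_good_code R1_def[symmetric] using Rc \<eta> by (auto simp: R1_def)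
qed

end

text \<open>The closure absorbs the slack: let \<open>\<eta>\<close> run through 1 / (k + 1). The
  truncation \<open>max 0\<close> keeps the message rate admissible and disappears in the limit
  because \<open>R\<close> is nonnegative.\<close>

lemma mem_capacity_distortion_regionI:
  assumes "\<And>\<eta>. \<eta> > 0 \<Longrightarrow> achievable P W d RE (D + \<eta>) (DE - \<eta>) (max 0 (R - \<eta>)) (Rc + \<eta>)" and R: "R \<ge> 0"
  shows "(R, Rc) \<in> capacity_distortion_region P W d RE D DE"
proof -
  have "(R, Rc, D, DE) \<in> closure {(R', Rc', D', DE'). achievable P W d RE D' DE' R' Rc'}"
  proof (rule iffD2[OF closure_sequential], intro exI conjI allI)
    let ?f = "\<lambda>k. (max 0 (R - inverse (real (Suc k))), Rc + inverse (real (Suc k)), D + inverse (real (Suc k)), DE - inverse (real (Suc k)))"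
    show "?f k \<in> {(R', Rc', D', DE'). achievable P W d RE D' DE' R' Rc'}" for k using assms(1) by simp
    have "?f \<longlonglongrightarrow> (max 0 (R - 0), Rc + 0, D + 0, DE - 0)"
      by (intro tendsto_Pair tendsto_max tendsto_add tendsto_diff tendsto_const LIMSEQ_inverse_real_of_nat)
    then show "?f \<longlonglongrightarrow> (R, Rc, D, DE)" using R by simp
  qed
  then show ?thesis by (simp add: capacity_distortion_region_def)
qed

theorem theorem3:
  fixes P :: "('e::finite \<times> 's::finite) pmf"
    and W :: "'x::finite \<Rightarrow> 's \<Rightarrow> ('y::finite \<times> 'z::finite) pmf"
    and d :: "'s \<Rightarrow> 's \<Rightarrow> real"
    and RE D DE :: real
  assumes "\<And>a b. d a b \<ge> 0"
    and "RE \<ge> 0" and "D \<ge> 0" and "DE \<ge> 0"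
  shows "inner_region P W d RE D DE \<subseteq> capacity_distortion_region P W d RE D DE"
proof
  fix p assume "p \<in> inner_region P W d RE D DE"
  then obtain R Rc Q where p: "p = (R, Rc)" and RRc: "R \<ge> 0" "Rc \<ge> 0" and Q: "Q \<in> single_letter_laws P W"
    and R: "R \<le> mutual_info Q (\<lambda>(se, s, u, x, y, z, sh). u) (\<lambda>(se, s, u, x, y, z, sh). y)
       - mutual_info Q (\<lambda>(se, s, u, x, y, z, sh). u) (\<lambda>(se, s, u, x, y, z, sh). se)"
    and Rc: "Rc \<ge> max (mutual_info Q (\<lambda>(se, s, u, x, y, z, sh). u) (\<lambda>(se, s, u, x, y, z, sh). sh)
       - mutual_info Q (\<lambda>(se, s, u, x, y, z, sh). u) (\<lambda>(se, s, u, x, y, z, sh). y)) 0"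
    and D: "D \<ge> expec Q (\<lambda>(se, s, u, x, y, z, sh). d s sh)"
    and DE: "ereal DE \<le> (if RE < Rc
       then cond_distortion_rate d RE (map_pmf (\<lambda>(se, s, u, x, y, z, sh). (sh, y)) Q)
       else min (cond_distortion_rate d RE (map_pmf (\<lambda>(se, s, u, x, y, z, sh). (sh, y)) Q))
         (cond_distortion_rate d (RE - Rc) (map_pmf (\<lambda>(se, s, u, x, y, z, sh). (sh, (u, y))) Q)))"
    unfolding inner_region_def Let_def by blast
  obtain PU PX PT where finU: "finite (\<Union>e. set_pmf (PU e))"
    and Qdef: "Q = do { (se, s) \<leftarrow> P; u \<leftarrow> PU se; x \<leftarrow> PX u se; (y, z) \<leftarrow> W x s; sh \<leftarrow> PT x se z; return_pmf (se, s, u, x, y, z, sh) }"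
    and marg: "map_pmf (\<lambda>(se, s, u, x, y, z, sh). sh) Q = map_pmf snd P"
    using Q unfolding single_letter_laws_def by blast
  interpret sl: single_letter P W PU PX PT by unfold_locales (rule finU)
  have QQ: "Q = sl.Q" unfolding Qdef sl.Q_def ..
  \<comment> \<open>The marginal constraint on the single-letter laws: it makes the target of the
    repair kernel the required i.i.d. state law.\<close>
  have marginal: "sl.pT1 = map_pmf snd P"
    unfolding marg[symmetric] QQ sl.Q_out1 sl.pT1_def sl.VT1_def[abs_def]
    by (simp add: map_pmf_def bind_assoc_pmf bind_return_pmf case_prod_unfold)
  have "(R, Rc) \<in> capacity_distortion_region P W d RE D DE"
  proof (rule mem_capacity_distortion_regionI)
    fix \<eta> :: real assume \<eta>: "\<eta> > 0"
    show "achievable P W d RE (D + \<eta>) (DE - \<eta>) (max 0 (R - \<eta>)) (Rc + \<eta>)"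
    proof (rule sl.achievable_with_slack[OF assms(1,2) marginal RRc(1) _ RRc(2) _ _ _ _ assms(4) \<eta>])
      show "R \<le> expec sl.Q sl.\<phi>Y - expec sl.Q sl.\<phi>E"
        using R unfolding QQ sl.mutual_info_UY sl.mutual_info_UE .
      show "expec sl.Q sl.\<phi>T - expec sl.Q sl.\<phi>Y \<le> Rc"
        using Rc unfolding QQ sl.mutual_info_UY sl.mutual_info_UT by simp
      show "expec sl.Q (sl.\<phi>D d) \<le> D" using D unfolding QQ sl.\<phi>D_def .
      show "ereal DE \<le> cond_distortion_rate d RE sl.QTY"
        using DE unfolding QQ sl.QTY_def by (auto split: if_splits)
      show "ereal DE \<le> cond_distortion_rate d (RE - Rc) sl.QTUY" if "RE > Rc"
        using DE that unfolding QQ sl.QTUY_def by (auto split: if_splits)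
    qed
  qed (rule RRc(1))
  then show "p \<in> capacity_distortion_region P W d RE D DE" by (simp add: p)
qed

end
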